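(* There exists a constant $\check l>0$ such that for any $n\ge1$, any $0<\delta<1/2$, any $Q\in\mathcal Q_n$ and any $S$, the model selection estimator $S^*$ satisfies the oracle inequality $$\mathcal R_Q(S^*,S)\le\frac{1+5\delta}{1-\delta}\min_{\lambda\in\Lambda}\mathcal R_Q(S^*_\lambda,S)+\check l\,\frac{\Psi_{Q,n}}{n\delta}+\frac{12\,|\Lambda|_n\,\mathbf E_Q|\widehat\sigma_n-\sigma|}{n},$$ where $\Psi_{Q,n}=(1+\overline\phi_n^4)(1+\sigma)(1+c_n^* )\,\nu_n$.
   Context: Model. Let $\Pi$ be a fixed positive (Lévy) measure on $\mathbb R_0=\mathbb R\setminus\{0\}$ with $\int x^2\,\Pi(dx)=1$ and $\int x^6\,\Pi(dx)<\infty$ ($\Pi(\mathbb R_0)=+\infty$ is allowed). Let $(w_t)$ be a standard Brownian motion and $\mu(ds\,dx)$ a jump (Poisson random) measure independent of $w$ with deterministic compensator $\widetilde\mu(ds\,dx)=ds\,\Pi(dx)$. Put $z_t=\int_0^t\int_{\mathbb R_0}x\,(\mu-\widetilde\mu)(ds\,dx)$ and $\xi_t=\sigma_1w_t+\sigma_2z_t$ with constants $\sigma_1,\sigma_2$. One observes $(y_t)_{0\le t\le n}$ with $dy_t=S(t)\,dt+d\xi_t$, where $S:\mathbb R\to\mathbb R$ is an unknown 1-periodic function, square integrable on $[0,1]$. $Q$ denotes the law of $(\xi_t)_{0\le t\le n}$ on the Skorokhod space $D[0,n]$, and $\mathcal Q_n$ is the family of all such laws with $0<\underline\sigma_n\le\sigma_1^2$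 and $\sigma:=\sigma_1^2+\sigma_2^2\le\overline\sigma_n$, where $0<\underline\sigma_n\le\overline\sigma_n$ are given and satisfy, for every $\epsilon>0$, $\liminf_{n\to\infty} n^{\epsilon}\underline\sigma_n>0$ and $\lim_{n\to\infty} n^{-\epsilon}\overline\sigma_n=0$. $\mathbf E_{Q,S}$ (also written $\mathbf E_Q$) is the expectation under the law of $y$ for noise law $Q$ and signal $S$; $\|S\|^2=\int_0^1S^2(t)\,dt$; for an estimator $\widehat S$, $\mathcal R_Q(\widehat S,S)=\mathbf E_{Q,S}\|\widehat S-S\|^2$. Estimators. $(\phi_j)_{j\ge1}$ is an orthonormal basis of $L_2[0,1]$, extended 1-periodically to $\mathbb R$, with $\sup_{1\le j\le n}\sup_{0\le t\le1}|\phi_j(t)|\le\overline\phi_n<\infty$. $\widehat\theta_j=\frac1n\int_0^n\phi_j(t)\,dy_t$. $\Lambda\subset[0,1]^n$ is a finite set of weight vectors $\lambda=(\lambda(j))_{1\le j\le n}$ such that for every $\lambda\in\Lambda$ there is an integer $d=d(\lambda)$, $1\le d\le n$, with $\lambda(j)=1$ for $1\le j\le d$. Put $\nu_n=\mathrm{card}(\Lambda)$ and $|\Lambda|_n=\max_{\lambda\in\Lambda}\sum_{j=1}^n\lambda(j)$. The shrinkage estimator is $S^*_\lambda=\sum_{j=1}^n\lambda(j)\theta^*_{\lambda,j}\phi_j$ with $\theta^*_{\lambda,j}=(1-g_\lambda(j))\widehat\theta_j$, $g_\lambda(j)=\frac{c_n(\lambda)}{|\widetilde\theta_n|_d}\mathbf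 1_{\{1\le j\le d\}}$, $\widetilde\theta_n=(\widehat\theta_j)_{1\le j\le d}$, $|x|_d^2=\sum_{j=1}^dx_j^2$, and $c_n(\lambda)=\frac{(d-1)\underline\sigma_n}{(r_n+\sqrt{d\,\overline\sigma_n/n})\,n}$, where $r_n>0$ satisfies $r_n\to\infty$ and $r_n/n^{\epsilon}\to0$ for every $\epsilon>0$. Put $c_n^*=n\max_{\lambda\in\Lambda}c_n^2(\lambda)$. Model selection procedure. Let $\mathrm{Tr}_1\equiv1$ and, for $j\ge2$, $\mathrm{Tr}_j(x)=\sqrt2\cos(2\pi[j/2]x)$ for even $j$, $\mathrm{Tr}_j(x)=\sqrt2\sin(2\pi[j/2]x)$ for odd $j$ ($[a]$ is the integer part of $a$). Let $\widehat\sigma_n=\sum_{j=[\sqrt n]+1}^n\widehat t_j^{\,2}$ with $\widehat t_j=\frac1n\int_0^n\mathrm{Tr}_j(t)\,dy_t$. For $\delta>0$ let $$J_n(\lambda)=\sum_{j=1}^n\lambda^2(j)(\theta^*_{\lambda,j})^2-2\sum_{j=1}^n\lambda(j)\Big(\theta^*_{\lambda,j}\widehat\theta_j-\frac{\widehat\sigma_n}n\Big)+\delta\,\frac{\widehat\sigma_n|\lambda|_n^2}{n},\qquad|\lambda|_n^2=\sum_{j=1}^n\lambda^2(j),$$ and $S^*=S^*_{\lambda^*}$ with $\lambda^*\in\operatorname{argmin}_{\lambda\in\Lambda}J_n(\lambda)$ (any minimizer). *)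

theory Defs
  imports "HOL-Probability.Probability"
begin

section \<open>The space \<open>L\<^sub>2[0,1]\<close>\<close>

definition L2_unit :: "(real \<Rightarrow> real) \<Rightarrow> bool" where
  "L2_unit f \<longleftrightarrow> f \<in> borel_measurable (lebesgue_on {0..1}) \<and>
     integrable (lebesgue_on {0..1}) (\<lambda>t. (f t)\<^sup>2)"

definition inner_unit :: "(real \<Rightarrow> real) \<Rightarrow> (real \<Rightarrow> real) \<Rightarrow> real" where
  "inner_unit f g = (\<integral>t. f t * g t \<partial>lebesgue_on {0..1})"

definition norm2_unit :: "(real \<Rightarrow> real) \<Rightarrow> real" where
  "norm2_unit f = (\<integral>t. (f t)\<^sup>2 \<partial>lebesgue_on {0..1})"

definition periodic1 :: "(real \<Rightarrow> real) \<Rightarrow> bool" where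
  "periodic1 f \<longleftrightarrow> (\<forall>t. f (t + 1) = f t)"

text \<open>Indices start at 1; the value \<open>\<phi> 0\<close> is never used.\<close>

definition orthonormal_basis_unit :: "(nat \<Rightarrow> real \<Rightarrow> real) \<Rightarrow> bool" where
  "orthonormal_basis_unit \<phi> \<longleftrightarrow>
     (\<forall>j\<ge>1. L2_unit (\<phi> j)) \<and>
     (\<forall>i\<ge>1. \<forall>j\<ge>1. inner_unit (\<phi> i) (\<phi> j) = (if i = j then 1 else 0)) \<and>
     (\<forall>f. L2_unit f \<longrightarrow>
        (\<lambda>m. norm2_unit (\<lambda>t. f t - (\<Sum>j=1..m. inner_unit f (\<phi> j) * \<phi> j t))) \<longlonglongrightarrow> 0)"

definition trig :: "nat \<Rightarrow> real \<Rightarrow> real" where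
  "trig j x = (if j = 1 then 1
     else if even j then sqrt 2 * cos (2 * pi * real (j div 2) * x)
     else sqrt 2 * sin (2 * pi * real (j div 2) * x))"


section \<open>Driving noise\<close>

definition brownian_motion :: "'a measure \<Rightarrow> (real \<Rightarrow> 'a \<Rightarrow> real) \<Rightarrow> bool" where
  "brownian_motion M w \<longleftrightarrow>
     (\<forall>t\<ge>0. w t \<in> borel_measurable M) \<and>
     (\<forall>\<omega>\<in>space M. w 0 \<omega> = 0 \<and> continuous_on {0..} (\<lambda>t. w t \<omega>)) \<and>
     (\<forall>s t. 0 \<le> s \<longrightarrow> s < t \<longrightarrow>
        distributed M lborel (\<lambda>\<omega>. w t \<omega> - w s \<omega>)
          (\<lambda>x. ennreal (normal_density 0 (sqrt (t - s)) x))) \<and>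
     (\<forall>(m::nat) \<tau>. 0 \<le> \<tau> 0 \<longrightarrow> mono \<tau> \<longrightarrow>
        prob_space.indep_vars M (\<lambda>_. borel)
          (\<lambda>i \<omega>. w (\<tau> (Suc i)) \<omega> - w (\<tau> i) \<omega>) {..<m})"

text \<open>The measure \<open>\<nu>\<close> on the punctured line is a Borel measure on the line not charging 0.\<close>

definition levy_measure :: "real measure \<Rightarrow> bool" where
  "levy_measure \<nu> \<longleftrightarrow>
     sets \<nu> = sets borel \<and> emeasure \<nu> {0} = 0 \<and>
     (\<integral>\<^sup>+x. ennreal (x ^ 2) \<partial>\<nu>) = 1 \<and> (\<integral>\<^sup>+x. ennreal (x ^ 6) \<partial>\<nu>) < \<infinity>"

definition poisson_random_measure :: "'a measure \<Rightarrow> 'b measure \<Rightarrow> ('a \<Rightarrow> 'b measure) \<Rightarrow> bool" where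
  "poisson_random_measure M \<eta> N \<longleftrightarrow>
     (\<forall>\<omega>\<in>space M. sets (N \<omega>) = sets \<eta>) \<and>
     (\<forall>A\<in>sets \<eta>. (\<lambda>\<omega>. emeasure (N \<omega>) A) \<in> borel_measurable M) \<and>
     (\<forall>A\<in>sets \<eta>. emeasure \<eta> A < \<infinity> \<longrightarrow>
        (\<forall>k::nat. measure M {\<omega>\<in>space M. emeasure (N \<omega>) A = of_nat k}
           = exp (- measure \<eta> A) * measure \<eta> A ^ k / fact k)) \<and>
     (\<forall>F. finite F \<longrightarrow> F \<subseteq> sets \<eta> \<longrightarrow> disjoint F \<longrightarrow>
        prob_space.indep_vars M (\<lambda>_. borel) (\<lambda>A \<omega>. emeasure (N \<omega>) A) F)"

text \<open>The compensator \<open>ds \<nu>(dx)\<close>, carried by positive times.\<close>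

definition jump_compensator :: "real measure \<Rightarrow> (real \<times> real) measure" where
  "jump_compensator \<nu> = density lborel (indicator {0<..}) \<Otimes>\<^sub>M \<nu>"

definition independent_bm_prm ::
  "'a measure \<Rightarrow> (real \<Rightarrow> 'a \<Rightarrow> real) \<Rightarrow> 'b measure \<Rightarrow> ('a \<Rightarrow> 'b measure) \<Rightarrow> bool" where
  "independent_bm_prm M w \<eta> N \<longleftrightarrow>
     prob_space.indep_set M
       (sets (vimage_algebra (space M) (\<lambda>\<omega>. \<lambda>t\<in>{0..}. w t \<omega>) (Pi\<^sub>M {0..} (\<lambda>_. borel))))
       (sets (vimage_algebra (space M) (\<lambda>\<omega>. \<lambda>A\<in>sets \<eta>. emeasure (N \<omega>) A)
         (Pi\<^sub>M (sets \<eta>) (\<lambda>_. borel))))"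

text \<open>
  Compensated sum of the jumps of size larger than \<open>\<epsilon>\<close> up to time \<open>t\<close>. The integral
  \<open>\<integral>\<^sub>0\<^sup>t \<integral> x (\<mu> - ds \<nu>(dx))\<close> is its limit in \<open>L\<^sub>2(M)\<close> as \<open>\<epsilon>\<close> decreases to 0, which makes
  sense also when \<open>\<nu>\<close> is infinite near 0.
\<close>

definition compensated_jumps ::
  "real measure \<Rightarrow> ('a \<Rightarrow> (real \<times> real) measure) \<Rightarrow> real \<Rightarrow> real \<Rightarrow> 'a \<Rightarrow> real" where
  "compensated_jumps \<nu> N \<epsilon> t \<omega> =
     (\<integral>p. indicator ({0<..t} \<times> {x. \<epsilon> < \<bar>x\<bar>}) p * snd p \<partial>N \<omega>)
     - t * (\<integral>x. indicator {x. \<epsilon> < \<bar>x\<bar>} x * x \<partial>\<nu>)"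

definition compensated_jump_integral ::
  "'a measure \<Rightarrow> real measure \<Rightarrow> ('a \<Rightarrow> (real \<times> real) measure) \<Rightarrow> real \<Rightarrow> ('a \<Rightarrow> real) \<Rightarrow> bool" where
  "compensated_jump_integral M \<nu> N t Z \<longleftrightarrow>
     Z \<in> borel_measurable M \<and>
     ((\<lambda>\<epsilon>. \<integral>\<^sup>+\<omega>. ennreal ((compensated_jumps \<nu> N \<epsilon> t \<omega> - Z \<omega>)\<^sup>2) \<partial>M) \<longlongrightarrow> 0) (at_right 0)"


section \<open>Path space, noise laws and observations\<close>

definition cadlag :: "real \<Rightarrow> (real \<Rightarrow> real) \<Rightarrow> bool" where
  "cadlag T x \<longleftrightarrow> (\<forall>t\<in>{0..<T}. (x \<longlongrightarrow> x t) (at_right t)) \<and>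
     (\<forall>t\<in>{0<..T}. \<exists>l. (x \<longlongrightarrow> l) (at_left t))"

text \<open>
  The measurable space \<open>D[0,T]\<close>. The Borel sets of the Skorokhod topology are generated by the
  coordinate maps, so they form the trace of the product sigma-algebra. Only the
  measurable structure matters; the measure carried by this object is irrelevant.
\<close>

definition skorokhod :: "real \<Rightarrow> (real \<Rightarrow> real) measure" where
  "skorokhod T = restrict_space (Pi\<^sub>M {0..T} (\<lambda>_. borel)) {x. cadlag T x}"

text \<open>
  \<open>noise_law \<nu> T \<sigma>\<^sub>1 \<sigma>\<^sub>2 Q\<close>: \<open>Q\<close> is the law on \<open>D[0,T]\<close> of \<open>\<xi> = \<sigma>\<^sub>1 w + \<sigma>\<^sub>2 z\<close>.
  As \<open>Q\<close> depends only on the joint law of \<open>w\<close> and \<open>\<mu>\<close>, the sample space may be taken to consist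
  of pairs of a path and a measure. A concrete type here prevents constants from
  depending on the type of the sample space.
\<close>

type_synonym sample = "(real \<Rightarrow> real) \<times> (real \<times> real) measure"

definition noise_law ::
  "real measure \<Rightarrow> real \<Rightarrow> real \<Rightarrow> real \<Rightarrow> (real \<Rightarrow> real) measure \<Rightarrow> bool" where
  "noise_law \<nu> T \<sigma>\<^sub>1 \<sigma>\<^sub>2 Q \<longleftrightarrow>
     (\<exists>(M :: sample measure) w \<mu> z.
        prob_space M \<and> brownian_motion M w \<and>
        poisson_random_measure M (jump_compensator \<nu>) \<mu> \<and>
        independent_bm_prm M w (jump_compensator \<nu>) \<mu> \<and>
        (\<forall>t\<in>{0..T}. compensated_jump_integral M \<nu> \<mu> t (z t)) \<and>
        (\<forall>\<omega>\<in>space M. cadlag T (\<lambda>t. z t \<omega>)) \<and>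
        Q = distr M (skorokhod T) (\<lambda>\<omega>. \<lambda>t\<in>{0..T}. \<sigma>\<^sub>1 * w t \<omega> + \<sigma>\<^sub>2 * z t \<omega>))"

text \<open>The law of \<open>y\<^sub>t = \<integral>\<^sub>0\<^sup>t S(s) ds + \<xi>\<^sub>t\<close> when \<open>\<xi>\<close> has law \<open>Q\<close>.\<close>

definition observation_law ::
  "real \<Rightarrow> (real \<Rightarrow> real) measure \<Rightarrow> (real \<Rightarrow> real) \<Rightarrow> (real \<Rightarrow> real) measure" where
  "observation_law T Q S =
     distr Q (skorokhod T) (\<lambda>x. \<lambda>t\<in>{0..T}. (\<integral>s. S s \<partial>lebesgue_on {0..t}) + x t)"


section \<open>Integrals of deterministic functions against the observed process\<close>

text \<open>
  Under a law \<open>P\<close> on \<open>D[0,T]\<close>, the integral over \<open>[0,T]\<close> of a square integrable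
  deterministic \<open>f\<close> against the coordinate process is the limit in \<open>L\<^sub>2(P)\<close> of the integrals of step
  functions converging to \<open>f\<close> in \<open>L\<^sub>2[0,T]\<close>. For \<open>dy = S dt + d\<xi>\<close> with \<open>S\<close> square integrable
  this is the usual stochastic integral; it is determined up to a \<open>P\<close>-null set.
\<close>

definition step_function :: "nat \<Rightarrow> (nat \<Rightarrow> real) \<Rightarrow> (nat \<Rightarrow> real) \<Rightarrow> real \<Rightarrow> real" where
  "step_function m \<tau> a t = (\<Sum>i<m. a i * indicator {\<tau> i<..\<tau> (Suc i)} t)"

definition step_integral :: "nat \<Rightarrow> (nat \<Rightarrow> real) \<Rightarrow> (nat \<Rightarrow> real) \<Rightarrow> (real \<Rightarrow> real) \<Rightarrow> real" where
  "step_integral m \<tau> a x = (\<Sum>i<m. a i * (x (\<tau> (Suc i)) - x (\<tau> i)))"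

definition has_stochastic_integral ::
  "(real \<Rightarrow> real) measure \<Rightarrow> real \<Rightarrow> (real \<Rightarrow> real) \<Rightarrow> ((real \<Rightarrow> real) \<Rightarrow> real) \<Rightarrow> bool" where
  "has_stochastic_integral P T f X \<longleftrightarrow>
     X \<in> borel_measurable P \<and>
     (\<exists>m \<tau> a.
        (\<forall>k::nat. mono_on {..m k} (\<tau> k) \<and> \<tau> k ` {..m k} \<subseteq> {0..T}) \<and>
        (\<lambda>k. \<integral>\<^sup>+t. ennreal ((step_function (m k) (\<tau> k) (a k) t - f t)\<^sup>2) \<partial>lebesgue_on {0..T})
          \<longlonglongrightarrow> 0 \<and>
        (\<lambda>k. \<integral>\<^sup>+x. ennreal ((step_integral (m k) (\<tau> k) (a k) x - X x)\<^sup>2) \<partial>P) \<longlonglongrightarrow> 0)"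

definition stochastic_integral ::
  "(real \<Rightarrow> real) measure \<Rightarrow> real \<Rightarrow> (real \<Rightarrow> real) \<Rightarrow> (real \<Rightarrow> real) \<Rightarrow> real" where
  "stochastic_integral P T f = (SOME X. has_stochastic_integral P T f X)"


section \<open>Estimators\<close>

text \<open>
  Everywhere below \<open>P\<close> is the law of the observed path \<open>y\<close> on \<open>D[0,n]\<close>; it only selects the
  versions of the stochastic integrals. Weight vectors are functions on \<open>{1..n}\<close>, and
  \<open>d lam\<close>, \<open>c lam\<close> are the number of shrunk coordinates and the shrinkage coefficient.
\<close>

definition coef_hat ::
  "(real \<Rightarrow> real) measure \<Rightarrow> nat \<Rightarrow> (nat \<Rightarrow> real \<Rightarrow> real) \<Rightarrow> nat \<Rightarrow> (real \<Rightarrow> real) \<Rightarrow> real" where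
  "coef_hat P n \<psi> j y = stochastic_integral P (real n) (\<psi> j) y / real n"

definition sigma_hat :: "(real \<Rightarrow> real) measure \<Rightarrow> nat \<Rightarrow> (real \<Rightarrow> real) \<Rightarrow> real" where
  "sigma_hat P n y = (\<Sum>j = nat \<lfloor>sqrt (real n)\<rfloor> + 1..n. (coef_hat P n trig j y)\<^sup>2)"

definition weight_family ::
  "nat \<Rightarrow> (nat \<Rightarrow> real) set \<Rightarrow> ((nat \<Rightarrow> real) \<Rightarrow> nat) \<Rightarrow> bool" where
  "weight_family n \<Lambda> d \<longleftrightarrow>
     finite \<Lambda> \<and> \<Lambda> \<noteq> {} \<and> \<Lambda> \<subseteq> {1..n} \<rightarrow>\<^sub>E {0..1} \<and>
     (\<forall>lam\<in>\<Lambda>. 1 \<le> d lam \<and> d lam \<le> n \<and> (\<forall>j\<in>{1..d lam}. lam j = 1))"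

definition shrinkage_coef :: "nat \<Rightarrow> real \<Rightarrow> real \<Rightarrow> real \<Rightarrow> nat \<Rightarrow> real" where
  "shrinkage_coef n \<sigma>low \<sigma>up r d =
     ((real d - 1) * \<sigma>low) / ((r + sqrt (real d * \<sigma>up / real n)) * real n)"

definition shrinkage_factor ::
  "(real \<Rightarrow> real) measure \<Rightarrow> nat \<Rightarrow> (nat \<Rightarrow> real \<Rightarrow> real) \<Rightarrow> ((nat \<Rightarrow> real) \<Rightarrow> real) \<Rightarrow>
   ((nat \<Rightarrow> real) \<Rightarrow> nat) \<Rightarrow> (nat \<Rightarrow> real) \<Rightarrow> nat \<Rightarrow> (real \<Rightarrow> real) \<Rightarrow> real" where
  "shrinkage_factor P n \<phi> c d lam j y =
     (if 1 \<le> j \<and> j \<le> d lam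
      then c lam / sqrt (\<Sum>i=1..d lam. (coef_hat P n \<phi> i y)\<^sup>2) else 0)"

definition coef_star ::
  "(real \<Rightarrow> real) measure \<Rightarrow> nat \<Rightarrow> (nat \<Rightarrow> real \<Rightarrow> real) \<Rightarrow> ((nat \<Rightarrow> real) \<Rightarrow> real) \<Rightarrow>
   ((nat \<Rightarrow> real) \<Rightarrow> nat) \<Rightarrow> (nat \<Rightarrow> real) \<Rightarrow> nat \<Rightarrow> (real \<Rightarrow> real) \<Rightarrow> real" where
  "coef_star P n \<phi> c d lam j y = (1 - shrinkage_factor P n \<phi> c d lam j y) * coef_hat P n \<phi> j y"

definition S_star ::
  "(real \<Rightarrow> real) measure \<Rightarrow> nat \<Rightarrow> (nat \<Rightarrow> real \<Rightarrow> real) \<Rightarrow> ((nat \<Rightarrow> real) \<Rightarrow> real) \<Rightarrow>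
   ((nat \<Rightarrow> real) \<Rightarrow> nat) \<Rightarrow> (nat \<Rightarrow> real) \<Rightarrow> (real \<Rightarrow> real) \<Rightarrow> real \<Rightarrow> real" where
  "S_star P n \<phi> c d lam y t = (\<Sum>j=1..n. lam j * coef_star P n \<phi> c d lam j y * \<phi> j t)"

definition selection_cost ::
  "(real \<Rightarrow> real) measure \<Rightarrow> nat \<Rightarrow> (nat \<Rightarrow> real \<Rightarrow> real) \<Rightarrow> ((nat \<Rightarrow> real) \<Rightarrow> real) \<Rightarrow>
   ((nat \<Rightarrow> real) \<Rightarrow> nat) \<Rightarrow> real \<Rightarrow> (nat \<Rightarrow> real) \<Rightarrow> (real \<Rightarrow> real) \<Rightarrow> real" where
  "selection_cost P n \<phi> c d \<delta> lam y =
     (\<Sum>j=1..n. (lam j)\<^sup>2 * (coef_star P n \<phi> c d lam j y)\<^sup>2)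
     - 2 * (\<Sum>j=1..n. lam j *
         (coef_star P n \<phi> c d lam j y * coef_hat P n \<phi> j y - sigma_hat P n y / real n))
     + \<delta> * (sigma_hat P n y * (\<Sum>j=1..n. (lam j)\<^sup>2) / real n)"

text \<open>
  Estimators depend on the observed path; the minimizer may fail on a null set because the
  stochastic integrals are only determined almost surely.
\<close>

definition selects_model ::
  "(real \<Rightarrow> real) measure \<Rightarrow> nat \<Rightarrow> (nat \<Rightarrow> real \<Rightarrow> real) \<Rightarrow> ((nat \<Rightarrow> real) \<Rightarrow> real) \<Rightarrow>
   ((nat \<Rightarrow> real) \<Rightarrow> nat) \<Rightarrow> real \<Rightarrow> (nat \<Rightarrow> real) set \<Rightarrow> ((real \<Rightarrow> real) \<Rightarrow> (nat \<Rightarrow> real)) \<Rightarrow> bool" where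
  "selects_model P n \<phi> c d \<delta> \<Lambda> lam_star \<longleftrightarrow>
     lam_star \<in> measurable P (count_space \<Lambda>) \<and>
     (AE y in P. is_arg_min (\<lambda>lam. selection_cost P n \<phi> c d \<delta> lam y) (\<lambda>lam. lam \<in> \<Lambda>) (lam_star y))"

definition risk ::
  "(real \<Rightarrow> real) measure \<Rightarrow> ((real \<Rightarrow> real) \<Rightarrow> real \<Rightarrow> real) \<Rightarrow> (real \<Rightarrow> real) \<Rightarrow> ennreal" where
  "risk P S_est S = (\<integral>\<^sup>+y. ennreal (norm2_unit (\<lambda>t. S_est y t - S t)) \<partial>P)"

definition c_star :: "nat \<Rightarrow> (nat \<Rightarrow> real) set \<Rightarrow> ((nat \<Rightarrow> real) \<Rightarrow> real) \<Rightarrow> real" where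
  "c_star n \<Lambda> c = real n * Max ((\<lambda>lam. (c lam)\<^sup>2) ` \<Lambda>)"

definition weight_size :: "nat \<Rightarrow> (nat \<Rightarrow> real) set \<Rightarrow> real" where
  "weight_size n \<Lambda> = Max ((\<lambda>lam. \<Sum>j=1..n. lam j) ` \<Lambda>)"

definition Psi :: "nat \<Rightarrow> real \<Rightarrow> real \<Rightarrow> (nat \<Rightarrow> real) set \<Rightarrow> ((nat \<Rightarrow> real) \<Rightarrow> real) \<Rightarrow> real" where
  "Psi n \<phi>bar \<sigma> \<Lambda> c =
     (1 + \<phi>bar ^ 4) * (1 + \<sigma>) * (1 + c_star n \<Lambda> c) * real (card \<Lambda>)"

end

theory Submission
  imports Defs
begin

text \<open>
  The increments of the noise over a partition are sums of independent centred variables (Brownian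
  part, compensated jumps larger than \<open>\<epsilon>\<close>, in the limit \<open>\<epsilon> \<rightarrow> 0\<close>) with controlled fourth
  moments, so the variances of their linear and quadratic forms are computed directly. By
  Fatou's lemma these bounds pass from step functions to the stochastic integrals of bounded
  functions, and hence to the errors \<open>e\<^sub>j\<close> of the empirical coefficients: the second moment of
  \<open>\<Sum>y\<^sub>j e\<^sub>j\<close> is at most \<open>\<sigma>/n \<Sum>y\<^sub>j\<^sup>2\<close>, and that of \<open>\<Sum>x\<^sub>j (e\<^sub>j\<^sup>2 - \<sigma>/n)\<close> at most a constant times
  \<open>(1 + \<phi>\<^sup>4) \<sigma>\<^sup>2/n\<^sup>2 \<Sum>x\<^sub>j\<^sup>2\<close>.

  The rest is pointwise. The cost of a weight differs from its loss by such forms and by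
  \<open>\<bar>\<sigma>\<^sub>n - \<sigma>\<bar>\<close>; a form is absorbed into a \<open>\<delta>\<close>-fraction of the bias and of the penalty, up to its
  square divided by its variance. The shrinkage changes the estimator by a vector of norm at most
  \<open>c\<close> and is absorbed in the same way, at the price of a multiple of \<open>c\<^sup>2\<close>. Summing the squares over
  the weights gives the factor \<open>\<nu>\<^sub>n / \<delta>\<close>.
\<close>

section \<open>Linear and quadratic forms of independent variables\<close>

text \<open>The obstacle is that \<open>stochastic_integral\<close> is a Hilbert choice: a version
  is known only through some step functions whose integrals converge to it in L2, and this says
  nothing about squares converging in L2. What is needed about the noise is therefore put into
  inequalities between second moments, the predicate \<open>forms_bound\<close>, which survive
  almost sure limits along subsequences; independence is used only for finitely many Gaussian
  increments and Poisson counts and is never carried to a limit. A fourth moment is recorded as 3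
  v^2 + u, so that u, the excess over the Gaussian value, is proportional to time like the variance;
  this brings the fourth moment of the Levy measure and the bound of the basis into the constant. In
  the comparison of weights the obstacle is that the selected weight is random, so that its error
  terms are no fixed forms. The inequalities are therefore proved pointwise for every weight, and
  the terms that cannot be absorbed are divided by the bias or by the variance of the weight, which
  bounds their expectations independently of the signal.\<close>

lemma (in prob_space) indep_vars_insert_mult:
  fixes X :: "'i \<Rightarrow> 'a \<Rightarrow> real" and f :: "real \<Rightarrow> real" and g :: "('i \<Rightarrow> real) \<Rightarrow> real"
  assumes ind: "indep_vars (\<lambda>_. borel) X (insert a I)" and a: "a \<notin> I"
    and f: "f \<in> borel_measurable borel"
    and g: "g \<in> borel_measurable (Pi\<^sub>M I (\<lambda>_. borel))"
    and fi: "integrable M (\<lambda>\<omega>. f (X a \<omega>))"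
    and gi: "integrable M (\<lambda>\<omega>. g (\<lambda>i\<in>I. X i \<omega>))"
  shows "integrable M (\<lambda>\<omega>. f (X a \<omega>) * g (\<lambda>i\<in>I. X i \<omega>))"
    and "expectation (\<lambda>\<omega>. f (X a \<omega>) * g (\<lambda>i\<in>I. X i \<omega>))
      = expectation (\<lambda>\<omega>. f (X a \<omega>)) * expectation (\<lambda>\<omega>. g (\<lambda>i\<in>I. X i \<omega>))"
proof -
  have "indep_var (Pi\<^sub>M {a} (\<lambda>_. borel)) (\<lambda>\<omega>. \<lambda>i\<in>{a}. X i \<omega>) (Pi\<^sub>M I (\<lambda>_. borel)) (\<lambda>\<omega>. \<lambda>i\<in>I. X i \<omega>)"
    by (rule indep_var_restrict[OF ind]) (use a in auto)
  then have "indep_var borel ((\<lambda>x. f (x a)) \<circ> (\<lambda>\<omega>. \<lambda>i\<in>{a}. X i \<omega>)) borel (g \<circ> (\<lambda>\<omega>. \<lambda>i\<in>I. X i \<omega>))"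
    by (rule indep_var_compose) (use f g in measurable)
  then have iv: "indep_var borel (\<lambda>\<omega>. f (X a \<omega>)) borel (\<lambda>\<omega>. g (\<lambda>i\<in>I. X i \<omega>))"
    by (simp add: o_def)
  show "integrable M (\<lambda>\<omega>. f (X a \<omega>) * g (\<lambda>i\<in>I. X i \<omega>))"
    by (rule indep_var_integrable[OF iv fi gi])
  show "expectation (\<lambda>\<omega>. f (X a \<omega>) * g (\<lambda>i\<in>I. X i \<omega>))
      = expectation (\<lambda>\<omega>. f (X a \<omega>)) * expectation (\<lambda>\<omega>. g (\<lambda>i\<in>I. X i \<omega>))"
    by (rule indep_var_lebesgue_integral[OF iv fi gi])
qed

lemma (in prob_space) integrable_power_le_4:
  fixes Y :: "'a \<Rightarrow> real"
  assumes [measurable]: "Y \<in> borel_measurable M" and "integrable M (\<lambda>\<omega>. Y \<omega> ^ 4)" and "k \<le> 4"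
  shows "integrable M (\<lambda>\<omega>. Y \<omega> ^ k)"
proof (rule Bochner_Integration.integrable_bound)
  show "integrable M (\<lambda>\<omega>. 1 + Y \<omega> ^ 4)" using assms by auto
  have "\<bar>x ^ k\<bar> \<le> 1 + x ^ 4" for x :: real
  proof (cases "\<bar>x\<bar> \<le> 1")
    case True
    then have "\<bar>x\<bar> ^ k \<le> 1" by (intro power_le_one) auto
    moreover have "0 \<le> x ^ 4" by (rule zero_le_even_power) simp
    ultimately show ?thesis unfolding power_abs by linarith
  next
    case False
    then have "\<bar>x\<bar> ^ k \<le> \<bar>x\<bar> ^ 4" using assms(3) by (intro power_increasing) auto
    then show ?thesis by (simp add: power_abs)
  qed
  then show "AE \<omega> in M. norm (Y \<omega> ^ k) \<le> norm (1 + Y \<omega> ^ 4)"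
    by (intro AE_I2) (use abs_ge_self order_trans in \<open>auto simp: real_norm_def\<close>)
qed simp

text \<open>The Gaussian fourth moment is 3 v^2, so \<open>u\<close> bounds the fourth cumulant. It
  is 0 for Brownian increments and equals the mean for centred Poisson counts, the two kinds of
  variables to which the locale is applied.\<close>

locale indep_centered = prob_space +
  fixes I :: "'i set" and X :: "'i \<Rightarrow> 'a \<Rightarrow> real" and v u :: "'i \<Rightarrow> real"
  assumes fin: "finite I" and ind: "indep_vars (\<lambda>_. borel) X I"
    and int4: "\<And>i. i \<in> I \<Longrightarrow> integrable M (\<lambda>\<omega>. X i \<omega> ^ 4)"
    and mean0: "\<And>i. i \<in> I \<Longrightarrow> expectation (X i) = 0"
    and var: "\<And>i. i \<in> I \<Longrightarrow> expectation (\<lambda>\<omega>. (X i \<omega>)\<^sup>2) = v i"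
    and mom4: "\<And>i. i \<in> I \<Longrightarrow> expectation (\<lambda>\<omega>. X i \<omega> ^ 4) \<le> 3 * (v i)\<^sup>2 + u i"
begin

lemma measurable_X: "i \<in> I \<Longrightarrow> X i \<in> borel_measurable M"
  using ind unfolding indep_vars_def by auto

lemma integrable_power: "i \<in> I \<Longrightarrow> k \<le> 4 \<Longrightarrow> integrable M (\<lambda>\<omega>. X i \<omega> ^ k)"
  by (rule integrable_power_le_4[OF measurable_X int4])

text \<open>Variables are added one at a time. The cross term is a product of independent centred
  factors, so the zero mean has to be carried through the induction together with the
  variance.\<close>

lemma linear_form:
  "integrable M (\<lambda>\<omega>. (\<Sum>i\<in>I. b i * X i \<omega>)\<^sup>2) \<and> integrable M (\<lambda>\<omega>. \<Sum>i\<in>I. b i * X i \<omega>) \<and>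
   expectation (\<lambda>\<omega>. \<Sum>i\<in>I. b i * X i \<omega>) = 0 \<and>
   expectation (\<lambda>\<omega>. (\<Sum>i\<in>I. b i * X i \<omega>)\<^sup>2) = (\<Sum>i\<in>I. (b i)\<^sup>2 * v i)"
proof -
  have "finite J \<Longrightarrow> J \<subseteq> I \<Longrightarrow>
   integrable M (\<lambda>\<omega>. (\<Sum>i\<in>J. b i * X i \<omega>)\<^sup>2) \<and> integrable M (\<lambda>\<omega>. \<Sum>i\<in>J. b i * X i \<omega>) \<and>
   expectation (\<lambda>\<omega>. \<Sum>i\<in>J. b i * X i \<omega>) = 0 \<and>
   expectation (\<lambda>\<omega>. (\<Sum>i\<in>J. b i * X i \<omega>)\<^sup>2) = (\<Sum>i\<in>J. (b i)\<^sup>2 * v i)" for J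
  proof (induction J rule: finite_induct)
    case (insert a J)
    define L where "L = (\<lambda>\<omega>. \<Sum>i\<in>J. b i * X i \<omega>)"
    have L: "integrable M (\<lambda>\<omega>. (L \<omega>)\<^sup>2)" "integrable M L" "expectation L = 0"
      "expectation (\<lambda>\<omega>. (L \<omega>)\<^sup>2) = (\<Sum>i\<in>J. (b i)\<^sup>2 * v i)"
      using insert unfolding L_def by auto
    have aI: "a \<in> I" using insert by auto
    have xa: "integrable M (X a)" "integrable M (\<lambda>\<omega>. (X a \<omega>)\<^sup>2)"
      using integrable_power[OF aI, of 1] integrable_power[OF aI, of 2] by auto
    have ind': "indep_vars (\<lambda>_. borel) X (insert a J)"
      by (rule indep_vars_subset[OF ind]) (use insert in auto)
    have eq: "(\<Sum>i\<in>J. b i * (\<lambda>i\<in>J. X i \<omega>) i) = L \<omega>" for \<omega>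
      unfolding L_def by (intro sum.cong) auto
    have mj: "(\<lambda>x. \<Sum>i\<in>J. b i * x i) \<in> borel_measurable (Pi\<^sub>M J (\<lambda>_. borel))"
      by (intro borel_measurable_sum borel_measurable_times borel_measurable_const measurable_component_singleton)
    note m = indep_vars_insert_mult[OF ind' \<open>a \<notin> J\<close> _ mj, of "\<lambda>x. x", simplified eq, OF _ xa(1) L(2)]
    have m1: "integrable M (\<lambda>\<omega>. X a \<omega> * L \<omega>)" "expectation (\<lambda>\<omega>. X a \<omega> * L \<omega>) = 0"
      using m L by auto
    have s1: "(\<Sum>i\<in>insert a J. b i * X i \<omega>) = b a * X a \<omega> + L \<omega>" for \<omega>
      using insert unfolding L_def by simp
    have s2: "(b a * X a \<omega> + L \<omega>)\<^sup>2 = (b a)\<^sup>2 * (X a \<omega>)\<^sup>2 + 2 * b a * (X a \<omega> * L \<omega>) + (L \<omega>)\<^sup>2" for \<omega>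
      by (simp add: power2_sum power_mult_distrib)
    show ?case
      unfolding s1 s2 using insert(1,2) xa L m1 mean0[OF aI] var[OF aI] by (simp add: mult.commute)
  qed auto
  from this[of I] fin show ?thesis by auto
qed

text \<open>Adding an index \<open>a\<close> changes the centred form from V to V + 2 X_a L + Q_aa
  (X_a^2 - v_a), with L linear in the older variables. The three summands are uncorrelated, so
  second moments add: 4 v_a times the variance of L, and Q_aa^2 times at most 2 v_a^2 + u_a.\<close>

lemma quadratic_form:
  fixes Q :: "'i \<Rightarrow> 'i \<Rightarrow> real"
  assumes sym: "\<And>i j. Q i j = Q j i"
  defines "W \<equiv> \<lambda>\<omega>. (\<Sum>i\<in>I. \<Sum>j\<in>I. Q i j * X i \<omega> * X j \<omega>) - (\<Sum>i\<in>I. Q i i * v i)"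
  shows "integrable M (\<lambda>\<omega>. (W \<omega>)\<^sup>2)" and
   "expectation (\<lambda>\<omega>. (W \<omega>)\<^sup>2) \<le> 2 * (\<Sum>i\<in>I. \<Sum>j\<in>I. (Q i j)\<^sup>2 * v i * v j) + (\<Sum>i\<in>I. (Q i i)\<^sup>2 * u i)"
proof -
  define w where "w = (\<lambda>J x. (\<Sum>i\<in>J. \<Sum>j\<in>J. Q i j * x i * x j) - (\<Sum>i\<in>J. Q i i * v i))"
  have "finite J \<Longrightarrow> J \<subseteq> I \<Longrightarrow>
    integrable M (\<lambda>\<omega>. (w J (\<lambda>i. X i \<omega>))\<^sup>2) \<and> integrable M (\<lambda>\<omega>. w J (\<lambda>i. X i \<omega>)) \<and>
    expectation (\<lambda>\<omega>. w J (\<lambda>i. X i \<omega>)) = 0 \<and>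
    expectation (\<lambda>\<omega>. (w J (\<lambda>i. X i \<omega>))\<^sup>2) \<le>
      2 * (\<Sum>i\<in>J. \<Sum>j\<in>J. (Q i j)\<^sup>2 * v i * v j) + (\<Sum>i\<in>J. (Q i i)\<^sup>2 * u i)" for J
  proof (induction J rule: finite_induct)
    case empty then show ?case by (simp add: w_def)
  next
    case (insert a J)
    define V where "V = (\<lambda>\<omega>. w J (\<lambda>i. X i \<omega>))"
    define L where "L = (\<lambda>\<omega>. \<Sum>i\<in>J. Q a i * X i \<omega>)"
    have V: "integrable M (\<lambda>\<omega>. (V \<omega>)\<^sup>2)" "integrable M V" "expectation V = 0"
      "expectation (\<lambda>\<omega>. (V \<omega>)\<^sup>2) \<le> 2 * (\<Sum>i\<in>J. \<Sum>j\<in>J. (Q i j)\<^sup>2 * v i * v j) + (\<Sum>i\<in>J. (Q i i)\<^sup>2 * u i)"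
      using insert unfolding V_def by auto
    interpret J: indep_centered M J X v u
      using insert indep_vars_subset[OF ind, of J] int4 mean0 var mom4
      by unfold_locales auto
    have L: "integrable M (\<lambda>\<omega>. (L \<omega>)\<^sup>2)" "integrable M L" "expectation L = 0"
      "expectation (\<lambda>\<omega>. (L \<omega>)\<^sup>2) = (\<Sum>i\<in>J. (Q a i)\<^sup>2 * v i)"
      using J.linear_form[of "Q a"] unfolding L_def by auto
    have [measurable]: "L \<in> borel_measurable M" "V \<in> borel_measurable M" using L V by auto
    have aI: "a \<in> I" using insert by auto
    note p = integrable_power[OF aI]
    have xa: "integrable M (X a)" "integrable M (\<lambda>\<omega>. (X a \<omega>)\<^sup>2)" "integrable M (\<lambda>\<omega>. X a \<omega> ^ 3)"
       "integrable M (\<lambda>\<omega>. X a \<omega> ^ 4)"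
      using p[of 1] p[of 2] p[of 3] p[of 4] by auto
    have [measurable]: "X a \<in> borel_measurable M" using measurable_X aI by auto
    have ind': "indep_vars (\<lambda>_. borel) X (insert a J)"
      by (rule indep_vars_subset[OF ind]) (use insert in auto)
    \<comment> \<open>\<open>L\<close> and \<open>V\<close> are built from the same variables, so
      independence does not help here; square integrability of both does.\<close>
    have VL: "integrable M (\<lambda>\<omega>. L \<omega> * V \<omega>)"
    proof (rule Bochner_Integration.integrable_bound)
      show "integrable M (\<lambda>\<omega>. (L \<omega>)\<^sup>2 + (V \<omega>)\<^sup>2)" using L V by auto
      have "\<bar>x * y\<bar> \<le> x\<^sup>2 + y\<^sup>2" for x y :: real
      proof -
        have "2 * \<bar>x * y\<bar> \<le> x\<^sup>2 + y\<^sup>2"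
          using sum_squares_bound[of "\<bar>x\<bar>" "\<bar>y\<bar>"] by (simp add: abs_mult mult.assoc)
        then show ?thesis using abs_ge_zero[of "x * y"] by linarith
      qed
      then show "AE \<omega> in M. norm (L \<omega> * V \<omega>) \<le> norm ((L \<omega>)\<^sup>2 + (V \<omega>)\<^sup>2)" by auto
    qed measurable
    have eqL: "(\<Sum>i\<in>J. Q a i * (\<lambda>i\<in>J. X i \<omega>) i) = L \<omega>" for \<omega>
      unfolding L_def by (intro sum.cong) auto
    have eqV: "w J (\<lambda>i\<in>J. X i \<omega>) = V \<omega>" for \<omega>
      unfolding V_def w_def by (intro arg_cong2[where f="(-)"] sum.cong refl) auto
    have mL: "(\<lambda>x. \<Sum>i\<in>J. Q a i * x i) \<in> borel_measurable (Pi\<^sub>M J (\<lambda>_. borel))"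
      by (intro borel_measurable_sum borel_measurable_times borel_measurable_const measurable_component_singleton)
    have mV: "w J \<in> borel_measurable (Pi\<^sub>M J (\<lambda>_. borel))"
      unfolding w_def
      by (intro borel_measurable_diff borel_measurable_sum borel_measurable_times borel_measurable_const measurable_component_singleton)
    have mL2: "(\<lambda>x. (\<Sum>i\<in>J. Q a i * x i)\<^sup>2) \<in> borel_measurable (Pi\<^sub>M J (\<lambda>_. borel))"
      using mL by measurable
    have mLV: "(\<lambda>x. (\<Sum>i\<in>J. Q a i * x i) * w J x) \<in> borel_measurable (Pi\<^sub>M J (\<lambda>_. borel))"
      using mL mV by measurable
    note mult = indep_vars_insert_mult[OF ind' \<open>a \<notin> J\<close>]
    have m1: "integrable M (\<lambda>\<omega>. X a \<omega> * L \<omega>)" "expectation (\<lambda>\<omega>. X a \<omega> * L \<omega>) = 0"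
      using mult[OF _ mL, of "\<lambda>x. x", unfolded eqL] xa L by auto
    have m2: "integrable M (\<lambda>\<omega>. (X a \<omega>)\<^sup>2 * (L \<omega>)\<^sup>2)"
        "expectation (\<lambda>\<omega>. (X a \<omega>)\<^sup>2 * (L \<omega>)\<^sup>2) = v a * (\<Sum>i\<in>J. (Q a i)\<^sup>2 * v i)"
      using mult[OF _ mL2, of "\<lambda>x. x\<^sup>2", unfolded eqL] xa L var[OF aI] by auto
    have m3: "integrable M (\<lambda>\<omega>. X a \<omega> * (L \<omega> * V \<omega>))" "expectation (\<lambda>\<omega>. X a \<omega> * (L \<omega> * V \<omega>)) = 0"
      using mult[OF _ mLV, of "\<lambda>x. x", unfolded eqL eqV] xa VL mean0[OF aI] by auto
    have m4: "integrable M (\<lambda>\<omega>. (X a \<omega>)\<^sup>2 * V \<omega>)" "expectation (\<lambda>\<omega>. (X a \<omega>)\<^sup>2 * V \<omega>) = 0"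
      using mult[OF _ mV, of "\<lambda>x. x\<^sup>2", unfolded eqV] xa V by auto
    \<comment> \<open>The third moment of \<open>X a\<close> need not vanish, but it is multiplied
      by the mean of \<open>L\<close>, which does.\<close>
    have m5: "integrable M (\<lambda>\<omega>. X a \<omega> ^ 3 * L \<omega>)" "expectation (\<lambda>\<omega>. X a \<omega> ^ 3 * L \<omega>) = 0"
      using mult[OF _ mL, of "\<lambda>x. x ^ 3", unfolded eqL] xa L by auto
    have s1: "w (insert a J) (\<lambda>i. X i \<omega>) = V \<omega> + 2 * (X a \<omega> * L \<omega>) + Q a a * ((X a \<omega>)\<^sup>2 - v a)" for \<omega>
    proof -
      have "(\<Sum>i\<in>J. Q i a * X i \<omega> * X a \<omega>) = X a \<omega> * L \<omega>" "(\<Sum>j\<in>J. Q a j * X a \<omega> * X j \<omega>) = X a \<omega> * L \<omega>"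
        unfolding L_def by (auto simp: sum_distrib_left sym mult.assoc mult.left_commute mult.commute intro!: sum.cong)
      then show ?thesis
        using insert(1,2) unfolding w_def V_def
        by (simp add: sum.distrib algebra_simps power2_eq_square)
    qed
    \<comment> \<open>Apart from the three squares every term is a multiple of a product whose
      expectation is zero by \<open>m1\<close>, \<open>m3\<close>, \<open>m4\<close>,
      \<open>m5\<close> or the centring of \<open>V\<close>.\<close>
    have s2: "(V \<omega> + 2 * (X a \<omega> * L \<omega>) + Q a a * ((X a \<omega>)\<^sup>2 - v a))\<^sup>2 =
       (V \<omega>)\<^sup>2 + 4 * ((X a \<omega>)\<^sup>2 * (L \<omega>)\<^sup>2) + (Q a a)\<^sup>2 * (X a \<omega> ^ 4 - 2 * v a * (X a \<omega>)\<^sup>2 + (v a)\<^sup>2)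
       + 4 * (X a \<omega> * (L \<omega> * V \<omega>)) + 2 * Q a a * ((X a \<omega>)\<^sup>2 * V \<omega> - v a * V \<omega>)
       + 4 * Q a a * (X a \<omega> ^ 3 * L \<omega> - v a * (X a \<omega> * L \<omega>))" for \<omega>
      by algebra
    have i2: "integrable M (\<lambda>\<omega>. (w (insert a J) (\<lambda>i. X i \<omega>))\<^sup>2)"
      unfolding s1 s2 using xa L V m1 m2 m3 m4 m5 by auto
    have i1: "integrable M (\<lambda>\<omega>. w (insert a J) (\<lambda>i. X i \<omega>))"
      unfolding s1 using xa V m1 by auto
    have e1: "expectation (\<lambda>\<omega>. w (insert a J) (\<lambda>i. X i \<omega>)) = 0"
      unfolding s1 using xa V m1 var[OF aI] by (simp add: prob_space)
    have "expectation (\<lambda>\<omega>. (w (insert a J) (\<lambda>i. X i \<omega>))\<^sup>2) =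
       expectation (\<lambda>\<omega>. (V \<omega>)\<^sup>2) + 4 * (v a * (\<Sum>i\<in>J. (Q a i)\<^sup>2 * v i))
        + (Q a a)\<^sup>2 * (expectation (\<lambda>\<omega>. X a \<omega> ^ 4) - 2 * v a * v a + (v a)\<^sup>2)"
      unfolding s1 s2 using xa L V m1 m2 m3 m4 m5 var[OF aI] by (simp add: prob_space)
    also have "\<dots> \<le> expectation (\<lambda>\<omega>. (V \<omega>)\<^sup>2) + 4 * (v a * (\<Sum>i\<in>J. (Q a i)\<^sup>2 * v i))
        + (Q a a)\<^sup>2 * (2 * (v a)\<^sup>2 + u a)"
      by (intro add_left_mono mult_left_mono) (use mom4[OF aI] in \<open>auto simp: power2_eq_square\<close>)
    also have "\<dots> \<le> 2 * (\<Sum>i\<in>J. \<Sum>j\<in>J. (Q i j)\<^sup>2 * v i * v j) + (\<Sum>i\<in>J. (Q i i)\<^sup>2 * u i)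
       + 4 * (v a * (\<Sum>i\<in>J. (Q a i)\<^sup>2 * v i)) + (Q a a)\<^sup>2 * (2 * (v a)\<^sup>2 + u a)"
      using V(4) by simp
    also have "\<dots> = 2 * (\<Sum>i\<in>insert a J. \<Sum>j\<in>insert a J. (Q i j)\<^sup>2 * v i * v j) + (\<Sum>i\<in>insert a J. (Q i i)\<^sup>2 * u i)"
    proof -
      have "(\<Sum>i\<in>J. (Q i a)\<^sup>2 * v i * v a) = v a * (\<Sum>i\<in>J. (Q a i)\<^sup>2 * v i)"
        "(\<Sum>j\<in>J. (Q a j)\<^sup>2 * v a * v j) = v a * (\<Sum>i\<in>J. (Q a i)\<^sup>2 * v i)"
        by (auto simp: sum_distrib_left sym mult.left_commute mult.commute intro!: sum.cong)
      then show ?thesis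
        using insert(1,2) by (simp add: sum.distrib algebra_simps power2_eq_square)
    qed
    finally show ?case using i1 i2 e1 by blast
  qed
  from this[of I] fin show "integrable M (\<lambda>\<omega>. (W \<omega>)\<^sup>2)"
   "expectation (\<lambda>\<omega>. (W \<omega>)\<^sup>2) \<le> 2 * (\<Sum>i\<in>I. \<Sum>j\<in>I. (Q i j)\<^sup>2 * v i * v j) + (\<Sum>i\<in>I. (Q i i)\<^sup>2 * u i)"
    unfolding W_def w_def by auto
qed

text \<open>A weighted sum of squares of linear forms is one quadratic form, with matrix the sum of
  x_j b_j b_j^T, and its diagonal produces exactly the centring constants.\<close>

lemma quadratic_forms_bound:
  fixes b :: "'j \<Rightarrow> 'i \<Rightarrow> real" and x :: "'j \<Rightarrow> real"
  assumes "finite J"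
  shows "(\<integral>\<^sup>+\<omega>. ennreal ((\<Sum>j\<in>J. x j * ((\<Sum>i\<in>I. b j i * X i \<omega>)\<^sup>2 - (\<Sum>i\<in>I. (b j i)\<^sup>2 * v i)))\<^sup>2) \<partial>M)
    \<le> ennreal (2 * (\<Sum>j\<in>J. \<Sum>k\<in>J. x j * x k * (\<Sum>i\<in>I. b j i * b k i * v i)\<^sup>2)
        + (\<Sum>i\<in>I. (\<Sum>j\<in>J. x j * (b j i)\<^sup>2)\<^sup>2 * u i))"
proof -
  define Q where "Q = (\<lambda>i i'. \<Sum>j\<in>J. x j * b j i * b j i')"
  have sym: "Q i j = Q j i" for i j unfolding Q_def by (simp add: mult_ac)
  have "(\<Sum>j\<in>J. x j * ((\<Sum>i\<in>I. b j i * X i \<omega>)\<^sup>2 - (\<Sum>i\<in>I. (b j i)\<^sup>2 * v i)))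
      = (\<Sum>i\<in>I. \<Sum>j\<in>I. Q i j * X i \<omega> * X j \<omega>) - (\<Sum>i\<in>I. Q i i * v i)" for \<omega>
  proof -
    have "(\<Sum>j\<in>J. x j * (\<Sum>i\<in>I. b j i * X i \<omega>)\<^sup>2) = (\<Sum>j\<in>J. \<Sum>i\<in>I. \<Sum>i'\<in>I. x j * b j i * b j i' * X i \<omega> * X i' \<omega>)"
      by (simp add: power2_eq_square sum_product sum_distrib_left mult_ac)
    also have "\<dots> = (\<Sum>i\<in>I. \<Sum>j\<in>J. \<Sum>i'\<in>I. x j * b j i * b j i' * X i \<omega> * X i' \<omega>)"
      by (rule sum.swap)
    also have "\<dots> = (\<Sum>i\<in>I. \<Sum>i'\<in>I. \<Sum>j\<in>J. x j * b j i * b j i' * X i \<omega> * X i' \<omega>)"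
      by (intro sum.cong refl sum.swap)
    also have "\<dots> = (\<Sum>i\<in>I. \<Sum>j\<in>I. Q i j * X i \<omega> * X j \<omega>)"
      unfolding Q_def by (simp add: sum_distrib_right)
    finally have e1: "(\<Sum>j\<in>J. x j * (\<Sum>i\<in>I. b j i * X i \<omega>)\<^sup>2) = (\<Sum>i\<in>I. \<Sum>j\<in>I. Q i j * X i \<omega> * X j \<omega>)" .
    have "(\<Sum>j\<in>J. x j * (\<Sum>i\<in>I. (b j i)\<^sup>2 * v i)) = (\<Sum>j\<in>J. \<Sum>i\<in>I. x j * b j i * b j i * v i)"
      by (simp add: power2_eq_square sum_distrib_left mult_ac)
    also have "\<dots> = (\<Sum>i\<in>I. \<Sum>j\<in>J. x j * b j i * b j i * v i)" by (rule sum.swap)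
    also have "\<dots> = (\<Sum>i\<in>I. Q i i * v i)" unfolding Q_def by (simp add: sum_distrib_right)
    finally show ?thesis using e1 by (simp add: right_diff_distrib sum_subtractf)
  qed
  then have "(\<integral>\<^sup>+\<omega>. ennreal ((\<Sum>j\<in>J. x j * ((\<Sum>i\<in>I. b j i * X i \<omega>)\<^sup>2 - (\<Sum>i\<in>I. (b j i)\<^sup>2 * v i)))\<^sup>2) \<partial>M)
     = ennreal (expectation (\<lambda>\<omega>. ((\<Sum>i\<in>I. \<Sum>j\<in>I. Q i j * X i \<omega> * X j \<omega>) - (\<Sum>i\<in>I. Q i i * v i))\<^sup>2))"
    using quadratic_form(1)[of Q, OF sym] by (simp add: nn_integral_eq_integral)
  also have "\<dots> \<le> ennreal (2 * (\<Sum>i\<in>I. \<Sum>j\<in>I. (Q i j)\<^sup>2 * v i * v j) + (\<Sum>i\<in>I. (Q i i)\<^sup>2 * u i))"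
    by (intro ennreal_leI quadratic_form(2)[of Q, OF sym])
  \<comment> \<open>The fourfold sum is regrouped from indices of variables to indices of forms. The
    Hilbert-Schmidt norm of \<open>Q\<close> becomes a sum over squared entries of the Gram matrix
    of the forms, which orthonormality will make diagonal.\<close>
  also have "(\<Sum>i\<in>I. \<Sum>i'\<in>I. (Q i i')\<^sup>2 * v i * v i') = (\<Sum>j\<in>J. \<Sum>k\<in>J. x j * x k * (\<Sum>i\<in>I. b j i * b k i * v i)\<^sup>2)"
  proof -
    have "(\<Sum>i\<in>I. \<Sum>i'\<in>I. (Q i i')\<^sup>2 * v i * v i') =
       (\<Sum>i\<in>I. \<Sum>i'\<in>I. \<Sum>j\<in>J. \<Sum>k\<in>J. x j * x k * (b j i * b k i * v i) * (b j i' * b k i' * v i'))"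
      unfolding Q_def by (simp add: power2_eq_square sum_product sum_distrib_left sum_distrib_right mult_ac)
    also have "\<dots> = (\<Sum>i\<in>I. \<Sum>j\<in>J. \<Sum>i'\<in>I. \<Sum>k\<in>J. x j * x k * (b j i * b k i * v i) * (b j i' * b k i' * v i'))"
      by (intro sum.cong refl sum.swap)
    also have "\<dots> = (\<Sum>j\<in>J. \<Sum>i\<in>I. \<Sum>k\<in>J. \<Sum>i'\<in>I. x j * x k * (b j i * b k i * v i) * (b j i' * b k i' * v i'))"
      by (subst sum.swap) (intro sum.cong refl sum.swap)
    also have "\<dots> = (\<Sum>j\<in>J. \<Sum>k\<in>J. \<Sum>i\<in>I. \<Sum>i'\<in>I. x j * x k * (b j i * b k i * v i) * (b j i' * b k i' * v i'))"
      by (intro sum.cong refl sum.swap)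
    also have "\<dots> = (\<Sum>j\<in>J. \<Sum>k\<in>J. x j * x k * (\<Sum>i\<in>I. b j i * b k i * v i)\<^sup>2)"
      by (simp add: power2_eq_square sum_product sum_distrib_left mult_ac)
    finally show ?thesis .
  qed
  also have "(\<Sum>i\<in>I. (Q i i)\<^sup>2 * u i) = (\<Sum>i\<in>I. (\<Sum>j\<in>J. x j * (b j i)\<^sup>2)\<^sup>2 * u i)"
    unfolding Q_def by (simp add: power2_eq_square mult_ac)
  finally show ?thesis .
qed

end

section \<open>Joining the Gaussian and the Poisson family, and their moments\<close>

text \<open>A finite set of indices splits into its two sides; the events of each side intersect to
  a set of \<open>N1\<close> or of \<open>N2\<close>, so the probability factors once between the
  sides and then within each of them.\<close>

lemma (in prob_space) indep_vars_join:
  fixes X :: "'i \<Rightarrow> 'a \<Rightarrow> real" and Y :: "'j \<Rightarrow> 'a \<Rightarrow> real"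
  assumes X: "indep_vars (\<lambda>_. borel) X I" and Y: "indep_vars (\<lambda>_. borel) Y J"
    and ind: "indep_set (sets N1) (sets N2)"
    and sp: "space N1 = space M" "space N2 = space M"
    and mX: "\<And>i. i \<in> I \<Longrightarrow> X i \<in> borel_measurable N1"
    and mY: "\<And>j. j \<in> J \<Longrightarrow> Y j \<in> borel_measurable N2"
  shows "indep_vars (\<lambda>_. borel) (case_sum X Y) (I <+> J)"
proof -
  let ?F = "\<lambda>i. {case_sum X Y i -` A \<inter> space M | A. A \<in> sets borel}"
  have rX: "\<And>i. i \<in> I \<Longrightarrow> X i \<in> borel_measurable M" and rY: "\<And>j. j \<in> J \<Longrightarrow> Y j \<in> borel_measurable M"
    using X Y unfolding indep_vars_def by auto
  have sX: "indep_sets (\<lambda>i. {X i -` A \<inter> space M | A. A \<in> sets borel}) I"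
    and sY: "indep_sets (\<lambda>i. {Y i -` A \<inter> space M | A. A \<in> sets borel}) J"
    using X Y unfolding indep_vars_def2 by auto
  have "indep_sets ?F (I <+> J)"
  proof (rule indep_setsI)
    fix i assume "i \<in> I <+> J"
    then show "?F i \<subseteq> events" using rX rY by (auto intro: measurable_sets)
  next
    fix A K assume K: "K \<noteq> {}" "K \<subseteq> I <+> J" "finite K" and A: "\<forall>j\<in>K. A j \<in> ?F j"
    define K1 K2 where "K1 = Inl -` K" and "K2 = Inr -` K"
    have fin: "finite K1" "finite K2" unfolding K1_def K2_def using K(3)
      by (auto intro: finite_vimageI)
    have sub: "K1 \<subseteq> I" "K2 \<subseteq> J" unfolding K1_def K2_def using K(2) by auto
    have Keq: "K = Inl ` K1 \<union> Inr ` K2" 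
    proof (intro set_eqI)
      fix x show "x \<in> K \<longleftrightarrow> x \<in> Inl ` K1 \<union> Inr ` K2"
        unfolding K1_def K2_def by (cases x) auto
    qed
    have A1: "A (Inl i) \<in> {X i -` B \<inter> space M | B. B \<in> sets borel}" if "i \<in> K1" for i
      using bspec[OF A, of "Inl i"] that unfolding K1_def by simp
    have A2: "A (Inr i) \<in> {Y i -` B \<inter> space M | B. B \<in> sets borel}" if "i \<in> K2" for i
      using bspec[OF A, of "Inr i"] that unfolding K2_def by simp
    \<comment> \<open>Intersecting with \<open>space M\<close> covers an empty side, where the
      intersection alone would be the whole type.\<close>
    define a where "a = space M \<inter> (\<Inter>i\<in>K1. A (Inl i))"
    define b where "b = space M \<inter> (\<Inter>i\<in>K2. A (Inr i))"
    have "A (Inl i) \<in> sets N1" if "i \<in> K1" for i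
      using A1[OF that] mX[of i] sub that sp by (auto simp: measurable_def)
    then have aN: "a \<in> sets N1"
      unfolding a_def sp(1)[symmetric] using fin by (cases "K1 = {}") (auto intro!: sets.Int sets.finite_INT)
    have "A (Inr i) \<in> sets N2" if "i \<in> K2" for i
      using A2[OF that] mY[of i] sub that sp by (auto simp: measurable_def)
    then have bN: "b \<in> sets N2"
      unfolding b_def sp(2)[symmetric] using fin by (cases "K2 = {}") (auto intro!: sets.Int sets.finite_INT)
    have pa: "prob a = (\<Prod>i\<in>K1. prob (A (Inl i)))"
    proof (cases "K1 = {}")
      case False
      then have "a = (\<Inter>i\<in>K1. A (Inl i))" unfolding a_def using A1 by auto
      then show ?thesis
        using indep_setsD[OF sX sub(1) False fin(1), of "\<lambda>i. A (Inl i)"] A1 by auto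
    qed (simp add: a_def prob_space)
    have pb: "prob b = (\<Prod>i\<in>K2. prob (A (Inr i)))"
    proof (cases "K2 = {}")
      case False
      then have "b = (\<Inter>i\<in>K2. A (Inr i))" unfolding b_def using A2 by auto
      then show ?thesis
        using indep_setsD[OF sY sub(2) False fin(2), of "\<lambda>i. A (Inr i)"] A2 by auto
    qed (simp add: b_def prob_space)
    have "(\<Inter>j\<in>K. A j) \<subseteq> space M" using K A by fastforce
    then have "(\<Inter>j\<in>K. A j) = a \<inter> b" unfolding a_def b_def Keq by auto
    then have "prob (\<Inter>j\<in>K. A j) = prob a * prob b"
      using indep_setD[OF ind aN bN] by simp
    also have "\<dots> = (\<Prod>j\<in>K. prob (A j))"
      unfolding pa pb Keq using fin
      by (subst prod.union_disjoint) (auto simp: prod.reindex)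
    finally show "prob (\<Inter>j\<in>K. A j) = (\<Prod>j\<in>K. prob (A j))" .
  qed
  then show ?thesis
    unfolding indep_vars_def2 using rX rY by auto
qed

lemma (in prob_space) normal_moments:
  assumes "0 < s" and D: "distributed M lborel X (\<lambda>x. ennreal (normal_density 0 s x))"
  shows "integrable M (\<lambda>\<omega>. X \<omega> ^ 4)" "expectation X = 0"
    "expectation (\<lambda>\<omega>. (X \<omega>)\<^sup>2) = s\<^sup>2" "expectation (\<lambda>\<omega>. X \<omega> ^ 4) = 3 * (s\<^sup>2)\<^sup>2"
proof -
  note i = distributed_integrable[OF D] and e = distributed_integral[OF D]
  show "integrable M (\<lambda>\<omega>. X \<omega> ^ 4)"
    using i[of "\<lambda>x. x ^ 4"] integrable.intros[OF normal_moment_even[OF \<open>0 < s\<close>, of 0 2]] by simp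
  show "expectation X = 0"
    using e[of "\<lambda>x. x"] integral_normal_moment_odd[OF \<open>0 < s\<close>, of 0 0] by simp
  show "expectation (\<lambda>\<omega>. (X \<omega>)\<^sup>2) = s\<^sup>2"
    using e[of "\<lambda>x. x\<^sup>2"] integral_normal_moment_even[OF \<open>0 < s\<close>, of 0 1] by (simp add: fact_numeral)
  show "expectation (\<lambda>\<omega>. X \<omega> ^ 4) = 3 * (s\<^sup>2)\<^sup>2"
    using e[of "\<lambda>x. x ^ 4"] integral_normal_moment_even[OF \<open>0 < s\<close>, of 0 2] by (simp add: fact_numeral power_divide)
qed

text \<open>Factorial moments of a Poisson variable are the powers of its mean, and the central
  moments are linear combinations of them. The variable takes values in the extended reals, so
  finiteness almost surely has to be derived as well.\<close>

lemma (in prob_space) poisson_moments: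
  fixes N :: "'a \<Rightarrow> ennreal"
  assumes [measurable]: "N \<in> borel_measurable M" and "0 \<le> l"
    and pr: "\<And>k::nat. prob {\<omega>\<in>space M. N \<omega> = of_nat k} = exp (- l) * l ^ k / fact k"
  defines "Y \<equiv> \<lambda>\<omega>. enn2real (N \<omega>) - l"
  shows "integrable M (\<lambda>\<omega>. Y \<omega> ^ 4)" "expectation Y = 0"
    "expectation (\<lambda>\<omega>. (Y \<omega>)\<^sup>2) = l" "expectation (\<lambda>\<omega>. Y \<omega> ^ 4) = 3 * l\<^sup>2 + l"
    "AE \<omega> in M. N \<omega> < \<infinity>" "(\<integral>\<^sup>+\<omega>. N \<omega> \<partial>M) = ennreal l"
proof -
  define A where "A = (\<lambda>k::nat. {\<omega>\<in>space M. N \<omega> = of_nat k})"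
  have [measurable]: "A k \<in> sets M" for k unfolding A_def by measurable
  have dis: "disjoint_family A" unfolding A_def disjoint_family_on_def by auto
  have exps: "(\<lambda>k. exp (- l) * l ^ k / fact k) sums 1"
  proof -
    have "(\<lambda>k. exp (- l) * (l ^ k / fact k)) sums (exp (- l) * exp l)"
      using sums_mult[OF exp_converges[of l], of "exp (- l)"] by (simp add: field_simps)
    then show ?thesis by (simp add: exp_minus)
  qed
  \<comment> \<open>The prescribed probabilities already add up to 1; hence all other values,
    infinity included, have probability zero.\<close>
  have "(\<lambda>k. prob (A k)) sums prob (\<Union>k. A k)"
    by (rule finite_measure_UNION) (use dis in auto)
  then have "prob (\<Union>k. A k) = 1"
    using exps sums_unique2 unfolding A_def pr by blast
  then have AEA: "AE \<omega> in M. \<omega> \<in> (\<Union>k. A k)"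
    by (subst prob_eq_1[symmetric]) auto
  then have AEn: "AE \<omega> in M. \<exists>k. N \<omega> = of_nat k" unfolding A_def by auto
  then show fin: "AE \<omega> in M. N \<omega> < \<infinity>" by eventually_elim (metis ennreal_of_nat_eq_real_of_nat ennreal_less_top infinity_ennreal_def)
  \<comment> \<open>The falling factorial y (y - 1) ... (y - r + 1). At a natural number k + r it is
    the quotient of the factorials of k + r and k, which cancels the denominator of the Poisson
    weight.\<close>
  define h where "h = (\<lambda>r y. \<Prod>i<r. y - real i)"
  have hf: "h r (real (k + r)) * fact k = fact (k + r)" for k r
  proof (induction r)
    case (Suc r)
    have "h (Suc r) (real (k + Suc r)) = real (k + Suc r) * h r (real (k + r))"
      unfolding h_def by (subst prod.lessThan_Suc_shift) (simp add: algebra_simps)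
    then have "h (Suc r) (real (k + Suc r)) * fact k = real (k + Suc r) * (h r (real (k + r)) * fact k)"
      by (simp only: mult.assoc)
    also have "\<dots> = fact (k + Suc r)" unfolding Suc by simp
    finally show ?case .
  qed (simp add: h_def)
  have h0: "h r (real k) = 0" if "k < r" for k r
    unfolding h_def using that by (subst prod_zero) auto
  have hnn: "0 \<le> h r (real k)" for k r
  proof (cases "k < r")
    case False
    then obtain m where "k = m + r" by (metis add.commute le_Suc_ex not_less)
    then show ?thesis using hf[of r m]
      by (metis fact_ge_zero fact_gt_zero mult_le_cancel_right mult_zero_left not_less)
  qed (simp add: h0)
  \<comment> \<open>The first r terms vanish by \<open>h0\<close>; the others, shifted by r, form
    l^r times the exponential series.\<close>
  have hsum: "(\<lambda>k. h r (real k) * (exp (- l) * l ^ k / fact k)) sums (l ^ r)" for r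
  proof -
    have "(\<lambda>k. l ^ r * (exp (- l) * l ^ k / fact k)) sums (l ^ r * 1)"
      by (rule sums_mult[OF exps])
    moreover have "h r (real (k + r)) * (exp (- l) * l ^ (k + r) / fact (k + r)) = l ^ r * (exp (- l) * l ^ k / fact k)" for k
    proof -
      have "h r (real (k + r)) = fact (k + r) / fact k" using hf[of r k] by (simp add: field_simps)
      then show ?thesis by (simp add: power_add)
    qed
    ultimately have "(\<lambda>k. h r (real (k + r)) * (exp (- l) * l ^ (k + r) / fact (k + r))) sums (l ^ r)" by simp
    then show ?thesis
      by (subst (asm) sums_iff_shift[where f="\<lambda>k. h r (real k) * (exp (- l) * l ^ k / fact k)"]) (simp add: h0)
  qed
  define Z where "Z = (\<lambda>\<omega>. enn2real (N \<omega>))"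
  have [measurable]: "Z \<in> borel_measurable M" unfolding Z_def by measurable
  have [measurable]: "(\<lambda>\<omega>. h r (Z \<omega>)) \<in> borel_measurable M" for r unfolding h_def by measurable
  have AEZ: "AE \<omega> in M. \<exists>k. \<omega> \<in> A k \<and> Z \<omega> = real k"
    using AEA unfolding Z_def A_def by eventually_elim (auto simp: ennreal_of_nat_eq_real_of_nat)
  have hb: "has_bochner_integral M (\<lambda>\<omega>. h r (Z \<omega>)) (l ^ r)" for r
  proof (rule has_bochner_integral_nn_integral)
    show "AE \<omega> in M. 0 \<le> h r (Z \<omega>)" using AEZ by eventually_elim (use hnn in auto)
    have "(\<integral>\<^sup>+\<omega>. ennreal (h r (Z \<omega>)) \<partial>M) = (\<integral>\<^sup>+\<omega>. (\<Sum>k. ennreal (h r (real k)) * indicator (A k) \<omega>) \<partial>M)"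
    proof (rule nn_integral_cong_AE)
      show "AE \<omega> in M. ennreal (h r (Z \<omega>)) = (\<Sum>k. ennreal (h r (real k)) * indicator (A k) \<omega>)"
        using AEZ
      proof eventually_elim
        case (elim \<omega>)
        then obtain k where k: "\<omega> \<in> A k" "Z \<omega> = real k" by auto
        have "(\<Sum>j. ennreal (h r (real j)) * indicator (A j) \<omega>) = ennreal (h r (real k))"
        proof -
          have "j = k" if "\<omega> \<in> A j" for j using dis k(1) that unfolding disjoint_family_on_def by auto
          then have "(\<Sum>j. ennreal (h r (real j)) * indicator (A j) \<omega>) = (\<Sum>j\<in>{k}. ennreal (h r (real j)) * indicator (A j) \<omega>)"
            by (intro suminf_finite) (auto simp: indicator_def)
          then show ?thesis using k by simp
        qed
        then show ?case using k by simp
      qed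
    qed
    also have "\<dots> = (\<Sum>k. ennreal (h r (real k)) * emeasure M (A k))"
      by (subst nn_integral_suminf) (auto simp: nn_integral_cmult_indicator)
    also have "\<dots> = (\<Sum>k. ennreal (h r (real k) * (exp (- l) * l ^ k / fact k)))"
      by (intro suminf_cong) (simp only: emeasure_eq_measure A_def pr ennreal_mult'[OF hnn])
    also have "\<dots> = ennreal (l ^ r)"
      by (rule suminf_ennreal_eq[OF _ hsum]) (use hnn \<open>0 \<le> l\<close> in auto)
    finally show "(\<integral>\<^sup>+\<omega>. ennreal (h r (Z \<omega>)) \<partial>M) = ennreal (l ^ r)" .
  qed (use \<open>0 \<le> l\<close> in auto)
  have hI: "integrable M (\<lambda>\<omega>. h r (Z \<omega>))" "expectation (\<lambda>\<omega>. h r (Z \<omega>)) = l ^ r" for r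
    using hb[of r] by (auto simp: has_bochner_integral_iff)
  have h1: "h 1 y = y" and h2: "h 2 y = y * (y - 1)" and h3: "h 3 y = y * (y - 1) * (y - 2)"
    and h4: "h 4 y = y * (y - 1) * (y - 2) * (y - 3)" for y
    unfolding h_def by (auto simp: eval_nat_numeral)
  have p1: "Y \<omega> = h 1 (Z \<omega>) - l" for \<omega>
    unfolding Y_def Z_def h1 by simp
  have p2: "(Y \<omega>)\<^sup>2 = h 2 (Z \<omega>) + (1 - 2 * l) * h 1 (Z \<omega>) + l\<^sup>2" for \<omega>
    unfolding p1 h1 h2 by algebra
  \<comment> \<open>The numbers 1, 7, 6, 1 are the Stirling numbers expressing y^4 in falling
    factorials; the other coefficients come in the same way from the lower powers in the expansion
    of (y - l)^4.\<close>
  have p4: "Y \<omega> ^ 4 = h 4 (Z \<omega>) + (6 - 4 * l) * h 3 (Z \<omega>) + (7 - 12 * l + 6 * l\<^sup>2) * h 2 (Z \<omega>)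
      + (1 - 4 * l + 6 * l\<^sup>2 - 4 * l ^ 3) * h 1 (Z \<omega>) + l ^ 4" for \<omega>
    unfolding p1 h1 h2 h3 h4 by algebra
  show "integrable M (\<lambda>\<omega>. Y \<omega> ^ 4)" unfolding p4 using hI by simp
  show "expectation Y = 0" unfolding p1 using hI by (simp add: prob_space)
  have "expectation (\<lambda>\<omega>. (Y \<omega>)\<^sup>2) = l ^ 2 + (1 - 2 * l) * l ^ 1 + l\<^sup>2"
    unfolding p2 using hI by (simp add: prob_space)
  then show "expectation (\<lambda>\<omega>. (Y \<omega>)\<^sup>2) = l" by algebra
  have "expectation (\<lambda>\<omega>. Y \<omega> ^ 4) = l ^ 4 + (6 - 4 * l) * l ^ 3 + (7 - 12 * l + 6 * l\<^sup>2) * l ^ 2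
      + (1 - 4 * l + 6 * l\<^sup>2 - 4 * l ^ 3) * l ^ 1 + l ^ 4"
    unfolding p4 using hI by (simp add: prob_space)
  then show "expectation (\<lambda>\<omega>. Y \<omega> ^ 4) = 3 * l\<^sup>2 + l" by algebra
  have "(\<integral>\<^sup>+\<omega>. N \<omega> \<partial>M) = (\<integral>\<^sup>+\<omega>. ennreal (h 1 (Z \<omega>)) \<partial>M)"
    by (rule nn_integral_cong_AE) (use fin in eventually_elim, auto simp: h1[simplified] Z_def)
  also have "\<dots> = ennreal l"
    using hI[of 1] AEZ hnn[of 1] by (subst nn_integral_eq_integral) (auto elim!: eventually_mono)
  finally show "(\<integral>\<^sup>+\<omega>. N \<omega> \<partial>M) = ennreal l" .
qed

section \<open>Poisson random measures and Levy measures\<close>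

text \<open>Campbell's formula. Measurability in the sample point is part of the induction because
  linearity and monotone convergence under the outer integral require it. The restriction to
  \<open>A\<close> keeps all sets of finite intensity, the only ones for which the Poisson law is
  prescribed.\<close>

lemma campbell:
  assumes M: "prob_space M" and N: "poisson_random_measure M \<eta> N"
    and PM: "\<And>A. A \<in> sets \<eta> \<Longrightarrow> emeasure \<eta> A < \<infinity> \<Longrightarrow> (\<integral>\<^sup>+\<omega>. emeasure (N \<omega>) A \<partial>M) = emeasure \<eta> A"
    and A: "A \<in> sets \<eta>" "emeasure \<eta> A < \<infinity>"
    and h: "h \<in> borel_measurable \<eta>"
  shows "(\<lambda>\<omega>. \<integral>\<^sup>+p. h p * indicator A p \<partial>N \<omega>) \<in> borel_measurable M \<and>
    (\<integral>\<^sup>+\<omega>. (\<integral>\<^sup>+p. h p * indicator A p \<partial>N \<omega>) \<partial>M) = (\<integral>\<^sup>+p. h p * indicator A p \<partial>\<eta>)"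
  using h
proof (induct rule: borel_measurable_induct)
  note [measurable] = A(1)
  have sN: "\<omega> \<in> space M \<Longrightarrow> sets (N \<omega>) = sets \<eta>" for \<omega>
    using N unfolding poisson_random_measure_def by auto
  have spN: "\<omega> \<in> space M \<Longrightarrow> space (N \<omega>) = space \<eta>" for \<omega>
    using sN sets_eq_imp_space_eq by blast
  have mN: "\<omega> \<in> space M \<Longrightarrow> f \<in> borel_measurable \<eta> \<Longrightarrow> f \<in> borel_measurable (N \<omega>)" for \<omega> and f :: "_ \<Rightarrow> ennreal"
    using measurable_cong_sets[OF sN refl] by blast
  have mNA: "\<omega> \<in> space M \<Longrightarrow> f \<in> borel_measurable \<eta> \<Longrightarrow> (\<lambda>p. f p * indicator A p) \<in> borel_measurable (N \<omega>)" for \<omega> and f :: "_ \<Rightarrow> ennreal"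
    by (intro mN borel_measurable_times_ennreal borel_measurable_indicator A(1))
  { case (cong f g)
    have "(\<integral>\<^sup>+p. f p * indicator A p \<partial>N \<omega>) = (\<integral>\<^sup>+p. g p * indicator A p \<partial>N \<omega>)" if "\<omega> \<in> space M" for \<omega>
      by (rule nn_integral_cong) (use cong(3) spN[OF that] in auto)
    moreover have "(\<integral>\<^sup>+p. f p * indicator A p \<partial>\<eta>) = (\<integral>\<^sup>+p. g p * indicator A p \<partial>\<eta>)"
      by (rule nn_integral_cong) (use cong(3) in auto)
    ultimately show ?case using cong(4)
      by (simp cong: measurable_cong nn_integral_cong) }
  \<comment> \<open>The Poisson property enters only in this case, through \<open>PM\<close> for the
    set \<open>B \<inter> A\<close> of finite intensity.\<close>
  { case (set B)
    have BA: "B \<inter> A \<in> sets \<eta>" using set A by auto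
    have fin: "emeasure \<eta> (B \<inter> A) < \<infinity>"
      using emeasure_mono[of "B \<inter> A" A \<eta>] A by (auto simp: less_top[symmetric] top_unique)
    have e: "(\<lambda>p. indicator B p * indicator A p :: ennreal) = indicator (B \<inter> A)"
      by (auto simp: indicator_def)
    have e2: "(\<integral>\<^sup>+p. indicator B p * indicator A p \<partial>N \<omega>) = emeasure (N \<omega>) (B \<inter> A)" if "\<omega> \<in> space M" for \<omega>
      unfolding e using sN[OF that] BA by simp
    have e3: "(\<integral>\<^sup>+p. indicator B p * indicator A p \<partial>\<eta>) = emeasure \<eta> (B \<inter> A)"
      unfolding e using BA by simp
    have "(\<lambda>\<omega>. emeasure (N \<omega>) (B \<inter> A)) \<in> borel_measurable M"
      using N BA unfolding poisson_random_measure_def by auto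
    then show ?case
      using PM[OF BA fin] e2 e3 by (simp cong: measurable_cong nn_integral_cong) }
  { case (mult u c)
    have e: "(\<integral>\<^sup>+p. c * u p * indicator A p \<partial>N \<omega>) = c * (\<integral>\<^sup>+p. u p * indicator A p \<partial>N \<omega>)" if "\<omega> \<in> space M" for \<omega>
      using mNA[OF that mult(2)] by (simp add: nn_integral_cmult mult.assoc)
    have "(\<integral>\<^sup>+p. c * u p * indicator A p \<partial>\<eta>) = c * (\<integral>\<^sup>+p. u p * indicator A p \<partial>\<eta>)"
      using mult(2) A by (simp add: nn_integral_cmult mult.assoc)
    then show ?case using mult(4) e by (auto simp: nn_integral_cmult intro!: borel_measurable_times_ennreal cong: measurable_cong nn_integral_cong) }
  { case (add u v)
    have e: "(\<integral>\<^sup>+p. (v p + u p) * indicator A p \<partial>N \<omega>) = (\<integral>\<^sup>+p. v p * indicator A p \<partial>N \<omega>) + (\<integral>\<^sup>+p. u p * indicator A p \<partial>N \<omega>)" if "\<omega> \<in> space M" for \<omega>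
      using mNA[OF that add(1)] mNA[OF that add(4)] by (simp add: nn_integral_add distrib_right)
    have "(\<integral>\<^sup>+p. (v p + u p) * indicator A p \<partial>\<eta>) = (\<integral>\<^sup>+p. v p * indicator A p \<partial>\<eta>) + (\<integral>\<^sup>+p. u p * indicator A p \<partial>\<eta>)"
      using add(1,4) A by (simp add: nn_integral_add distrib_right)
    then show ?case using add(3,7) e by (auto simp: nn_integral_add intro!: borel_measurable_add cong: measurable_cong nn_integral_cong) }
  { case (seq U)
    have inc: "incseq (\<lambda>i p. U i p * indicator A p)"
      using seq(4) by (auto simp: incseq_def le_fun_def indicator_def)
    have S: "(SUP i. U i) p * indicator A p = (SUP i. U i p * indicator A p)" for p
      by (cases "p \<in> A") (auto simp: image_comp)
    have e: "(\<integral>\<^sup>+p. (SUP i. U i) p * indicator A p \<partial>N \<omega>) = (SUP i. \<integral>\<^sup>+p. U i p * indicator A p \<partial>N \<omega>)" if "\<omega> \<in> space M" for \<omega>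
      unfolding S by (rule nn_integral_monotone_convergence_SUP[OF inc]) (rule mNA[OF that seq(1)])
    have e2: "(\<integral>\<^sup>+p. (SUP i. U i) p * indicator A p \<partial>\<eta>) = (SUP i. \<integral>\<^sup>+p. U i p * indicator A p \<partial>\<eta>)"
      unfolding S by (rule nn_integral_monotone_convergence_SUP[OF inc]) (intro borel_measurable_times_ennreal borel_measurable_indicator A(1) seq(1))
    have m: "(\<lambda>\<omega>. \<integral>\<^sup>+p. U i p * indicator A p \<partial>N \<omega>) \<in> borel_measurable M" for i using seq(3) by auto
    have inc2: "incseq (\<lambda>i \<omega>. \<integral>\<^sup>+p. U i p * indicator A p \<partial>N \<omega>)"
      using inc by (auto simp: incseq_def le_fun_def intro!: nn_integral_mono)
    have "(\<integral>\<^sup>+\<omega>. (SUP i. \<integral>\<^sup>+p. U i p * indicator A p \<partial>N \<omega>) \<partial>M) = (SUP i. \<integral>\<^sup>+p. U i p * indicator A p \<partial>\<eta>)"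
      using nn_integral_monotone_convergence_SUP[OF inc2 m] seq(3) by simp
    moreover have "(\<lambda>\<omega>. SUP i. \<integral>\<^sup>+p. U i p * indicator A p \<partial>N \<omega>) \<in> borel_measurable M"
      using m by measurable
    ultimately show ?case using e e2 by (simp cong: measurable_cong nn_integral_cong) }
qed

locale levy =
  fixes \<nu> :: "real measure"
  assumes levy: "levy_measure \<nu>"
begin

lemma sets_nu[measurable_cong, simp]: "sets \<nu> = sets borel"
  and nu0: "emeasure \<nu> {0} = 0"
  and nu2: "(\<integral>\<^sup>+x. ennreal (x\<^sup>2) \<partial>\<nu>) = 1"
  and nu6: "(\<integral>\<^sup>+x. ennreal (x ^ 6) \<partial>\<nu>) < \<infinity>"
  using levy unfolding levy_measure_def by auto

lemma space_nu[simp]: "space \<nu> = UNIV"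
  using sets_eq_imp_space_eq[OF sets_nu] by simp

lemma integrable_x2: "integrable \<nu> (\<lambda>x. x\<^sup>2)" and integral_x2: "(\<integral>x. x\<^sup>2 \<partial>\<nu>) = 1"
proof -
  have "has_bochner_integral \<nu> (\<lambda>x. x\<^sup>2) 1"
    by (rule has_bochner_integral_nn_integral) (use nu2 in auto)
  then show "integrable \<nu> (\<lambda>x. x\<^sup>2)" "(\<integral>x. x\<^sup>2 \<partial>\<nu>) = 1"
    by (auto simp: has_bochner_integral_iff)
qed

text \<open>Interpolation between the moments of order two and six, the ones that are given.\<close>

lemma integrable_x4: "integrable \<nu> (\<lambda>x. x ^ 4)"
proof (rule Bochner_Integration.integrable_bound)
  have "integrable \<nu> (\<lambda>x. x ^ 6)"
    using nu6 by (intro integrableI_nonneg) auto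
  then show "integrable \<nu> (\<lambda>x. x\<^sup>2 + x ^ 6)" using integrable_x2 by auto
  have "x ^ 4 \<le> x\<^sup>2 + x ^ 6" for x :: real
  proof -
    have "0 \<le> x\<^sup>2 * (x\<^sup>2 - 1)\<^sup>2 + x ^ 4" by simp
    then show ?thesis by (simp add: power2_eq_square algebra_simps eval_nat_numeral)
  qed
  then show "AE x in \<nu>. norm (x ^ 4) \<le> norm (x\<^sup>2 + x ^ 6)" by auto
qed simp

text \<open>Chebyshev's inequality for the second moment. The measure may be infinite near 0, so
  jumps are counted only away from 0.\<close>

lemma emeasure_tail:
  assumes "0 < \<epsilon>" shows "emeasure \<nu> {x. \<epsilon> < \<bar>x\<bar>} < \<infinity>"
proof -
  have "emeasure \<nu> {x. \<epsilon> < \<bar>x\<bar>} = (\<integral>\<^sup>+x. indicator {x. \<epsilon> < \<bar>x\<bar>} x \<partial>\<nu>)" by simp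
  also have "\<dots> \<le> (\<integral>\<^sup>+x. ennreal (1 / \<epsilon>\<^sup>2) * ennreal (x\<^sup>2) \<partial>\<nu>)"
  proof (rule nn_integral_mono)
    fix x :: real
    show "indicator {x. \<epsilon> < \<bar>x\<bar>} x \<le> ennreal (1 / \<epsilon>\<^sup>2) * ennreal (x\<^sup>2)"
    proof (cases "\<epsilon> < \<bar>x\<bar>")
      case True
      then have "\<epsilon>\<^sup>2 \<le> x\<^sup>2" using assms by (simp flip: abs_le_square_iff)
      then have "1 \<le> 1 / \<epsilon>\<^sup>2 * x\<^sup>2" using assms by (simp add: field_simps)
      then show ?thesis using True by (simp flip: ennreal_mult')
    qed simp
  qed
  also have "\<dots> = ennreal (1 / \<epsilon>\<^sup>2)" by (simp add: nn_integral_cmult nu2)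
  finally show ?thesis by (simp add: order_le_less_trans)
qed

text \<open>The line is covered by the null set {0} and countably many tails of finite measure.
  Sigma-finiteness makes the product measure \<open>jump_compensator\<close> computable on
  rectangles.\<close>

sublocale sigma_finite_measure \<nu>
proof
  let ?B = "\<lambda>k::nat. {x. 1 / (real k + 1) < \<bar>x\<bar>}"
  show "\<exists>A. countable A \<and> A \<subseteq> sets \<nu> \<and> \<Union>A = space \<nu> \<and> (\<forall>a\<in>A. emeasure \<nu> a \<noteq> \<infinity>)"
  proof (intro exI conjI ballI)
    show "countable (insert {0} (range ?B))" by auto
    show "insert {0} (range ?B) \<subseteq> sets \<nu>" by auto
    have "\<exists>k. x \<in> ?B k" if "x \<noteq> 0" for x
      using reals_Archimedean[of "\<bar>x\<bar>"] that by (auto simp: inverse_eq_divide add.commute)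
    then show "\<Union>(insert {0} (range ?B)) = space \<nu>" by auto
    show "emeasure \<nu> a \<noteq> \<infinity>" if "a \<in> insert {0} (range ?B)" for a
      using that emeasure_tail nu0 by (auto simp: less_top[symmetric])
  qed
qed

abbreviation "\<eta> \<equiv> jump_compensator \<nu>"

lemma sets_eta[measurable_cong, simp]: "sets \<eta> = sets borel"
  unfolding jump_compensator_def borel_prod[symmetric]
  by (intro sets_pair_measure_cong) auto

lemma emeasure_eta:
  assumes "0 \<le> s" "s \<le> t" "B \<in> sets borel"
  shows "emeasure \<eta> ({s<..t} \<times> B) = ennreal (t - s) * emeasure \<nu> B"
proof -
  have "emeasure \<eta> ({s<..t} \<times> B) = emeasure (density lborel (indicator {0<..})) {s<..t} * emeasure \<nu> B"
    unfolding jump_compensator_def by (rule emeasure_pair_measure_Times) (use assms in auto)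
  also have "emeasure (density lborel (indicator {0<..})) {s<..t} = emeasure lborel {s<..t}"
  proof -
    have "{0<..} \<inter> {s<..t} = {s<..t}" using assms by auto
    then show ?thesis by (subst emeasure_density) (auto simp: indicator_inter_arith[symmetric] cong: nn_integral_cong)
  qed
  finally show ?thesis using assms by simp
qed

lemma nn_integral_eta_snd:
  assumes "0 \<le> s" "s \<le> t" "h \<in> borel_measurable borel"
  shows "(\<integral>\<^sup>+p. h (snd p) * indicator ({s<..t} \<times> UNIV) p \<partial>\<eta>) = ennreal (t - s) * (\<integral>\<^sup>+x. h x \<partial>\<nu>)"
proof -
  have "(\<integral>\<^sup>+p. h (snd p) * indicator ({s<..t} \<times> UNIV) p \<partial>\<eta>) =
     (\<integral>\<^sup>+y. \<integral>\<^sup>+x. h x * indicator {s<..t} y \<partial>\<nu> \<partial>density lborel (indicator {0<..}))"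
    unfolding jump_compensator_def using assms(3)
    by (subst nn_integral_fst[symmetric]) (auto simp: indicator_times intro!: nn_integral_cong)
  also have "\<dots> = (\<integral>\<^sup>+y. (\<integral>\<^sup>+x. h x \<partial>\<nu>) * indicator {s<..t} y \<partial>density lborel (indicator {0<..}))"
    using assms(3) by (simp add: nn_integral_multc)
  also have "\<dots> = (\<integral>\<^sup>+x. h x \<partial>\<nu>) * emeasure (density lborel (indicator {0<..})) {s<..t}"
    by (rule nn_integral_cmult_indicator) simp
  also have "emeasure (density lborel (indicator {0<..})) {s<..t} = emeasure lborel {s<..t}"
  proof -
    have "{0<..} \<inter> {s<..t} = {s<..t}" using assms by auto
    then show ?thesis by (subst emeasure_density) (auto simp: indicator_inter_arith[symmetric] cong: nn_integral_cong)
  qed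
  finally show ?thesis using assms by (simp add: mult.commute)
qed

end

section \<open>Second order bounds for the increments of the noise\<close>

text \<open>Fatou's lemma. Almost sure convergence suffices, without any uniform integrability; the
  price is that an equality of moments turns into an inequality.\<close>

lemma nn_integral_square_le_limit:
  fixes u :: "nat \<Rightarrow> 'a \<Rightarrow> real"
  assumes m: "\<And>l. u l \<in> borel_measurable M"
    and lim: "AE \<omega> in M. (\<lambda>l. u l \<omega>) \<longlonglongrightarrow> v \<omega>"
    and le: "\<And>l. (\<integral>\<^sup>+\<omega>. ennreal ((u l \<omega>)\<^sup>2) \<partial>M) \<le> ennreal (C l)" and C: "C \<longlonglongrightarrow> c"
  shows "(\<integral>\<^sup>+\<omega>. ennreal ((v \<omega>)\<^sup>2) \<partial>M) \<le> ennreal c"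
proof -
  have "(\<integral>\<^sup>+\<omega>. ennreal ((v \<omega>)\<^sup>2) \<partial>M) = (\<integral>\<^sup>+\<omega>. liminf (\<lambda>l. ennreal ((u l \<omega>)\<^sup>2)) \<partial>M)"
  proof (rule nn_integral_cong_AE)
    show "AE \<omega> in M. ennreal ((v \<omega>)\<^sup>2) = liminf (\<lambda>l. ennreal ((u l \<omega>)\<^sup>2))"
      using lim
    proof eventually_elim
      case (elim \<omega>)
      then have "(\<lambda>l. ennreal ((u l \<omega>)\<^sup>2)) \<longlonglongrightarrow> ennreal ((v \<omega>)\<^sup>2)"
        by (intro tendsto_ennrealI tendsto_power)
      then show ?case by (rule lim_imp_Liminf[OF sequentially_bot, symmetric])
    qed
  qed
  also have "\<dots> \<le> liminf (\<lambda>l. \<integral>\<^sup>+\<omega>. ennreal ((u l \<omega>)\<^sup>2) \<partial>M)"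
    by (rule nn_integral_liminf) (use m in measurable)
  also have "\<dots> \<le> liminf (\<lambda>l. ennreal (C l))"
    by (intro Liminf_mono always_eventually allI le)
  also have "\<dots> = ennreal c"
    using tendsto_ennrealI[OF C] by (simp add: lim_imp_Liminf)
  finally show ?thesis .
qed

text \<open>The bounds of \<open>linear_form\<close> and \<open>quadratic_forms_bound\<close> for
  increments over cells of length \<open>h k\<close> whose variance is \<open>s * h k\<close> and
  whose excess fourth moment is \<open>q * h k\<close>. Independence is left out on purpose: these
  inequalities pass to almost sure limits directly.\<close>

definition forms_bound ::
  "'a measure \<Rightarrow> nat \<Rightarrow> (nat \<Rightarrow> real) \<Rightarrow> real \<Rightarrow> real \<Rightarrow> (nat \<Rightarrow> 'a \<Rightarrow> real) \<Rightarrow> bool" where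
  "forms_bound M K h s q D \<longleftrightarrow>
     (\<forall>a. (\<integral>\<^sup>+\<omega>. ennreal ((\<Sum>k<K. a k * D k \<omega>)\<^sup>2) \<partial>M) \<le> ennreal (s * (\<Sum>k<K. (a k)\<^sup>2 * h k))) \<and>
     (\<forall>(J :: nat set) x a. finite J \<longrightarrow>
        (\<integral>\<^sup>+\<omega>. ennreal ((\<Sum>j\<in>J. x j * ((\<Sum>k<K. a j k * D k \<omega>)\<^sup>2 - s * (\<Sum>k<K. (a j k)\<^sup>2 * h k)))\<^sup>2) \<partial>M)
        \<le> ennreal (2 * s\<^sup>2 * (\<Sum>j\<in>J. \<Sum>i\<in>J. x j * x i * (\<Sum>k<K. a j k * a i k * h k)\<^sup>2)
             + q * (\<Sum>k<K. (\<Sum>j\<in>J. x j * (a j k)\<^sup>2)\<^sup>2 * h k)))"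

lemma forms_bound_limit:
  assumes fb: "\<And>l. forms_bound M K h (s l) (q l) (D l)" and s: "s \<longlonglongrightarrow> s0" and q: "q \<longlonglongrightarrow> q0"
    and m: "\<And>l k. k < K \<Longrightarrow> D l k \<in> borel_measurable M"
    and lim: "AE \<omega> in M. \<forall>k<K. (\<lambda>l. D l k \<omega>) \<longlonglongrightarrow> D0 k \<omega>"
  shows "forms_bound M K h s0 q0 D0"
  unfolding forms_bound_def
proof (intro conjI allI impI)
  fix a :: "nat \<Rightarrow> real"
  show "(\<integral>\<^sup>+\<omega>. ennreal ((\<Sum>k<K. a k * D0 k \<omega>)\<^sup>2) \<partial>M) \<le> ennreal (s0 * (\<Sum>k<K. (a k)\<^sup>2 * h k))"
  proof (rule nn_integral_square_le_limit)
    show "(\<lambda>\<omega>. \<Sum>k<K. a k * D l k \<omega>) \<in> borel_measurable M" for l using m by auto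
    show "AE \<omega> in M. (\<lambda>l. \<Sum>k<K. a k * D l k \<omega>) \<longlonglongrightarrow> (\<Sum>k<K. a k * D0 k \<omega>)"
      using lim by eventually_elim (auto intro!: tendsto_intros)
    show "(\<integral>\<^sup>+\<omega>. ennreal ((\<Sum>k<K. a k * D l k \<omega>)\<^sup>2) \<partial>M) \<le> ennreal (s l * (\<Sum>k<K. (a k)\<^sup>2 * h k))" for l
      using fb unfolding forms_bound_def by blast
    show "(\<lambda>l. s l * (\<Sum>k<K. (a k)\<^sup>2 * h k)) \<longlonglongrightarrow> s0 * (\<Sum>k<K. (a k)\<^sup>2 * h k)"
      by (intro tendsto_intros s)
  qed
next
  fix J :: "nat set" and x a assume J: "finite J"
  show "(\<integral>\<^sup>+\<omega>. ennreal ((\<Sum>j\<in>J. x j * ((\<Sum>k<K. a j k * D0 k \<omega>)\<^sup>2 - s0 * (\<Sum>k<K. (a j k)\<^sup>2 * h k)))\<^sup>2) \<partial>M)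
        \<le> ennreal (2 * s0\<^sup>2 * (\<Sum>j\<in>J. \<Sum>i\<in>J. x j * x i * (\<Sum>k<K. a j k * a i k * h k)\<^sup>2)
             + q0 * (\<Sum>k<K. (\<Sum>j\<in>J. x j * (a j k)\<^sup>2)\<^sup>2 * h k))"
  proof (rule nn_integral_square_le_limit)
    show "(\<lambda>\<omega>. \<Sum>j\<in>J. x j * ((\<Sum>k<K. a j k * D l k \<omega>)\<^sup>2 - s l * (\<Sum>k<K. (a j k)\<^sup>2 * h k))) \<in> borel_measurable M" for l
      using m by auto
    show "AE \<omega> in M. (\<lambda>l. \<Sum>j\<in>J. x j * ((\<Sum>k<K. a j k * D l k \<omega>)\<^sup>2 - s l * (\<Sum>k<K. (a j k)\<^sup>2 * h k)))
       \<longlonglongrightarrow> (\<Sum>j\<in>J. x j * ((\<Sum>k<K. a j k * D0 k \<omega>)\<^sup>2 - s0 * (\<Sum>k<K. (a j k)\<^sup>2 * h k)))"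
      using lim by eventually_elim (auto intro!: tendsto_intros s)
    show "(\<integral>\<^sup>+\<omega>. ennreal ((\<Sum>j\<in>J. x j * ((\<Sum>k<K. a j k * D l k \<omega>)\<^sup>2 - s l * (\<Sum>k<K. (a j k)\<^sup>2 * h k)))\<^sup>2) \<partial>M)
        \<le> ennreal (2 * (s l)\<^sup>2 * (\<Sum>j\<in>J. \<Sum>i\<in>J. x j * x i * (\<Sum>k<K. a j k * a i k * h k)\<^sup>2)
             + q l * (\<Sum>k<K. (\<Sum>j\<in>J. x j * (a j k)\<^sup>2)\<^sup>2 * h k))" for l
      using fb J unfolding forms_bound_def by blast
    show "(\<lambda>l. 2 * (s l)\<^sup>2 * (\<Sum>j\<in>J. \<Sum>i\<in>J. x j * x i * (\<Sum>k<K. a j k * a i k * h k)\<^sup>2)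
             + q l * (\<Sum>k<K. (\<Sum>j\<in>J. x j * (a j k)\<^sup>2)\<^sup>2 * h k)) \<longlonglongrightarrow>
        2 * s0\<^sup>2 * (\<Sum>j\<in>J. \<Sum>i\<in>J. x j * x i * (\<Sum>k<K. a j k * a i k * h k)\<^sup>2)
             + q0 * (\<Sum>k<K. (\<Sum>j\<in>J. x j * (a j k)\<^sup>2)\<^sup>2 * h k)"
      by (intro tendsto_intros s q)
  qed
qed

text \<open>Poisson counts are declared independent as a family indexed by the sets themselves. This
  turns it into a family indexed by names of the sets, provided that different names denote
  different sets.\<close>

lemma (in prob_space) indep_vars_reindex:
  assumes ind: "indep_vars (\<lambda>_. N) X (f ` I)" and inj: "inj_on f I"
  shows "indep_vars (\<lambda>_. N) (\<lambda>i. X (f i)) I"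
  unfolding indep_vars_def2
proof (intro conjI ballI)
  show "i \<in> I \<Longrightarrow> random_variable N (X (f i))" for i
    using ind unfolding indep_vars_def2 by auto
  have isets: "indep_sets (\<lambda>i. {X i -` A \<inter> space M | A. A \<in> sets N}) (f ` I)"
    using ind unfolding indep_vars_def2 by auto
  show "indep_sets (\<lambda>i. {X (f i) -` A \<inter> space M | A. A \<in> sets N}) I"
  proof (rule indep_setsI)
    show "i \<in> I \<Longrightarrow> {X (f i) -` A \<inter> space M | A. A \<in> sets N} \<subseteq> events" for i
      using isets unfolding indep_sets_def by auto
    fix A J assume J: "J \<noteq> {}" "J \<subseteq> I" "finite J" and A: "\<forall>j\<in>J. A j \<in> {X (f j) -` A \<inter> space M | A. A \<in> sets N}"
    have injJ: "inj_on f J" using inj J by (auto intro: inj_on_subset)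
    define A' where "A' = (\<lambda>i. A (the_inv_into J f i))"
    have A': "A' (f j) = A j" if "j \<in> J" for j
      unfolding A'_def using the_inv_into_f_f[OF injJ that] by simp
    have "prob (\<Inter>j\<in>f ` J. A' j) = (\<Prod>j\<in>f ` J. prob (A' j))"
      by (rule indep_setsD[OF isets]) (use J A A' in auto)
    then show "prob (\<Inter>j\<in>J. A j) = (\<Prod>j\<in>J. prob (A j))"
      using A' by (simp add: prod.reindex[OF injJ])
  qed
qed

locale driving_noise = prob_space M + levy \<nu> for M :: "'a measure" and \<nu> +
  fixes w :: "real \<Rightarrow> 'a \<Rightarrow> real" and \<mu> :: "'a \<Rightarrow> (real \<times> real) measure"
  assumes bm: "brownian_motion M w"
    and prm: "poisson_random_measure M (jump_compensator \<nu>) \<mu>"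
    and indep: "independent_bm_prm M w (jump_compensator \<nu>) \<mu>"
begin

lemma w_measurable: "0 \<le> t \<Longrightarrow> w t \<in> borel_measurable M"
  using bm unfolding brownian_motion_def by auto

lemma sets_mu: "\<omega> \<in> space M \<Longrightarrow> sets (\<mu> \<omega>) = sets borel"
  using prm unfolding poisson_random_measure_def by simp

lemma mu_measurable: "A \<in> sets borel \<Longrightarrow> (\<lambda>\<omega>. emeasure (\<mu> \<omega>) A) \<in> borel_measurable M"
  using prm unfolding poisson_random_measure_def by simp

lemma
  assumes A: "A \<in> sets borel" "emeasure \<eta> A < \<infinity>"
  shows mu_int4: "integrable M (\<lambda>\<omega>. (enn2real (emeasure (\<mu> \<omega>) A) - measure \<eta> A) ^ 4)"
    and mu_mean: "expectation (\<lambda>\<omega>. enn2real (emeasure (\<mu> \<omega>) A) - measure \<eta> A) = 0"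
    and mu_var: "expectation (\<lambda>\<omega>. (enn2real (emeasure (\<mu> \<omega>) A) - measure \<eta> A)\<^sup>2) = measure \<eta> A"
    and mu_mom4: "expectation (\<lambda>\<omega>. (enn2real (emeasure (\<mu> \<omega>) A) - measure \<eta> A) ^ 4) = 3 * (measure \<eta> A)\<^sup>2 + measure \<eta> A"
    and mu_finite: "AE \<omega> in M. emeasure (\<mu> \<omega>) A < \<infinity>"
    and mu_expectation: "(\<integral>\<^sup>+\<omega>. emeasure (\<mu> \<omega>) A \<partial>M) = emeasure \<eta> A"
proof -
  have pr: "prob {\<omega>\<in>space M. emeasure (\<mu> \<omega>) A = of_nat k} = exp (- measure \<eta> A) * measure \<eta> A ^ k / fact k" for k :: nat
    using prm A unfolding poisson_random_measure_def by simp
  note pm = poisson_moments[OF mu_measurable[OF A(1)] measure_nonneg pr]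
  show "integrable M (\<lambda>\<omega>. (enn2real (emeasure (\<mu> \<omega>) A) - measure \<eta> A) ^ 4)"
    "expectation (\<lambda>\<omega>. enn2real (emeasure (\<mu> \<omega>) A) - measure \<eta> A) = 0"
    "expectation (\<lambda>\<omega>. (enn2real (emeasure (\<mu> \<omega>) A) - measure \<eta> A)\<^sup>2) = measure \<eta> A"
    "expectation (\<lambda>\<omega>. (enn2real (emeasure (\<mu> \<omega>) A) - measure \<eta> A) ^ 4) = 3 * (measure \<eta> A)\<^sup>2 + measure \<eta> A"
    "AE \<omega> in M. emeasure (\<mu> \<omega>) A < \<infinity>"
    by (rule pm)+
  show "(\<integral>\<^sup>+\<omega>. emeasure (\<mu> \<omega>) A \<partial>M) = emeasure \<eta> A"
    using pm(6) A by (simp add: emeasure_eq_ennreal_measure less_top)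
qed

lemma campbell_mu:
  assumes "A \<in> sets borel" "emeasure \<eta> A < \<infinity>" "h \<in> borel_measurable borel"
  shows "(\<lambda>\<omega>. \<integral>\<^sup>+p. h p * indicator A p \<partial>\<mu> \<omega>) \<in> borel_measurable M"
    and "(\<integral>\<^sup>+\<omega>. (\<integral>\<^sup>+p. h p * indicator A p \<partial>\<mu> \<omega>) \<partial>M) = (\<integral>\<^sup>+p. h p * indicator A p \<partial>\<eta>)"
  using campbell[OF prob_space_axioms prm, of A h] mu_expectation assms by simp_all

text \<open>If \<open>g\<close> is simple and vanishes on small jumps, the compensated sum of
  \<open>g\<close> over the jumps in a time cell is a finite combination of centred Poisson counts
  of the boxes \<open>A k y\<close>. The value 0 is left out of \<open>Y\<close> because its level
  set may have infinite measure. Brownian increments and counts together form one independent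
  centred family.\<close>

lemma simple_increments_forms_bound:
  fixes p :: "nat \<Rightarrow> real" and g :: "real \<Rightarrow> real" and \<sigma>\<^sub>1 \<sigma>\<^sub>2 :: real
  assumes p0: "0 \<le> p 0" and p: "\<And>k. k < K \<Longrightarrow> p k < p (Suc k)"
    and g: "simple_function borel g" and "0 < \<epsilon>" and g0: "\<And>x. \<not> \<epsilon> < \<bar>x\<bar> \<Longrightarrow> g x = 0"
  defines "Y \<equiv> g ` UNIV - {0}" and "A \<equiv> \<lambda>k y. {p k<..p (Suc k)} \<times> g -` {y}"
  shows "forms_bound M K (\<lambda>k. p (Suc k) - p k) (\<sigma>\<^sub>1\<^sup>2 + \<sigma>\<^sub>2\<^sup>2 * (\<integral>x. (g x)\<^sup>2 \<partial>\<nu>)) (\<sigma>\<^sub>2 ^ 4 * (\<integral>x. g x ^ 4 \<partial>\<nu>))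
    (\<lambda>k \<omega>. \<sigma>\<^sub>1 * (w (p (Suc k)) \<omega> - w (p k) \<omega>)
      + \<sigma>\<^sub>2 * (\<Sum>y\<in>Y. y * (enn2real (emeasure (\<mu> \<omega>) (A k y)) - measure \<eta> (A k y))))" (is ?bound)
    and "\<And>k. k < K \<Longrightarrow> (\<Sum>y\<in>Y. y * measure \<eta> (A k y)) = (p (Suc k) - p k) * (\<integral>x. g x \<partial>\<nu>)"
proof -
  have finY: "finite Y" using g unfolding Y_def simple_function_def by auto
  have gm[measurable]: "g \<in> borel_measurable borel" using g by (rule borel_measurable_simple_function)
  have gy: "g -` {y} \<in> sets borel" for y
    using measurable_sets[OF gm, of "{y}"] by simp
  have finy: "emeasure \<nu> (g -` {y}) < \<infinity>" if "y \<noteq> 0" for y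
  proof -
    have "g -` {y} \<subseteq> {x. \<epsilon> < \<bar>x\<bar>}" using g0 that by auto
    then show ?thesis using emeasure_mono[of "g -` {y}" "{x. \<epsilon> < \<bar>x\<bar>}" \<nu>] emeasure_tail[OF \<open>0 < \<epsilon>\<close>]
      by (simp add: order_le_less_trans)
  qed
  have pmono: "i \<le> j \<Longrightarrow> j \<le> K \<Longrightarrow> p i \<le> p j" for i j
  proof (induction j)
    case (Suc j) then show ?case using p[of j] by (cases "i = Suc j") auto
  qed simp
  have pn: "0 \<le> p k" if "k \<le> K" for k using pmono[of 0 k] p0 that by auto
  have A_sets: "A k y \<in> sets borel" for k y
    unfolding A_def borel_prod[symmetric] using gy by (intro pair_measureI) auto
  have A_em: "emeasure \<eta> (A k y) = ennreal (p (Suc k) - p k) * emeasure \<nu> (g -` {y})" if "k < K" for k y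
    unfolding A_def by (rule emeasure_eta) (use p[OF that] pn[of k] that gy in auto)
  have A_fin: "emeasure \<eta> (A k y) < \<infinity>" if "k < K" "y \<in> Y" for k y
    using A_em[OF that(1)] finy[of y] that unfolding Y_def by (auto simp: ennreal_mult_less_top)
  have A_meas: "measure \<eta> (A k y) = (p (Suc k) - p k) * measure \<nu> (g -` {y})" if "k < K" for k y
    unfolding measure_def A_em[OF that] using p[OF that] by (simp add: enn2real_mult)
  define I where "I = {..<K} <+> ({..<K} \<times> Y)"
  define X where "X = case_sum (\<lambda>k \<omega>. w (p (Suc k)) \<omega> - w (p k) \<omega>)
     (\<lambda>(k, y) \<omega>. enn2real (emeasure (\<mu> \<omega>) (A k y)) - measure \<eta> (A k y))"
  define v where "v = case_sum (\<lambda>k. p (Suc k) - p k) (\<lambda>(k, y). measure \<eta> (A k y))"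
  define u where "u = case_sum (\<lambda>k::nat. 0) (\<lambda>(k, y). measure \<eta> (A k y))"
  have ind1: "indep_vars (\<lambda>_. borel) (\<lambda>k \<omega>. w (p (Suc k)) \<omega> - w (p k) \<omega>) {..<K}"
  proof -
    \<comment> \<open>The definition of Brownian motion asks for a partition that is monotone on all
      indices, so \<open>p\<close> is continued as a constant beyond \<open>K\<close>.\<close>
    define \<tau> where "\<tau> = (\<lambda>i. p (min i K))"
    have "0 \<le> \<tau> 0" "mono \<tau>" unfolding \<tau>_def mono_def using p0 pmono by auto
    then have "indep_vars (\<lambda>_. borel) (\<lambda>i \<omega>. w (\<tau> (Suc i)) \<omega> - w (\<tau> i) \<omega>) {..<K}"
      using bm unfolding brownian_motion_def by blast
    moreover have "\<tau> (Suc i) = p (Suc i)" "\<tau> i = p i" if "i < K" for i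
      using that unfolding \<tau>_def by (auto simp: min_def)
    ultimately show ?thesis by (subst (asm) indep_vars_cong) auto
  qed
  have injA: "inj_on (\<lambda>(k, y). A k y) ({..<K} \<times> Y)"
    and disA: "disjoint ((\<lambda>(k, y). A k y) ` ({..<K} \<times> Y))"
  proof -
    \<comment> \<open>Nonempty boxes make the naming by pairs injective: disjoint boxes could
      otherwise coincide by being empty. This is one reason for strictly increasing partition
      points.\<close>
    have ne: "A k y \<noteq> {}" if "k < K" "y \<in> Y" for k y
      using p[OF that(1)] that(2) unfolding A_def Y_def by auto
    have dj: "A k y \<inter> A k' y' = {}" if "k < K" "k' < K" "(k, y) \<noteq> (k', y')" for k y k' y'
    proof (cases "y = y'")
      case True
      then have "k \<noteq> k'" using that by auto
      then consider "k < k'" | "k' < k" by linarith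
      then have "{p k<..p (Suc k)} \<inter> {p k'<..p (Suc k')} = {}"
      proof cases
        case 1 then show ?thesis using pmono[of "Suc k" k'] that by auto
      next
        case 2 then show ?thesis using pmono[of "Suc k'" k] that by auto
      qed
      then show ?thesis unfolding A_def by blast
    qed (auto simp: A_def)
    show "inj_on (\<lambda>(k, y). A k y) ({..<K} \<times> Y)"
    proof (rule inj_onI)
      fix a b assume "a \<in> {..<K} \<times> Y" "b \<in> {..<K} \<times> Y" "(\<lambda>(k, y). A k y) a = (\<lambda>(k, y). A k y) b"
      then show "a = b"
        using dj[of "fst a" "fst b" "snd a" "snd b"] ne[of "fst a" "snd a"] by (cases a; cases b) auto
    qed
    show "disjoint ((\<lambda>(k, y). A k y) ` ({..<K} \<times> Y))"
      unfolding disjoint_def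
    proof (intro ballI impI)
      fix B C assume B: "B \<in> (\<lambda>(k, y). A k y) ` ({..<K} \<times> Y)" and C: "C \<in> (\<lambda>(k, y). A k y) ` ({..<K} \<times> Y)" and ne: "B \<noteq> C"
      from B obtain k y where "k < K" "B = A k y" by auto
      moreover from C obtain k' y' where "k' < K" "C = A k' y'" by auto
      ultimately show "B \<inter> C = {}" using ne dj[of k k' y y'] by auto
    qed
  qed
  have ind2: "indep_vars (\<lambda>_. borel) (\<lambda>(k, y) \<omega>. enn2real (emeasure (\<mu> \<omega>) (A k y)) - measure \<eta> (A k y)) ({..<K} \<times> Y)"
  proof -
    have "indep_vars (\<lambda>_. borel) (\<lambda>B \<omega>. emeasure (\<mu> \<omega>) B) ((\<lambda>(k, y). A k y) ` ({..<K} \<times> Y))"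
    proof -
      have "finite ((\<lambda>(k, y). A k y) ` ({..<K} \<times> Y))" using finY by simp
      moreover have "(\<lambda>(k, y). A k y) ` ({..<K} \<times> Y) \<subseteq> sets \<eta>" using A_sets by auto
      ultimately show ?thesis using prm disA unfolding poisson_random_measure_def by simp
    qed
    then have "indep_vars (\<lambda>_. borel) (\<lambda>ky \<omega>. emeasure (\<mu> \<omega>) ((\<lambda>(k, y). A k y) ky)) ({..<K} \<times> Y)"
      by (rule indep_vars_reindex[OF _ injA])
    then have "indep_vars (\<lambda>_. borel) (\<lambda>ky \<omega>. enn2real (emeasure (\<mu> \<omega>) ((\<lambda>(k, y). A k y) ky)) - measure \<eta> ((\<lambda>(k, y). A k y) ky)) ({..<K} \<times> Y)"
      by (rule indep_vars_compose2) simp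
    then show ?thesis by (simp add: case_prod_unfold)
  qed
  have ind: "indep_vars (\<lambda>_. borel) X I"
    unfolding X_def I_def
  proof (rule indep_vars_join[OF ind1 ind2])
    show "indep_set (sets (vimage_algebra (space M) (\<lambda>\<omega>. \<lambda>t\<in>{0..}. w t \<omega>) (Pi\<^sub>M {0..} (\<lambda>_. borel))))
       (sets (vimage_algebra (space M) (\<lambda>\<omega>. \<lambda>A\<in>sets \<eta>. emeasure (\<mu> \<omega>) A) (Pi\<^sub>M (sets \<eta>) (\<lambda>_. borel))))"
      using indep unfolding independent_bm_prm_def .
    \<comment> \<open>Independence of \<open>w\<close> and \<open>\<mu>\<close> is stated for the
      sigma-algebras that they generate, so increments and counts must be measurable for these and
      not merely for \<open>M\<close>.\<close>
    have mw: "w t \<in> borel_measurable (vimage_algebra (space M) (\<lambda>\<omega>. \<lambda>t\<in>{0..}. w t \<omega>) (Pi\<^sub>M {0..} (\<lambda>_. borel)))" if "0 \<le> t" for t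
    proof -
      have "(\<lambda>\<omega>. (\<lambda>t\<in>{0..}. w t \<omega>) t) \<in> borel_measurable (vimage_algebra (space M) (\<lambda>\<omega>. \<lambda>t\<in>{0..}. w t \<omega>) (Pi\<^sub>M {0..} (\<lambda>_. borel)))"
        by (rule measurable_compose[OF measurable_vimage_algebra1 measurable_component_singleton])
          (use that in \<open>auto simp: space_PiM split: if_splits\<close>)
      then show ?thesis using that by simp
    qed
    show "k \<in> {..<K} \<Longrightarrow> (\<lambda>\<omega>. w (p (Suc k)) \<omega> - w (p k) \<omega>) \<in> borel_measurable (vimage_algebra (space M) (\<lambda>\<omega>. \<lambda>t\<in>{0..}. w t \<omega>) (Pi\<^sub>M {0..} (\<lambda>_. borel)))" for k
      by (intro borel_measurable_diff mw pn) auto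
    have mm: "(\<lambda>\<omega>. emeasure (\<mu> \<omega>) B) \<in> borel_measurable (vimage_algebra (space M) (\<lambda>\<omega>. \<lambda>A\<in>sets \<eta>. emeasure (\<mu> \<omega>) A) (Pi\<^sub>M (sets \<eta>) (\<lambda>_. borel)))" if "B \<in> sets borel" for B
    proof -
      have "(\<lambda>\<omega>. (\<lambda>A\<in>sets \<eta>. emeasure (\<mu> \<omega>) A) B) \<in> borel_measurable (vimage_algebra (space M) (\<lambda>\<omega>. \<lambda>A\<in>sets \<eta>. emeasure (\<mu> \<omega>) A) (Pi\<^sub>M (sets \<eta>) (\<lambda>_. borel)))"
        by (rule measurable_compose[OF measurable_vimage_algebra1 measurable_component_singleton])
          (use that in \<open>auto simp: space_PiM split: if_splits\<close>)
      then show ?thesis using that by simp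
    qed
    show "(case ky of (k, y) \<Rightarrow> \<lambda>\<omega>. enn2real (emeasure (\<mu> \<omega>) (A k y)) - measure \<eta> (A k y))
       \<in> borel_measurable (vimage_algebra (space M) (\<lambda>\<omega>. \<lambda>A\<in>sets \<eta>. emeasure (\<mu> \<omega>) A) (Pi\<^sub>M (sets \<eta>) (\<lambda>_. borel)))" for ky
      by (cases ky) (use mm[OF A_sets] in simp)
  qed simp_all
  have finI: "finite I" unfolding I_def using finY by auto
  have mom: "integrable M (\<lambda>\<omega>. X i \<omega> ^ 4) \<and> expectation (X i) = 0 \<and> expectation (\<lambda>\<omega>. (X i \<omega>)\<^sup>2) = v i
     \<and> expectation (\<lambda>\<omega>. X i \<omega> ^ 4) \<le> 3 * (v i)\<^sup>2 + u i" if "i \<in> I" for i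
  proof (cases i)
    case (Inl k)
    then have k: "k < K" using that unfolding I_def by auto
    have D: "distributed M lborel (\<lambda>\<omega>. w (p (Suc k)) \<omega> - w (p k) \<omega>) (\<lambda>x. ennreal (normal_density 0 (sqrt (p (Suc k) - p k)) x))"
      using bm p[OF k] pn[of k] k unfolding brownian_motion_def by auto
    have "0 < sqrt (p (Suc k) - p k)" using p[OF k] by simp
    from normal_moments[OF this D] show ?thesis
      using p[OF k] unfolding Inl X_def v_def u_def by simp
  next
    case (Inr ky)
    with \<open>i \<in> I\<close> obtain k y where ky: "ky = (k, y)" "k < K" "y \<in> Y" unfolding I_def by (cases ky) auto
    note f = A_sets[of k y] A_fin[OF ky(2,3)]
    show ?thesis
      using mu_int4[OF f] mu_mean[OF f] mu_var[OF f] mu_mom4[OF f] unfolding Inr X_def v_def u_def ky(1) by simp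
  qed
  interpret IC: indep_centered M I X v u
    using finI ind mom by unfold_locales auto
  \<comment> \<open>Coefficients of the combination of increments in terms of the elementary
    variables: each increment carries its Brownian part once and the count of box (k, y) with the
    additional factor y.\<close>
  define b where "b = (\<lambda>a :: nat \<Rightarrow> real. case_sum (\<lambda>k. \<sigma>\<^sub>1 * a k) (\<lambda>(k, y). \<sigma>\<^sub>2 * a k * y))"
  have sumI: "(\<Sum>i\<in>I. f i) = (\<Sum>k<K. f (Inl k) + (\<Sum>y\<in>Y. f (Inr (k, y))))" for f :: "_ \<Rightarrow> real"
    unfolding I_def using finY by (simp add: sum.Plus sum.cartesian_product sum.distrib)
  define D where "D = (\<lambda>k \<omega>. \<sigma>\<^sub>1 * (w (p (Suc k)) \<omega> - w (p k) \<omega>)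
      + \<sigma>\<^sub>2 * (\<Sum>y\<in>Y. y * (enn2real (emeasure (\<mu> \<omega>) (A k y)) - measure \<eta> (A k y))))"
  have lin: "(\<Sum>i\<in>I. b a i * X i \<omega>) = (\<Sum>k<K. a k * D k \<omega>)" for a \<omega>
    unfolding sumI b_def X_def D_def by (simp add: sum_distrib_left distrib_left mult_ac)
  \<comment> \<open>The exponent must be positive: for exponent 0 the points with
    \<open>g x = 0\<close> would contribute 1 on the left and nothing on the right.\<close>
  have gint: "(\<integral>x. g x ^ r \<partial>\<nu>) = (\<Sum>y\<in>Y. y ^ r * measure \<nu> (g -` {y}))" if "0 < r" for r
  proof -
    have "g x ^ r = (\<Sum>y\<in>Y. y ^ r * indicator (g -` {y}) x)" for x
    proof (cases "g x = 0")
      case True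
      then have "(\<Sum>y\<in>Y. y ^ r * indicator (g -` {y}) x) = 0"
        by (intro sum.neutral) (auto simp: Y_def)
      then show ?thesis using True that by simp
    next
      case False
      then have "(\<Sum>y\<in>Y. y ^ r * indicator (g -` {y}) x) = (\<Sum>y\<in>{g x}. y ^ r * indicator (g -` {y}) x)"
        using finY by (intro sum.mono_neutral_right) (auto simp: Y_def)
      then show ?thesis by simp
    qed
    then have "(\<integral>x. g x ^ r \<partial>\<nu>) = (\<integral>x. (\<Sum>y\<in>Y. y ^ r * indicator (g -` {y}) x) \<partial>\<nu>)" by simp
    also have "\<dots> = (\<Sum>y\<in>Y. y ^ r * measure \<nu> (g -` {y}))"
      using gy finy by (subst Bochner_Integration.integral_sum) (auto simp: Y_def)
    finally show ?thesis .
  qed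
  define s where "s = \<sigma>\<^sub>1\<^sup>2 + \<sigma>\<^sub>2\<^sup>2 * (\<integral>x. (g x)\<^sup>2 \<partial>\<nu>)"
  have bil: "(\<Sum>i\<in>I. b a i * b a' i * v i) = s * (\<Sum>k<K. a k * a' k * (p (Suc k) - p k))" for a a'
  proof -
    have "(\<Sum>i\<in>I. b a i * b a' i * v i) = (\<Sum>k<K. \<sigma>\<^sub>1\<^sup>2 * (a k * a' k * (p (Suc k) - p k))
        + (\<Sum>y\<in>Y. \<sigma>\<^sub>2\<^sup>2 * y\<^sup>2 * measure \<nu> (g -` {y}) * (a k * a' k * (p (Suc k) - p k))))"
      unfolding sumI b_def v_def by (intro sum.cong) (auto simp: A_meas power2_eq_square mult_ac)
    also have "\<dots> = (\<Sum>k<K. s * (a k * a' k * (p (Suc k) - p k)))"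
    proof (intro sum.cong refl)
      fix k
      have "(\<Sum>y\<in>Y. \<sigma>\<^sub>2\<^sup>2 * y\<^sup>2 * measure \<nu> (g -` {y}) * (a k * a' k * (p (Suc k) - p k)))
          = \<sigma>\<^sub>2\<^sup>2 * (\<integral>x. (g x)\<^sup>2 \<partial>\<nu>) * (a k * a' k * (p (Suc k) - p k))"
        unfolding gint[OF pos2] by (simp only: sum_distrib_left sum_distrib_right mult.assoc)
      then show "\<sigma>\<^sub>1\<^sup>2 * (a k * a' k * (p (Suc k) - p k))
        + (\<Sum>y\<in>Y. \<sigma>\<^sub>2\<^sup>2 * y\<^sup>2 * measure \<nu> (g -` {y}) * (a k * a' k * (p (Suc k) - p k)))
        = s * (a k * a' k * (p (Suc k) - p k))"
        unfolding s_def by (simp only: distrib_right)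
    qed
    finally show ?thesis by (simp add: sum_distrib_left)
  qed
  have bil2: "(\<Sum>i\<in>I. (b a i)\<^sup>2 * v i) = s * (\<Sum>k<K. (a k)\<^sup>2 * (p (Suc k) - p k))" for a
    using bil[of a a] by (simp add: power2_eq_square)
  have quart: "(\<Sum>i\<in>I. (\<Sum>j\<in>J. x j * (b (a j) i)\<^sup>2)\<^sup>2 * u i)
      = \<sigma>\<^sub>2 ^ 4 * (\<integral>x. g x ^ 4 \<partial>\<nu>) * (\<Sum>k<K. (\<Sum>j\<in>J. x j * (a j k)\<^sup>2)\<^sup>2 * (p (Suc k) - p k))"
    for J :: "nat set" and x :: "nat \<Rightarrow> real" and a
  proof -
    have e: "(\<Sum>j\<in>J. x j * (\<sigma>\<^sub>2 * a j k * y)\<^sup>2) = \<sigma>\<^sub>2\<^sup>2 * y\<^sup>2 * (\<Sum>j\<in>J. x j * (a j k)\<^sup>2)" for k y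
      unfolding sum_distrib_left by (intro sum.cong refl) (simp add: power_mult_distrib)
    have tl: "(\<Sum>j\<in>J. x j * (b (a j) (Inl k))\<^sup>2)\<^sup>2 * u (Inl k) = 0" for k
      by (simp add: u_def)
    have tr: "(\<Sum>j\<in>J. x j * (b (a j) (Inr (k, y)))\<^sup>2)\<^sup>2 * u (Inr (k, y))
        = \<sigma>\<^sub>2 ^ 4 * (y ^ 4 * measure \<nu> (g -` {y})) * ((\<Sum>j\<in>J. x j * (a j k)\<^sup>2)\<^sup>2 * (p (Suc k) - p k))"
      if "k < K" for k y
    proof -
      have "(\<Sum>j\<in>J. x j * (b (a j) (Inr (k, y)))\<^sup>2) = \<sigma>\<^sub>2\<^sup>2 * y\<^sup>2 * (\<Sum>j\<in>J. x j * (a j k)\<^sup>2)"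
        unfolding e[symmetric] b_def by simp
      moreover have "u (Inr (k, y)) = (p (Suc k) - p k) * measure \<nu> (g -` {y})"
        unfolding u_def using A_meas[OF that] by simp
      moreover have "(c\<^sup>2 * d\<^sup>2 * S)\<^sup>2 * (h * m) = c ^ 4 * (d ^ 4 * m) * (S\<^sup>2 * h)" for c d S h m :: real
        by algebra
      ultimately show ?thesis by (simp only:)
    qed
    have "(\<Sum>i\<in>I. (\<Sum>j\<in>J. x j * (b (a j) i)\<^sup>2)\<^sup>2 * u i) =
      (\<Sum>k<K. \<Sum>y\<in>Y. \<sigma>\<^sub>2 ^ 4 * (y ^ 4 * measure \<nu> (g -` {y})) * ((\<Sum>j\<in>J. x j * (a j k)\<^sup>2)\<^sup>2 * (p (Suc k) - p k)))"
      unfolding sumI tl add_0 by (intro sum.cong refl tr) simp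
    also have "\<dots> = \<sigma>\<^sub>2 ^ 4 * (\<integral>x. g x ^ 4 \<partial>\<nu>) * (\<Sum>k<K. (\<Sum>j\<in>J. x j * (a j k)\<^sup>2)\<^sup>2 * (p (Suc k) - p k))"
      unfolding gint[OF zero_less_numeral] by (simp only: sum_distrib_left sum_distrib_right)
    finally show ?thesis .
  qed
  show "(\<Sum>y\<in>Y. y * measure \<eta> (A k y)) = (p (Suc k) - p k) * (\<integral>x. g x \<partial>\<nu>)" if "k < K" for k
    using gint[of 1] by (simp add: A_meas[OF that] sum_distrib_left mult_ac)
  show ?bound
    unfolding D_def[symmetric] s_def[symmetric] forms_bound_def
  proof (intro conjI allI impI)
    fix a :: "nat \<Rightarrow> real"
    show "(\<integral>\<^sup>+\<omega>. ennreal ((\<Sum>k<K. a k * D k \<omega>)\<^sup>2) \<partial>M) \<le> ennreal (s * (\<Sum>k<K. (a k)\<^sup>2 * (p (Suc k) - p k)))"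
      using IC.linear_form[of "b a"] unfolding lin bil2 by (simp add: nn_integral_eq_integral)
  next
    fix J :: "nat set" and x :: "nat \<Rightarrow> real" and a assume "finite J"
    from IC.quadratic_forms_bound[OF this, of x "\<lambda>j. b (a j)"]
    show "(\<integral>\<^sup>+\<omega>. ennreal ((\<Sum>j\<in>J. x j * ((\<Sum>k<K. a j k * D k \<omega>)\<^sup>2 - s * (\<Sum>k<K. (a j k)\<^sup>2 * (p (Suc k) - p k))))\<^sup>2) \<partial>M)
        \<le> ennreal (2 * s\<^sup>2 * (\<Sum>j\<in>J. \<Sum>i\<in>J. x j * x i * (\<Sum>k<K. a j k * a i k * (p (Suc k) - p k))\<^sup>2)
             + \<sigma>\<^sub>2 ^ 4 * (\<integral>x. g x ^ 4 \<partial>\<nu>) * (\<Sum>k<K. (\<Sum>j\<in>J. x j * (a j k)\<^sup>2)\<^sup>2 * (p (Suc k) - p k)))"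
      unfolding lin bil bil2 quart power_mult_distrib by (simp add: sum_distrib_left mult_ac)
  qed
qed

end

text \<open>The sum of the squared differences over the finite index set tends to 0 in L1, so a
  single subsequence of it converges almost surely; it then serves all indices at once.\<close>

lemma L2_AE_subseq:
  fixes u :: "nat \<Rightarrow> 'j \<Rightarrow> 'a \<Rightarrow> real"
  assumes fin: "finite J" and u[measurable]: "\<And>k j. j \<in> J \<Longrightarrow> u k j \<in> borel_measurable M"
    and v[measurable]: "\<And>j. j \<in> J \<Longrightarrow> v j \<in> borel_measurable M"
    and lim: "\<And>j. j \<in> J \<Longrightarrow> (\<lambda>k. \<integral>\<^sup>+\<omega>. ennreal ((u k j \<omega> - v j \<omega>)\<^sup>2) \<partial>M) \<longlonglongrightarrow> 0"
  shows "\<exists>r. strict_mono r \<and> (AE \<omega> in M. \<forall>j\<in>J. (\<lambda>k. u (r k) j \<omega>) \<longlonglongrightarrow> v j \<omega>)"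
proof -
  define F where "F = (\<lambda>k \<omega>. \<Sum>j\<in>J. (u k j \<omega> - v j \<omega>)\<^sup>2)"
  have Fm[measurable]: "F k \<in> borel_measurable M" for k unfolding F_def by measurable
  have F0: "0 \<le> F k \<omega>" for k \<omega> unfolding F_def by (simp add: sum_nonneg)
  have Fi: "(\<integral>\<^sup>+\<omega>. ennreal (F k \<omega>) \<partial>M) = (\<Sum>j\<in>J. \<integral>\<^sup>+\<omega>. ennreal ((u k j \<omega> - v j \<omega>)\<^sup>2) \<partial>M)" for k
    unfolding F_def by (subst nn_integral_sum[symmetric]) (auto simp: sum_ennreal)
  have Flim: "(\<lambda>k. \<integral>\<^sup>+\<omega>. ennreal (F k \<omega>) \<partial>M) \<longlonglongrightarrow> 0"
    unfolding Fi using tendsto_sum[of J "\<lambda>j k. \<integral>\<^sup>+\<omega>. ennreal ((u k j \<omega> - v j \<omega>)\<^sup>2) \<partial>M" "\<lambda>_. 0"] lim by auto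
  then have "\<forall>\<^sub>F k in sequentially. (\<integral>\<^sup>+\<omega>. ennreal (F k \<omega>) \<partial>M) < 1"
    by (rule order_tendstoD) simp
  \<comment> \<open>Finitely many initial distances may be infinite; they are skipped so that
    \<open>F\<close> becomes integrable.\<close>
  then obtain N where N: "\<And>k. k \<ge> N \<Longrightarrow> (\<integral>\<^sup>+\<omega>. ennreal (F k \<omega>) \<partial>M) < 1"
    unfolding eventually_sequentially by auto
  have int: "integrable M (F (k + N))" for k
    using N[of "k + N"] F0 by (intro integrableI_nonneg) (auto simp: less_top[symmetric] intro: order_less_trans)
  have "(\<lambda>k. ennreal (\<integral>\<omega>. F (k + N) \<omega> \<partial>M)) \<longlonglongrightarrow> ennreal 0"
    using LIMSEQ_ignore_initial_segment[OF Flim, of N] int F0 by (simp add: nn_integral_eq_integral)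
  then have "(\<lambda>k. \<integral>\<omega>. F (k + N) \<omega> \<partial>M) \<longlonglongrightarrow> 0"
    by (rule tendsto_ennrealD) (auto simp: F0)
  then have "(\<lambda>k. \<integral>\<omega>. norm (F (k + N) \<omega>) \<partial>M) \<longlonglongrightarrow> 0" using F0 by simp
  from tendsto_L1_AE_subseq[OF int this]
  obtain r where r: "strict_mono r" "AE \<omega> in M. (\<lambda>k. F (r k + N) \<omega>) \<longlonglongrightarrow> 0" by auto
  show ?thesis
  proof (intro exI conjI)
    show "strict_mono (\<lambda>k. r k + N)" using r(1) by (auto simp: strict_mono_def)
    show "AE \<omega> in M. \<forall>j\<in>J. (\<lambda>k. u (r k + N) j \<omega>) \<longlonglongrightarrow> v j \<omega>"
      using r(2)
    proof eventually_elim
      case (elim \<omega>)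
      show ?case
      proof
        fix j assume j: "j \<in> J"
        have "(\<lambda>k. sqrt (F (r k + N) \<omega>)) \<longlonglongrightarrow> sqrt 0" by (intro tendsto_real_sqrt elim)
        then have lim0: "(\<lambda>k. sqrt (F (r k + N) \<omega>)) \<longlonglongrightarrow> 0" by simp
        have le: "norm (u (r k + N) j \<omega> - v j \<omega>) \<le> sqrt (F (r k + N) \<omega>)" for k
        proof -
          have "(u (r k + N) j \<omega> - v j \<omega>)\<^sup>2 \<le> F (r k + N) \<omega>"
            unfolding F_def using member_le_sum[of j J "\<lambda>j. (u (r k + N) j \<omega> - v j \<omega>)\<^sup>2"] j fin by auto
          from real_sqrt_le_mono[OF this] show ?thesis by simp
        qed
        have "(\<lambda>k. u (r k + N) j \<omega> - v j \<omega>) \<longlonglongrightarrow> 0"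
          using le by (intro Lim_null_comparison[OF _ lim0] always_eventually allI)
        then show "(\<lambda>k. u (r k + N) j \<omega>) \<longlonglongrightarrow> v j \<omega>" by (rule LIM_zero_cancel)
      qed
    qed
  qed
qed

section \<open>Truncation of the jumps at a level \<epsilon> and its removal\<close>

context levy
begin

definition big :: "real \<Rightarrow> real \<Rightarrow> real" where
  "big \<epsilon> x = indicator {x. \<epsilon> < \<bar>x\<bar>} x * x"

lemma big_measurable[measurable]: "big \<epsilon> \<in> borel_measurable borel"
  unfolding big_def by measurable

text \<open>The first absolute moment of the Levy measure may be infinite near 0. On the truncated
  range it is controlled by the second moment, at the price of a factor 1 / \<epsilon>.\<close>

lemma abs_big_le: "0 < \<epsilon> \<Longrightarrow> \<bar>big \<epsilon> x\<bar> \<le> x\<^sup>2 / \<epsilon>"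
proof -
  assume e: "0 < \<epsilon>"
  show ?thesis
  proof (cases "\<epsilon> < \<bar>x\<bar>")
    case True
    then have "\<epsilon> * \<bar>x\<bar> \<le> \<bar>x\<bar> * \<bar>x\<bar>" by (intro mult_right_mono) auto
    then show ?thesis using True e by (simp add: big_def field_simps power2_eq_square)
  qed (use e in \<open>simp add: big_def\<close>)
qed

lemma abs_big_le': "\<bar>big \<epsilon> x\<bar> \<le> \<bar>x\<bar>"
  by (simp add: big_def indicator_def)

lemma integrable_big: "0 < \<epsilon> \<Longrightarrow> integrable \<nu> (big \<epsilon>)"
  by (rule Bochner_Integration.integrable_bound[where f="\<lambda>x. x\<^sup>2 / \<epsilon>"])
    (auto simp: integrable_x2 intro!: AE_I2 order_trans[OF abs_big_le])

lemma integral_big_tendsto: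
  assumes "filterlim e (at_right 0) sequentially"
  shows "(\<lambda>l. \<integral>x. (big (e l) x)\<^sup>2 \<partial>\<nu>) \<longlonglongrightarrow> 1" and "(\<lambda>l. \<integral>x. big (e l) x ^ 4 \<partial>\<nu>) \<longlonglongrightarrow> (\<integral>x. x ^ 4 \<partial>\<nu>)"
proof -
  have ptw: "(\<lambda>l. big (e l) x) \<longlonglongrightarrow> x" for x
  proof (cases "x = 0")
    case False
    have "e \<longlonglongrightarrow> 0" using assms by (simp add: filterlim_at)
    then have "\<forall>\<^sub>F l in sequentially. e l < \<bar>x\<bar>" by (rule order_tendstoD) (use False in simp)
    then have "\<forall>\<^sub>F l in sequentially. big (e l) x = x" by eventually_elim (simp add: big_def)
    then show ?thesis by (rule tendsto_eventually)
  qed (simp add: big_def)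
  have "\<bar>big \<epsilon> x\<bar>\<^sup>2 \<le> \<bar>x\<bar>\<^sup>2" for \<epsilon> x by (intro power_mono abs_big_le') simp
  then have "(\<lambda>l. \<integral>x. (big (e l) x)\<^sup>2 \<partial>\<nu>) \<longlonglongrightarrow> (\<integral>x. x\<^sup>2 \<partial>\<nu>)"
    by (intro integral_dominated_convergence[where w="\<lambda>x. x\<^sup>2"])
      (auto simp: integrable_x2 intro!: AE_I2 tendsto_power ptw)
  then show "(\<lambda>l. \<integral>x. (big (e l) x)\<^sup>2 \<partial>\<nu>) \<longlonglongrightarrow> 1" by (simp add: integral_x2)
  have "\<bar>big \<epsilon> x\<bar> ^ 4 \<le> \<bar>x\<bar> ^ 4" for \<epsilon> x by (intro power_mono abs_big_le') simp
  then show "(\<lambda>l. \<integral>x. big (e l) x ^ 4 \<partial>\<nu>) \<longlonglongrightarrow> (\<integral>x. x ^ 4 \<partial>\<nu>)"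
    by (intro integral_dominated_convergence[where w="\<lambda>x. x ^ 4"])
      (auto simp: integrable_x4 intro!: AE_I2 tendsto_power ptw)
qed

end


context driving_noise
begin

text \<open>Measurable version of the compensated sum of the jumps larger than \<open>\<epsilon>\<close>.\<close>

definition comp_jumps :: "real \<Rightarrow> real \<Rightarrow> 'a \<Rightarrow> real" where
  "comp_jumps \<epsilon> t \<omega> =
     enn2real (\<integral>\<^sup>+q. ennreal (snd q) * indicator ({0<..t} \<times> {x. \<epsilon> < \<bar>x\<bar>}) q \<partial>\<mu> \<omega>)
     - enn2real (\<integral>\<^sup>+q. ennreal (- snd q) * indicator ({0<..t} \<times> {x. \<epsilon> < \<bar>x\<bar>}) q \<partial>\<mu> \<omega>)
     - t * (\<integral>x. big \<epsilon> x \<partial>\<nu>)"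

lemma tail_sets: "{s<..t} \<times> {x. \<epsilon> < \<bar>x\<bar>} \<in> sets (borel :: (real \<times> real) measure)"
  unfolding borel_prod[symmetric] by (intro pair_measureI) auto

lemma tail_finite: "0 < \<epsilon> \<Longrightarrow> 0 \<le> t \<Longrightarrow> emeasure \<eta> ({0<..t} \<times> {x. \<epsilon> < \<bar>x\<bar>}) < \<infinity>"
  by (subst emeasure_eta) (use emeasure_tail in \<open>auto simp: ennreal_mult_less_top\<close>)

text \<open>Campbell's formula supplies measurability in the sample point only for integrals of
  nonnegative functions against the random measure, hence the separate positive and negative
  parts.\<close>

lemma comp_jumps_measurable: "0 < \<epsilon> \<Longrightarrow> 0 \<le> t \<Longrightarrow> comp_jumps \<epsilon> t \<in> borel_measurable M"
  unfolding comp_jumps_def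
  by (intro borel_measurable_diff borel_measurable_const borel_measurable_enn2real[OF campbell_mu(1)] tail_sets tail_finite)
    (simp_all add: borel_prod[symmetric])

text \<open>The expected number of jumps and the expected sum of their absolute sizes are finite on
  the truncated box, so both random quantities are finite almost surely.\<close>

lemma jumps_finite:
  assumes "0 < \<epsilon>" "0 \<le> t"
  shows "AE \<omega> in M. emeasure (\<mu> \<omega>) ({0<..t} \<times> {x. \<epsilon> < \<bar>x\<bar>}) < \<infinity> \<and>
    integrable (\<mu> \<omega>) (\<lambda>q. indicator ({0<..t} \<times> {x. \<epsilon> < \<bar>x\<bar>}) q * snd q)"
proof -
  let ?B = "{0<..t} \<times> {x. \<epsilon> < \<bar>x\<bar>}"
  note B = tail_sets[of 0 t \<epsilon>] tail_finite[OF assms]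
  have h: "(\<lambda>q. ennreal \<bar>snd q\<bar>) \<in> borel_measurable (borel :: (real \<times> real) measure)"
    unfolding borel_prod[symmetric] by measurable
  have "(\<integral>\<^sup>+q. ennreal \<bar>snd q\<bar> * indicator ?B q \<partial>\<eta>) = (\<integral>\<^sup>+q. ennreal \<bar>big \<epsilon> (snd q)\<bar> * indicator ({0<..t} \<times> UNIV) q \<partial>\<eta>)"
    by (intro nn_integral_cong) (auto simp: big_def indicator_def)
  also have "\<dots> = ennreal (t - 0) * (\<integral>\<^sup>+x. ennreal \<bar>big \<epsilon> x\<bar> \<partial>\<nu>)"
    by (rule nn_integral_eta_snd) (use assms in auto)
  also have "\<dots> \<noteq> \<infinity>"
    using integrable_big[OF assms(1)] by (auto simp: integrable_iff_bounded ennreal_mult_eq_top_iff)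
  finally have "AE \<omega> in M. (\<integral>\<^sup>+q. ennreal \<bar>snd q\<bar> * indicator ?B q \<partial>\<mu> \<omega>) \<noteq> \<infinity>"
    using campbell_mu[OF B h] by (intro nn_integral_PInf_AE) auto
  then show ?thesis
    using mu_finite[OF B] AE_space
  proof eventually_elim
    case (elim \<omega>)
    have "(\<lambda>q. indicator ?B q * snd q) \<in> borel_measurable (\<mu> \<omega>)"
      by (subst measurable_cong_sets[OF sets_mu[OF elim(3)] refl])
        (intro borel_measurable_times borel_measurable_indicator B(1), simp add: borel_prod[symmetric])
    moreover have "(\<integral>\<^sup>+q. ennreal (norm (indicator ?B q * snd q)) \<partial>\<mu> \<omega>) = (\<integral>\<^sup>+q. ennreal \<bar>snd q\<bar> * indicator ?B q \<partial>\<mu> \<omega>)"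
      by (intro nn_integral_cong) (auto simp: indicator_def)
    ultimately show ?case using elim by (auto simp: integrable_iff_bounded less_top)
  qed
qed

text \<open>Equality holds only almost surely, because a Bochner integral splits into its two parts
  only where the jumps are integrable.\<close>

lemma compensated_jumps_eq:
  assumes "0 < \<epsilon>" "0 \<le> t"
  shows "AE \<omega> in M. compensated_jumps \<nu> \<mu> \<epsilon> t \<omega> = comp_jumps \<epsilon> t \<omega>"
  using jumps_finite[OF assms]
proof eventually_elim
  case (elim \<omega>)
  let ?B = "{0<..t} \<times> {x. \<epsilon> < \<bar>x\<bar>}"
  have "(\<integral>\<^sup>+q. ennreal (indicator ?B q * snd q) \<partial>\<mu> \<omega>) = (\<integral>\<^sup>+q. ennreal (snd q) * indicator ?B q \<partial>\<mu> \<omega>)"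
    "(\<integral>\<^sup>+q. ennreal (- (indicator ?B q * snd q)) \<partial>\<mu> \<omega>) = (\<integral>\<^sup>+q. ennreal (- snd q) * indicator ?B q \<partial>\<mu> \<omega>)"
    by (auto intro!: nn_integral_cong simp: indicator_def)
  then show ?case
    unfolding compensated_jumps_def comp_jumps_def big_def
    using elim by (subst real_lebesgue_integral_def) auto
qed

text \<open>The truncated jump size is a pointwise limit of simple functions. For almost every
  sample point the sums over its jumps converge by dominated convergence under the realised measure,
  and \<open>forms_bound_limit\<close> transfers the bounds.\<close>

lemma big_increments_forms_bound:
  fixes p :: "nat \<Rightarrow> real" and \<sigma>\<^sub>1 \<sigma>\<^sub>2 :: real
  assumes p0: "0 \<le> p 0" and p: "\<And>k. k < K \<Longrightarrow> p k < p (Suc k)" and e: "0 < \<epsilon>"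
  shows "forms_bound M K (\<lambda>k. p (Suc k) - p k) (\<sigma>\<^sub>1\<^sup>2 + \<sigma>\<^sub>2\<^sup>2 * (\<integral>x. (big \<epsilon> x)\<^sup>2 \<partial>\<nu>)) (\<sigma>\<^sub>2 ^ 4 * (\<integral>x. big \<epsilon> x ^ 4 \<partial>\<nu>))
    (\<lambda>k \<omega>. \<sigma>\<^sub>1 * (w (p (Suc k)) \<omega> - w (p k) \<omega>) + \<sigma>\<^sub>2 * (comp_jumps \<epsilon> (p (Suc k)) \<omega> - comp_jumps \<epsilon> (p k) \<omega>))"
proof -
  have pmono: "i \<le> j \<Longrightarrow> j \<le> K \<Longrightarrow> p i \<le> p j" for i j
  proof (induction j)
    case (Suc j) then show ?case using p[of j] by (cases "i = Suc j") auto
  qed simp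
  have pn: "0 \<le> p k" if "k \<le> K" for k using pmono[of 0 k] p0 that by auto
  \<comment> \<open>Choosing 0 as the centre of the approximation gives the factor 2 bound. It
    provides the dominating functions and forces \<open>g l\<close> to vanish on small jumps, as
    \<open>simple_increments_forms_bound\<close> demands.\<close>
  obtain g where g: "\<And>l. simple_function borel (g l)" "\<And>x. (\<lambda>l. g l x) \<longlonglongrightarrow> big \<epsilon> x"
    "\<And>l x. \<bar>g l x\<bar> \<le> 2 * \<bar>big \<epsilon> x\<bar>"
    using borel_measurable_implies_sequence_metric[OF big_measurable[of \<epsilon>], of 0] by auto
  have gm[measurable]: "g l \<in> borel_measurable borel" for l by (rule borel_measurable_simple_function[OF g(1)])
  have g0: "g l x = 0" if "\<not> \<epsilon> < \<bar>x\<bar>" for l x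
    using g(3)[of l x] that by (simp add: big_def)
  define Y where "Y = (\<lambda>l. g l ` UNIV - {0})"
  define A where "A = (\<lambda>l k y. {p k<..p (Suc k)} \<times> g l -` {y})"
  define D where "D = (\<lambda>l k \<omega>. \<sigma>\<^sub>1 * (w (p (Suc k)) \<omega> - w (p k) \<omega>)
      + \<sigma>\<^sub>2 * (\<Sum>y\<in>Y l. y * (enn2real (emeasure (\<mu> \<omega>) (A l k y)) - measure \<eta> (A l k y))))"
  have base1: "forms_bound M K (\<lambda>k. p (Suc k) - p k) (\<sigma>\<^sub>1\<^sup>2 + \<sigma>\<^sub>2\<^sup>2 * (\<integral>x. (g l x)\<^sup>2 \<partial>\<nu>)) (\<sigma>\<^sub>2 ^ 4 * (\<integral>x. g l x ^ 4 \<partial>\<nu>)) (D l)" for l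
    unfolding D_def Y_def A_def by (rule simple_increments_forms_bound(1)[OF p0 p g(1) e g0])
  have base2: "(\<Sum>y\<in>Y l. y * measure \<eta> (A l k y)) = (p (Suc k) - p k) * (\<integral>x. g l x \<partial>\<nu>)" if "k < K" for l k
    unfolding Y_def A_def by (rule simple_increments_forms_bound(2)[OF p0 p g(1) e g0 that])
  have A_sets: "A l k y \<in> sets borel" for l k y
    unfolding A_def borel_prod[symmetric] using measurable_sets[OF gm, of "{y}" l] by (intro pair_measureI) auto
  have finY: "finite (Y l)" for l using g(1)[of l] unfolding Y_def simple_function_def by auto
  let ?B = "{0<..p K} \<times> {x. \<epsilon> < \<bar>x\<bar>}"
  show ?thesis
  proof (rule forms_bound_limit[OF base1])
    have le2: "\<bar>g l x\<bar> ^ r \<le> (2 * \<bar>x\<bar>) ^ r" for l x r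
      using order_trans[OF g(3) mult_left_mono[OF abs_big_le']] by (intro power_mono) auto
    have "(\<lambda>l. \<integral>x. (g l x)\<^sup>2 \<partial>\<nu>) \<longlonglongrightarrow> (\<integral>x. (big \<epsilon> x)\<^sup>2 \<partial>\<nu>)"
      using le2[of _ _ 2] by (intro integral_dominated_convergence[where w="\<lambda>x. 4 * x\<^sup>2"])
        (auto simp: integrable_x2 power_mult_distrib intro!: AE_I2 tendsto_power g(2))
    then show "(\<lambda>l. \<sigma>\<^sub>1\<^sup>2 + \<sigma>\<^sub>2\<^sup>2 * (\<integral>x. (g l x)\<^sup>2 \<partial>\<nu>)) \<longlonglongrightarrow> \<sigma>\<^sub>1\<^sup>2 + \<sigma>\<^sub>2\<^sup>2 * (\<integral>x. (big \<epsilon> x)\<^sup>2 \<partial>\<nu>)"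
      by (intro tendsto_intros)
    have "(\<lambda>l. \<integral>x. g l x ^ 4 \<partial>\<nu>) \<longlonglongrightarrow> (\<integral>x. big \<epsilon> x ^ 4 \<partial>\<nu>)"
      using le2[of _ _ 4] by (intro integral_dominated_convergence[where w="\<lambda>x. 16 * x ^ 4"])
        (auto simp: integrable_x4 power_mult_distrib intro!: AE_I2 tendsto_power g(2))
    then show "(\<lambda>l. \<sigma>\<^sub>2 ^ 4 * (\<integral>x. g l x ^ 4 \<partial>\<nu>)) \<longlonglongrightarrow> \<sigma>\<^sub>2 ^ 4 * (\<integral>x. big \<epsilon> x ^ 4 \<partial>\<nu>)"
      by (intro tendsto_intros)
    show "D l k \<in> borel_measurable M" if "k < K" for l k
      unfolding D_def
      by (intro borel_measurable_add borel_measurable_times borel_measurable_const borel_measurable_diff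
          w_measurable borel_measurable_sum borel_measurable_enn2real[OF mu_measurable] A_sets pn) (use that in auto)
    have gI: "(\<lambda>l. \<integral>x. g l x \<partial>\<nu>) \<longlonglongrightarrow> (\<integral>x. big \<epsilon> x \<partial>\<nu>)"
      using g(3) by (intro integral_dominated_convergence[where w="\<lambda>x. 2 * \<bar>big \<epsilon> x\<bar>"])
        (auto simp: integrable_big[OF e] intro!: AE_I2 g(2))
    have tK: "AE \<omega> in M. \<forall>k\<in>{..K}. compensated_jumps \<nu> \<mu> \<epsilon> (p k) \<omega> = comp_jumps \<epsilon> (p k) \<omega>"
      using compensated_jumps_eq[OF e pn] by (intro AE_finite_allI) auto
    show "AE \<omega> in M. \<forall>k<K. (\<lambda>l. D l k \<omega>) \<longlonglongrightarrow>
       \<sigma>\<^sub>1 * (w (p (Suc k)) \<omega> - w (p k) \<omega>) + \<sigma>\<^sub>2 * (comp_jumps \<epsilon> (p (Suc k)) \<omega> - comp_jumps \<epsilon> (p k) \<omega>)"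
      using jumps_finite[OF e pn[of K, simplified]] tK AE_space
    proof eventually_elim
      case (elim \<omega>)
      have sm: "sets (\<mu> \<omega>) = sets borel" by (rule sets_mu[OF elim(3)])
      have int: "integrable (\<mu> \<omega>) (\<lambda>q. indicator ({s<..t} \<times> {x. \<epsilon> < \<bar>x\<bar>}) q * snd q)" if "0 \<le> s" "t \<le> p K" for s t
      proof -
        have "integrable (\<mu> \<omega>) (\<lambda>q. indicator ({s<..t} \<times> {x. \<epsilon> < \<bar>x\<bar>}) q * (indicator ?B q * snd q))"
          using integrable_mult_indicator[of "{s<..t} \<times> {x. \<epsilon> < \<bar>x\<bar>}" "\<mu> \<omega>" "\<lambda>q. indicator ?B q * snd q"] elim(1) tail_sets[of s t \<epsilon>] sm by simp
        moreover have "indicator ({s<..t} \<times> {x. \<epsilon> < \<bar>x\<bar>}) q * (indicator ?B q * snd q) = indicator ({s<..t} \<times> {x. \<epsilon> < \<bar>x\<bar>}) q * snd q" for q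
          using that by (auto simp: indicator_def)
        ultimately show ?thesis by simp
      qed
      show ?case
      proof (intro allI impI)
        fix k assume k: "k < K"
        have pk: "0 \<le> p k" "p k < p (Suc k)" "p (Suc k) \<le> p K" using pn[of k] p[OF k] pmono[of "Suc k" K] k by auto
        let ?C = "{p k<..p (Suc k)} \<times> {x. \<epsilon> < \<bar>x\<bar>}"
        have incr: "comp_jumps \<epsilon> (p (Suc k)) \<omega> - comp_jumps \<epsilon> (p k) \<omega>
            = (\<integral>q. indicator ?C q * snd q \<partial>\<mu> \<omega>) - (p (Suc k) - p k) * (\<integral>x. big \<epsilon> x \<partial>\<nu>)"
        proof -
          have "(\<integral>q. indicator ({0<..p (Suc k)} \<times> {x. \<epsilon> < \<bar>x\<bar>}) q * snd q \<partial>\<mu> \<omega>)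
             - (\<integral>q. indicator ({0<..p k} \<times> {x. \<epsilon> < \<bar>x\<bar>}) q * snd q \<partial>\<mu> \<omega>)
             = (\<integral>q. indicator ({0<..p (Suc k)} \<times> {x. \<epsilon> < \<bar>x\<bar>}) q * snd q - indicator ({0<..p k} \<times> {x. \<epsilon> < \<bar>x\<bar>}) q * snd q \<partial>\<mu> \<omega>)"
            by (rule Bochner_Integration.integral_diff[symmetric]; rule int) (use pk in auto)
          also have "\<dots> = (\<integral>q. indicator ?C q * snd q \<partial>\<mu> \<omega>)"
            by (intro Bochner_Integration.integral_cong refl) (use pk in \<open>auto simp: indicator_def\<close>)
          finally show ?thesis
            using elim(2) k unfolding compensated_jumps_def big_def
            by (auto simp: algebra_simps Ball_def dest!: spec[of _ "Suc k"] spec[of _ k])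
        qed
        \<comment> \<open>Along a path with finitely many large jumps the counts of the boxes are
          finite, so their weighted sum is an integral of \<open>g l\<close> against the realised
          jump measure.\<close>
        have Dl: "D l k \<omega> = \<sigma>\<^sub>1 * (w (p (Suc k)) \<omega> - w (p k) \<omega>)
            + \<sigma>\<^sub>2 * ((\<integral>q. indicator ?C q * g l (snd q) \<partial>\<mu> \<omega>) - (p (Suc k) - p k) * (\<integral>x. g l x \<partial>\<nu>))" for l
        proof -
          have fin: "emeasure (\<mu> \<omega>) (A l k y) < \<infinity>" if "y \<in> Y l" for y
          proof -
            have "A l k y \<subseteq> ?B" using that g0[of _ l] pk unfolding A_def Y_def by force
            then have "emeasure (\<mu> \<omega>) (A l k y) \<le> emeasure (\<mu> \<omega>) ?B"
              using tail_sets sm by (intro emeasure_mono) auto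
            then show ?thesis using elim(1) by (auto intro: order_le_less_trans)
          qed
          have "indicator ?C q * g l (snd q) = (\<Sum>y\<in>Y l. y * indicator (A l k y) q)" for q
          proof (cases "fst q \<in> {p k<..p (Suc k)} \<and> g l (snd q) \<noteq> 0")
            case True
            then have "(\<Sum>y\<in>Y l. y * indicator (A l k y) q) = (\<Sum>y\<in>{g l (snd q)}. y * indicator (A l k y) q)"
              using finY by (intro sum.mono_neutral_right) (auto simp: Y_def A_def indicator_def)
            moreover have "q \<in> ?C" using True g0[of "snd q" l] by (cases q) auto
            moreover have "q \<in> A l k (g l (snd q))" using True by (cases q) (auto simp: A_def)
            ultimately show ?thesis by simp
          next
            case False
            then have "(\<Sum>y\<in>Y l. y * indicator (A l k y) q) = 0"
              by (intro sum.neutral) (auto simp: Y_def A_def indicator_def)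
            moreover have "indicator ?C q * g l (snd q) = 0" using False by (cases q) (auto simp: indicator_def)
            ultimately show ?thesis by simp
          qed
          then have "(\<integral>q. indicator ?C q * g l (snd q) \<partial>\<mu> \<omega>) = (\<integral>q. (\<Sum>y\<in>Y l. y * indicator (A l k y) q) \<partial>\<mu> \<omega>)" by simp
          also have "\<dots> = (\<Sum>y\<in>Y l. y * measure (\<mu> \<omega>) (A l k y))"
            using fin A_sets sm by (subst Bochner_Integration.integral_sum) auto
          finally show ?thesis
            using base2[OF k, of l] unfolding D_def measure_def[of "\<mu> \<omega>"]
            by (simp add: right_diff_distrib sum_subtractf)
        qed
        have "(\<lambda>l. \<integral>q. indicator ?C q * g l (snd q) \<partial>\<mu> \<omega>) \<longlonglongrightarrow> (\<integral>q. indicator ?C q * snd q \<partial>\<mu> \<omega>)"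
        proof (rule integral_dominated_convergence[where w="\<lambda>q. 2 * \<bar>indicator ?C q * snd q\<bar>"])
          have mC: "indicator ?C \<in> borel_measurable (borel :: (real \<times> real) measure)"
            using tail_sets by (intro borel_measurable_indicator)
          have "(\<lambda>q. indicator ?C q * snd q) \<in> borel_measurable (borel :: (real \<times> real) measure)"
            by (intro borel_measurable_times mC) (simp add: borel_prod[symmetric])
          then show "(\<lambda>q. indicator ?C q * snd q) \<in> borel_measurable (\<mu> \<omega>)"
            by (subst measurable_cong_sets[OF sm refl])
          have "(\<lambda>q. indicator ?C q * g l (snd q)) \<in> borel_measurable (borel :: (real \<times> real) measure)" for l
            by (intro borel_measurable_times mC) (simp add: borel_prod[symmetric])
          then show "(\<lambda>q. indicator ?C q * g l (snd q)) \<in> borel_measurable (\<mu> \<omega>)" for l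
            by (subst measurable_cong_sets[OF sm refl])
          show "integrable (\<mu> \<omega>) (\<lambda>q. 2 * \<bar>indicator ?C q * snd q\<bar>)"
            using int[of "p k" "p (Suc k)"] pk by auto
          have "(\<lambda>l. indicator ?C q * g l (snd q)) \<longlonglongrightarrow> indicator ?C q * snd q" for q
          proof (cases "q \<in> ?C")
            case True
            then have "big \<epsilon> (snd q) = snd q" by (auto simp: big_def)
            then show ?thesis using g(2)[of "snd q"] True by simp
          qed simp
          then show "AE q in \<mu> \<omega>. (\<lambda>l. indicator ?C q * g l (snd q)) \<longlonglongrightarrow> indicator ?C q * snd q" by simp
          have "\<bar>g l (snd q)\<bar> \<le> 2 * \<bar>snd q\<bar>" for l q using le2[of l "snd q" 1] by simp
          then show "AE q in \<mu> \<omega>. norm (indicator ?C q * g l (snd q)) \<le> 2 * \<bar>indicator ?C q * snd q\<bar>" for l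
            by (intro AE_I2) (auto simp: indicator_def)
        qed
        then show "(\<lambda>l. D l k \<omega>) \<longlonglongrightarrow>
           \<sigma>\<^sub>1 * (w (p (Suc k)) \<omega> - w (p k) \<omega>) + \<sigma>\<^sub>2 * (comp_jumps \<epsilon> (p (Suc k)) \<omega> - comp_jumps \<epsilon> (p k) \<omega>)"
          unfolding Dl incr by (intro tendsto_intros gI)
      qed
    qed
  qed
qed

text \<open>The truncation level is sent to 0 along a sequence. The truncated second moments tend to
  1 by the normalisation of the Levy measure, so the limit variance per unit of time is
  \<open>\<sigma>\<^sub>1\<^sup>2 + \<sigma>\<^sub>2\<^sup>2\<close>.\<close>

theorem increments_forms_bound:
  fixes p :: "nat \<Rightarrow> real" and \<sigma>\<^sub>1 \<sigma>\<^sub>2 :: real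
  assumes p0: "0 \<le> p 0" and p: "\<And>k. k < K \<Longrightarrow> p k < p (Suc k)" and pT: "p K \<le> T"
    and z: "\<And>t. 0 \<le> t \<Longrightarrow> t \<le> T \<Longrightarrow> compensated_jump_integral M \<nu> \<mu> t (z t)"
  shows "forms_bound M K (\<lambda>k. p (Suc k) - p k) (\<sigma>\<^sub>1\<^sup>2 + \<sigma>\<^sub>2\<^sup>2) (\<sigma>\<^sub>2 ^ 4 * (\<integral>x. x ^ 4 \<partial>\<nu>))
    (\<lambda>k \<omega>. \<sigma>\<^sub>1 * (w (p (Suc k)) \<omega> - w (p k) \<omega>) + \<sigma>\<^sub>2 * (z (p (Suc k)) \<omega> - z (p k) \<omega>))"
proof -
  have pmono: "i \<le> j \<Longrightarrow> j \<le> K \<Longrightarrow> p i \<le> p j" for i j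
  proof (induction j)
    case (Suc j) then show ?case using p[of j] by (cases "i = Suc j") auto
  qed simp
  have pn: "0 \<le> p k" "p k \<le> T" if "k \<le> K" for k using pmono[of 0 k] pmono[of k K] p0 pT that by auto
  define e where "e = (\<lambda>l::nat. 1 / (real l + 1))"
  have e: "0 < e l" for l unfolding e_def by simp
  have "e \<longlonglongrightarrow> 0" unfolding e_def using LIMSEQ_inverse_real_of_nat by (simp add: inverse_eq_divide add.commute)
  then have elim: "filterlim e (at_right 0) sequentially"
    using e by (auto simp: filterlim_at e_def)
  \<comment> \<open>By definition \<open>z t\<close> is a limit in L2 only; one subsequence makes
    the convergence almost sure at all partition points.\<close>
  have "\<exists>r. strict_mono r \<and> (AE \<omega> in M. \<forall>k\<in>{..K}. (\<lambda>l. comp_jumps (e (r l)) (p k) \<omega>) \<longlonglongrightarrow> z (p k) \<omega>)"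
  proof (rule L2_AE_subseq)
    show "comp_jumps (e l) (p k) \<in> borel_measurable M" if "k \<in> {..K}" for l k
      using comp_jumps_measurable[OF e] pn that by auto
    show "z (p k) \<in> borel_measurable M" if "k \<in> {..K}" for k
      using z[of "p k"] pn that unfolding compensated_jump_integral_def by auto
    show "(\<lambda>l. \<integral>\<^sup>+\<omega>. ennreal ((comp_jumps (e l) (p k) \<omega> - z (p k) \<omega>)\<^sup>2) \<partial>M) \<longlonglongrightarrow> 0" if "k \<in> {..K}" for k
    proof -
      have "((\<lambda>\<epsilon>. \<integral>\<^sup>+\<omega>. ennreal ((compensated_jumps \<nu> \<mu> \<epsilon> (p k) \<omega> - z (p k) \<omega>)\<^sup>2) \<partial>M) \<longlongrightarrow> 0) (at_right 0)"
        using z[of "p k"] pn that unfolding compensated_jump_integral_def by auto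
      from filterlim_compose[OF this elim]
      have "(\<lambda>l. \<integral>\<^sup>+\<omega>. ennreal ((compensated_jumps \<nu> \<mu> (e l) (p k) \<omega> - z (p k) \<omega>)\<^sup>2) \<partial>M) \<longlonglongrightarrow> 0" .
      moreover have "(\<integral>\<^sup>+\<omega>. ennreal ((compensated_jumps \<nu> \<mu> (e l) (p k) \<omega> - z (p k) \<omega>)\<^sup>2) \<partial>M)
          = (\<integral>\<^sup>+\<omega>. ennreal ((comp_jumps (e l) (p k) \<omega> - z (p k) \<omega>)\<^sup>2) \<partial>M)" for l
        by (intro nn_integral_cong_AE)
          (use compensated_jumps_eq[OF e[of l] pn(1)[of k]] that in \<open>auto elim!: eventually_mono\<close>)
      ultimately show ?thesis by simp
    qed
  qed simp
  then obtain r where r: "strict_mono r"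
    "AE \<omega> in M. \<forall>k\<in>{..K}. (\<lambda>l. comp_jumps (e (r l)) (p k) \<omega>) \<longlonglongrightarrow> z (p k) \<omega>" by auto
  have er: "filterlim (\<lambda>l. e (r l)) (at_right 0) sequentially"
    using filterlim_compose[OF elim filterlim_subseq[OF r(1)]] .
  show ?thesis
  proof (rule forms_bound_limit[OF big_increments_forms_bound[OF p0 p e]])
    show "(\<lambda>l. \<sigma>\<^sub>1\<^sup>2 + \<sigma>\<^sub>2\<^sup>2 * (\<integral>x. (big (e (r l)) x)\<^sup>2 \<partial>\<nu>)) \<longlonglongrightarrow> \<sigma>\<^sub>1\<^sup>2 + \<sigma>\<^sub>2\<^sup>2"
      using tendsto_add[OF tendsto_const tendsto_mult[OF tendsto_const integral_big_tendsto(1)[OF er]], of "\<sigma>\<^sub>1\<^sup>2" "\<sigma>\<^sub>2\<^sup>2"] by simp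
    show "(\<lambda>l. \<sigma>\<^sub>2 ^ 4 * (\<integral>x. big (e (r l)) x ^ 4 \<partial>\<nu>)) \<longlonglongrightarrow> \<sigma>\<^sub>2 ^ 4 * (\<integral>x. x ^ 4 \<partial>\<nu>)"
      by (intro tendsto_intros integral_big_tendsto(2)[OF er])
    show "(\<lambda>\<omega>. \<sigma>\<^sub>1 * (w (p (Suc k)) \<omega> - w (p k) \<omega>) + \<sigma>\<^sub>2 * (comp_jumps (e (r l)) (p (Suc k)) \<omega> - comp_jumps (e (r l)) (p k) \<omega>)) \<in> borel_measurable M"
      if "k < K" for l k
      by (intro borel_measurable_add borel_measurable_times borel_measurable_const borel_measurable_diff w_measurable comp_jumps_measurable e pn)
        (use that in auto)
    show "AE \<omega> in M. \<forall>k<K. (\<lambda>l. \<sigma>\<^sub>1 * (w (p (Suc k)) \<omega> - w (p k) \<omega>) + \<sigma>\<^sub>2 * (comp_jumps (e (r l)) (p (Suc k)) \<omega> - comp_jumps (e (r l)) (p k) \<omega>))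
       \<longlonglongrightarrow> \<sigma>\<^sub>1 * (w (p (Suc k)) \<omega> - w (p k) \<omega>) + \<sigma>\<^sub>2 * (z (p (Suc k)) \<omega> - z (p k) \<omega>)"
      using r(2) by eventually_elim (auto intro!: tendsto_intros)
  qed
qed

end

section \<open>Integrals of step functions\<close>

text \<open>Forms in several step integrals become forms in the increments over one partition. It
  has to be strictly increasing, since Gaussian densities and nonempty boxes are available only for
  cells of positive length.\<close>

lemma common_refinement:
  fixes \<tau> :: "'j \<Rightarrow> nat \<Rightarrow> real"
  assumes J: "finite J" and v: "\<And>j. j \<in> J \<Longrightarrow> mono_on {..m j} (\<tau> j) \<and> \<tau> j ` {..m j} \<subseteq> {0..T}" and T: "0 \<le> T"
  shows "\<exists>K p. 0 \<le> p 0 \<and> (\<forall>k<K. p k < p (Suc k)) \<and> p K \<le> T \<and>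
    (\<forall>j\<in>J. \<exists>b. (\<forall>t. step_function (m j) (\<tau> j) (a j) t = step_function K p b t) \<and>
       (\<forall>x. step_integral (m j) (\<tau> j) (a j) x = step_integral K p b x))"
proof -
  \<comment> \<open>The point 0 is inserted so that the set is nonempty even if \<open>J\<close> is
    empty.\<close>
  define D where "D = insert 0 (\<Union>j\<in>J. \<tau> j ` {..m j})"
  have D: "finite D" "D \<noteq> {}" "D \<subseteq> {0..T}" unfolding D_def using J v T by auto
  define l where "l = sorted_list_of_set D"
  have l: "set l = D" "sorted_wrt (<) l" "l \<noteq> []" unfolding l_def using D by auto
  define K where "K = length l - 1"
  define p where "p = (\<lambda>k. l ! k)"
  have len: "length l = Suc K" unfolding K_def using l(3) by (cases l) auto
  have pless: "p i < p j" if "i < j" "j \<le> K" for i j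
    unfolding p_def using sorted_wrt_nth_less[OF l(2)] that len by auto
  have pD: "p k \<in> D" if "k \<le> K" for k unfolding p_def using l(1) len that by (metis le_imp_less_Suc nth_mem)
  have pidx: "\<exists>k\<le>K. p k = x" if "x \<in> D" for x
    using that l(1) len unfolding p_def by (metis in_set_conv_nth less_Suc_eq_le)
  have ple: "i \<le> j" if "p i \<le> p j" "i \<le> K" for i j
    using pless[of j i] that by (meson leD not_le_imp_less)
  have "\<exists>b. (\<forall>t. step_function (m j) (\<tau> j) (a j) t = step_function K p b t) \<and>
       (\<forall>x. step_integral (m j) (\<tau> j) (a j) x = step_integral K p b x)" if j: "j \<in> J" for j
  proof -
    \<comment> \<open>\<open>\<kappa> i\<close> will be the position of the i-th old partition point
      in the sorted list of all points.\<close>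
    have "\<forall>i\<in>{..m j}. \<exists>k. k \<le> K \<and> p k = \<tau> j i"
      using pidx j unfolding D_def by auto
    from bchoice[OF this] obtain \<kappa> where "\<forall>i\<in>{..m j}. \<kappa> i \<le> K \<and> p (\<kappa> i) = \<tau> j i" ..
    then have k: "\<kappa> i \<le> K \<and> p (\<kappa> i) = \<tau> j i" if "i \<le> m j" for i using that by auto
    have kmono: "\<kappa> i \<le> \<kappa> (Suc i)" if "i < m j" for i
    proof -
      have "\<tau> j i \<le> \<tau> j (Suc i)" using v[OF j] that by (auto simp: monotone_on_def)
      then have "p (\<kappa> i) \<le> p (\<kappa> (Suc i))" using k[of i] k[of "Suc i"] that by simp
      then show ?thesis by (rule ple) (use k[of i] that in simp)
    qed
    \<comment> \<open>A new cell inherits the coefficient of the old cell containing it. Repeated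
      old points give an empty range of new cells and contribute nothing, as they should.\<close>
    define b where "b = (\<lambda>k. \<Sum>i<m j. if k \<in> {\<kappa> i..<\<kappa> (Suc i)} then a j i else 0)"
    have swap: "(\<Sum>k<K. b k * g k) = (\<Sum>i<m j. a j i * (\<Sum>k\<in>{\<kappa> i..<\<kappa> (Suc i)}. g k))" for g :: "nat \<Rightarrow> real"
    proof -
      have "(\<Sum>k<K. b k * g k) = (\<Sum>k<K. \<Sum>i<m j. (if k \<in> {\<kappa> i..<\<kappa> (Suc i)} then a j i * g k else 0))"
        unfolding b_def sum_distrib_right by (intro sum.cong refl) auto
      also have "\<dots> = (\<Sum>i<m j. \<Sum>k<K. (if k \<in> {\<kappa> i..<\<kappa> (Suc i)} then a j i * g k else 0))"
        by (rule sum.swap)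
      also have "\<dots> = (\<Sum>i<m j. a j i * (\<Sum>k\<in>{\<kappa> i..<\<kappa> (Suc i)}. g k))"
      proof (intro sum.cong refl)
        fix i assume "i \<in> {..<m j}"
        then have "{..<K} \<inter> {\<kappa> i..<\<kappa> (Suc i)} = {\<kappa> i..<\<kappa> (Suc i)}" using k[of "Suc i"] by auto
        then show "(\<Sum>k<K. (if k \<in> {\<kappa> i..<\<kappa> (Suc i)} then a j i * g k else 0)) = a j i * (\<Sum>k\<in>{\<kappa> i..<\<kappa> (Suc i)}. g k)"
          unfolding sum_distrib_left by (subst sum.inter_restrict[symmetric]) simp_all
      qed
      finally show ?thesis .
    qed
    have ind: "indicator {p c<..p (c + e)} t = (\<Sum>k\<in>{c..<c + e}. indicator {p k<..p (Suc k)} t :: real)" if "c + e \<le> K" for c e t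
      using that
    proof (induction e)
      case (Suc e)
      have "p c \<le> p (c + e)" using pless[of c "c + e"] Suc by (cases "e = 0") auto
      then have "indicator {p c<..p (c + Suc e)} t = (indicator {p c<..p (c + e)} t + indicator {p (c + e)<..p (Suc (c + e))} t :: real)"
        using pless[of "c + e" "Suc (c + e)"] Suc.prems by (auto simp: indicator_def)
      moreover have "indicator {p c<..p (c + e)} t = (\<Sum>k\<in>{c..<c + e}. indicator {p k<..p (Suc k)} t :: real)"
        by (rule Suc.IH) (use Suc.prems in simp)
      ultimately show ?case
        by (simp only: add_Suc_right sum.atLeastLessThan_Suc[OF le_add1])
    qed simp
    have "step_function (m j) (\<tau> j) (a j) t = step_function K p b t" for t
      unfolding step_function_def swap
    proof (intro sum.cong refl)
      fix i assume "i \<in> {..<m j}"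
      then show "a j i * indicator {\<tau> j i<..\<tau> j (Suc i)} t = a j i * (\<Sum>k\<in>{\<kappa> i..<\<kappa> (Suc i)}. indicator {p k<..p (Suc k)} t)"
        using k[of i] k[of "Suc i"] kmono[of i] ind[of "\<kappa> i" "\<kappa> (Suc i) - \<kappa> i" t] by simp
    qed
    moreover have "step_integral (m j) (\<tau> j) (a j) x = step_integral K p b x" for x
      unfolding step_integral_def swap
    proof (intro sum.cong refl)
      fix i assume "i \<in> {..<m j}"
      then show "a j i * (x (\<tau> j (Suc i)) - x (\<tau> j i)) = a j i * (\<Sum>k\<in>{\<kappa> i..<\<kappa> (Suc i)}. x (p (Suc k)) - x (p k))"
        using k[of i] k[of "Suc i"] sum_Suc_diff'[OF kmono[of i], of "\<lambda>k. x (p k)"] by simp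
    qed
    ultimately show ?thesis by blast
  qed
  moreover have "0 \<le> p 0" "p K \<le> T" using pD[of 0] pD[of K] D(3) by auto
  moreover have "\<forall>k<K. p k < p (Suc k)" using pless by auto
  ultimately show ?thesis by blast
qed

text \<open>Half-open cells are disjoint, so only the diagonal of the double sum survives. Products
  and squares of step functions on one partition are thus again such step functions.\<close>

lemma step_function_mult:
  assumes "mono_on {..K} p"
  shows "step_function K p b t * step_function K p b' t = step_function K p (\<lambda>k. b k * b' k) t"
proof -
  have dis: "indicator {p k<..p (Suc k)} t * indicator {p k'<..p (Suc k')} t = (if k = k' then indicator {p k<..p (Suc k)} t else 0 :: real)"
    if "k < K" "k' < K" for k k'
  proof -
    have "k < k' \<Longrightarrow> p (Suc k) \<le> p k'" "k' < k \<Longrightarrow> p (Suc k') \<le> p k"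
      using assms that unfolding monotone_on_def by auto
    then show ?thesis by (cases k k' rule: linorder_cases) (auto simp: indicator_def)
  qed
  have "step_function K p b t * step_function K p b' t
      = (\<Sum>k<K. \<Sum>k'<K. b k * b' k' * (indicator {p k<..p (Suc k)} t * indicator {p k'<..p (Suc k')} t))"
    unfolding step_function_def sum_product by (simp add: mult_ac)
  also have "\<dots> = (\<Sum>k<K. \<Sum>k'<K. if k = k' then b k * b' k * indicator {p k<..p (Suc k)} t else 0)"
    by (intro sum.cong refl) (auto simp: dis)
  also have "\<dots> = step_function K p (\<lambda>k. b k * b' k) t"
    unfolding step_function_def by (intro sum.cong refl) simp
  finally show ?thesis .
qed

lemma step_function_sum:
  "(\<Sum>j\<in>J. x j * step_function K p (b j) t) = step_function K p (\<lambda>k. \<Sum>j\<in>J. x j * b j k) t"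
  unfolding step_function_def sum_distrib_left sum_distrib_right
  by (subst sum.swap) (simp add: mult_ac)

lemma integral_step_function:
  assumes "0 \<le> p 0" "mono_on {..K} p" "p K \<le> T"
  shows "(\<integral>t. step_function K p b t \<partial>lebesgue_on {0..T}) = (\<Sum>k<K. b k * (p (Suc k) - p k))"
    and "integrable (lebesgue_on {0..T}) (step_function K p b)"
proof -
  have pk: "0 \<le> p k" "p k \<le> p (Suc k)" "p (Suc k) \<le> T" if "k < K" for k
    using assms(2) that assms(1,3) unfolding monotone_on_def
    by (metis atMost_iff le0 less_imp_le_nat order_trans, simp, metis Suc_leI atMost_iff order_refl order_trans)
  have m: "measure (lebesgue_on {0..T}) {p k<..p (Suc k)} = p (Suc k) - p k"
    "emeasure (lebesgue_on {0..T}) {p k<..p (Suc k)} < \<infinity>" "{p k<..p (Suc k)} \<in> sets (lebesgue_on {0..T})" "{p k<..p (Suc k)} \<inter> {0..T} = {p k<..p (Suc k)}" if "k < K" for k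
  proof -
    have s: "{p k<..p (Suc k)} \<subseteq> {0..T}" using pk[OF that] by auto
    then show "measure (lebesgue_on {0..T}) {p k<..p (Suc k)} = p (Suc k) - p k"
      using pk[OF that] by (subst measure_restrict_space) auto
    show "emeasure (lebesgue_on {0..T}) {p k<..p (Suc k)} < \<infinity>"
      using s pk[OF that] by (subst emeasure_restrict_space) auto
    show "{p k<..p (Suc k)} \<in> sets (lebesgue_on {0..T})"
      using s by (auto simp: sets_restrict_space_iff)
    show "{p k<..p (Suc k)} \<inter> {0..T} = {p k<..p (Suc k)}" using s by auto
  qed
  show "integrable (lebesgue_on {0..T}) (step_function K p b)"
    unfolding step_function_def using m
    by (intro Bochner_Integration.integrable_sum integrable_mult_right integrable_real_indicator) auto
  show "(\<integral>t. step_function K p b t \<partial>lebesgue_on {0..T}) = (\<Sum>k<K. b k * (p (Suc k) - p k))"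
    unfolding step_function_def using m
    by (subst Bochner_Integration.integral_sum) (auto intro!: sum.cong)
qed

lemma Cauchy_Schwarz_integral:
  fixes f g :: "'a \<Rightarrow> real"
  assumes [measurable]: "f \<in> borel_measurable M" "g \<in> borel_measurable M"
    and f: "integrable M (\<lambda>x. (f x)\<^sup>2)" and g: "integrable M (\<lambda>x. (g x)\<^sup>2)"
  shows "integrable M (\<lambda>x. f x * g x)" and "(\<integral>x. f x * g x \<partial>M)\<^sup>2 \<le> (\<integral>x. (f x)\<^sup>2 \<partial>M) * (\<integral>x. (g x)\<^sup>2 \<partial>M)"
proof -
  show fg: "integrable M (\<lambda>x. f x * g x)"
  proof (rule Bochner_Integration.integrable_bound)
    show "integrable M (\<lambda>x. (f x)\<^sup>2 + (g x)\<^sup>2)" using f g by simp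
    have "\<bar>x * y\<bar> \<le> x\<^sup>2 + y\<^sup>2" for x y :: real
    proof -
      have "2 * \<bar>x * y\<bar> \<le> x\<^sup>2 + y\<^sup>2"
        using sum_squares_bound[of "\<bar>x\<bar>" "\<bar>y\<bar>"] by (simp add: abs_mult mult.assoc)
      then show ?thesis using abs_ge_zero[of "x * y"] by linarith
    qed
    then show "AE x in M. norm (f x * g x) \<le> norm ((f x)\<^sup>2 + (g x)\<^sup>2)" by auto
  qed measurable
  define F G H where "F = (\<integral>x. (f x)\<^sup>2 \<partial>M)" and "G = (\<integral>x. f x * g x \<partial>M)" and "H = (\<integral>x. (g x)\<^sup>2 \<partial>M)"
  have quad: "0 \<le> F - 2 * t * G + t\<^sup>2 * H" for t
  proof -
    have "0 \<le> (\<integral>x. (f x - t * g x)\<^sup>2 \<partial>M)" by simp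
    also have "(\<lambda>x. (f x - t * g x)\<^sup>2) = (\<lambda>x. (f x)\<^sup>2 - 2 * t * (f x * g x) + t\<^sup>2 * (g x)\<^sup>2)"
      by (auto simp: power2_diff power_mult_distrib mult_ac)
    also have "(\<integral>x. (f x)\<^sup>2 - 2 * t * (f x * g x) + t\<^sup>2 * (g x)\<^sup>2 \<partial>M) = F - 2 * t * G + t\<^sup>2 * H"
      unfolding F_def G_def H_def using f g fg by simp
    finally show ?thesis .
  qed
  have H0: "0 \<le> H" unfolding H_def by simp
  show "(\<integral>x. f x * g x \<partial>M)\<^sup>2 \<le> (\<integral>x. (f x)\<^sup>2 \<partial>M) * (\<integral>x. (g x)\<^sup>2 \<partial>M)"
    unfolding F_def[symmetric] G_def[symmetric] H_def[symmetric]
  proof (cases "H = 0")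
    case True
    have "G = 0"
    proof (rule ccontr)
      assume "G \<noteq> 0"
      \<comment> \<open>With \<open>H = 0\<close> this choice of t makes the quadratic equal to -1.
        In the other case t = G / H is its minimiser.\<close>
      then show False using quad[of "(F + 1) / (2 * G)"] True by simp
    qed
    then show "G\<^sup>2 \<le> F * H" using True by simp
  next
    case False
    then have "0 < H" using H0 by simp
    moreover have "F - 2 * (G / H) * G + (G / H)\<^sup>2 * H = (F * H - G\<^sup>2) / H"
      using False by (simp add: field_simps power2_eq_square)
    ultimately show "G\<^sup>2 \<le> F * H" using quad[of "G / H"] by (simp add: zero_le_divide_iff)
  qed
qed

text \<open>The interface between the noise model and the stochastic integrals: a square integrable
  drift and the second order bounds for the centred increments are all that is used of the law. Per
  unit of time, \<open>s\<close> plays the part of the variance and \<open>q\<close> that of the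
  fourth cumulant.\<close>

locale observed = prob_space P for P :: "(real \<Rightarrow> real) measure" +
  fixes T s q :: real and S :: "real \<Rightarrow> real"
  assumes T: "0 < T" and s: "0 \<le> s" and q: "0 \<le> q"
    and S_measurable: "S \<in> borel_measurable (lebesgue_on {0..T})"
    and S_integrable: "integrable (lebesgue_on {0..T}) (\<lambda>t. (S t)\<^sup>2)"
    and coordinate: "\<And>t. 0 \<le> t \<Longrightarrow> t \<le> T \<Longrightarrow> (\<lambda>y. y t) \<in> borel_measurable P"
    and increments: "\<And>K p. 0 \<le> p 0 \<Longrightarrow> (\<And>k. k < K \<Longrightarrow> p k < p (Suc k)) \<Longrightarrow> p K \<le> T \<Longrightarrow>
      forms_bound P K (\<lambda>k. p (Suc k) - p k) s q
        (\<lambda>k y. y (p (Suc k)) - y (p k) - (\<integral>t. indicator {p k<..p (Suc k)} t * S t \<partial>lebesgue_on {0..T}))"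
begin

abbreviation "L \<equiv> lebesgue_on {0..T}"

definition valid :: "nat \<Rightarrow> (nat \<Rightarrow> real) \<Rightarrow> bool" where
  "valid m \<tau> \<longleftrightarrow> mono_on {..m} \<tau> \<and> \<tau> ` {..m} \<subseteq> {0..T}"

definition centred :: "nat \<Rightarrow> (nat \<Rightarrow> real) \<Rightarrow> (nat \<Rightarrow> real) \<Rightarrow> (real \<Rightarrow> real) \<Rightarrow> real" where
  "centred m \<tau> a y = step_integral m \<tau> a y - (\<integral>t. step_function m \<tau> a t * S t \<partial>L)"

lemma step_integral_measurable: "valid m \<tau> \<Longrightarrow> step_integral m \<tau> a \<in> borel_measurable P"
  unfolding step_integral_def valid_def
  by (intro borel_measurable_sum borel_measurable_times borel_measurable_const borel_measurable_diff coordinate)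
    (auto simp: image_subset_iff)

lemma step_function_measurable: "step_function m \<tau> a \<in> borel_measurable L"
  unfolding step_function_def
  by (intro borel_measurable_sum borel_measurable_times borel_measurable_const measurable_restrict_space1
      borel_measurable_indicator) auto

lemma abs_step_function_le: "\<bar>step_function m \<tau> a t\<bar> \<le> (\<Sum>i<m. \<bar>a i\<bar>)"
  unfolding step_function_def
  by (rule order_trans[OF sum_abs sum_mono]) (auto simp: abs_mult indicator_def)

lemma finite_L: "finite_measure L"
  using T by (intro finite_measureI) (simp add: emeasure_restrict_space)

lemma bounded_integrable:
  fixes f :: "real \<Rightarrow> real"
  shows "f \<in> borel_measurable L \<Longrightarrow> (\<And>t. t \<in> {0..T} \<Longrightarrow> \<bar>f t\<bar> \<le> B) \<Longrightarrow> integrable L f"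
  by (rule finite_measure.integrable_const_bound[OF finite_L, of _ B]) (auto intro!: AE_I2)

lemma step_square_integrable: "integrable L (\<lambda>t. (step_function m \<tau> a t)\<^sup>2)"
proof (rule bounded_integrable)
  show "(\<lambda>t. (step_function m \<tau> a t)\<^sup>2) \<in> borel_measurable L"
    using step_function_measurable by measurable
  show "\<bar>(step_function m \<tau> a t)\<^sup>2\<bar> \<le> (\<Sum>i<m. \<bar>a i\<bar>)\<^sup>2" for t
    using power_mono[OF abs_step_function_le[of m \<tau> a t], of 2] by simp
qed

lemmas step_S_integrable = Cauchy_Schwarz_integral(1)[OF step_function_measurable S_measurable step_square_integrable S_integrable]

text \<open>On a common refinement, centred step integrals are linear forms in centred increments,
  and the sums weighted by cell lengths in \<open>forms_bound\<close> are integrals of products of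
  the step functions.\<close>

lemma steps_forms_bound:
  fixes J :: "nat set" and m :: "nat \<Rightarrow> nat" and \<tau> a :: "nat \<Rightarrow> nat \<Rightarrow> real" and x :: "nat \<Rightarrow> real"
  assumes J: "finite J" and v: "\<And>j. j \<in> J \<Longrightarrow> valid (m j) (\<tau> j)"
  defines "f \<equiv> \<lambda>j t. step_function (m j) (\<tau> j) (a j) t" and "F \<equiv> \<lambda>j. centred (m j) (\<tau> j) (a j)"
  shows "(\<integral>\<^sup>+y. ennreal ((\<Sum>j\<in>J. x j * F j y)\<^sup>2) \<partial>P) \<le> ennreal (s * (\<integral>t. (\<Sum>j\<in>J. x j * f j t)\<^sup>2 \<partial>L))" (is ?lin)
    and "(\<integral>\<^sup>+y. ennreal ((\<Sum>j\<in>J. x j * ((F j y)\<^sup>2 - s * (\<integral>t. (f j t)\<^sup>2 \<partial>L)))\<^sup>2) \<partial>P)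
       \<le> ennreal (2 * s\<^sup>2 * (\<Sum>j\<in>J. \<Sum>i\<in>J. x j * x i * (\<integral>t. f j t * f i t \<partial>L)\<^sup>2)
           + q * (\<integral>t. (\<Sum>j\<in>J. x j * (f j t)\<^sup>2)\<^sup>2 \<partial>L))" (is ?quad)
proof -
  have v': "mono_on {..m j} (\<tau> j) \<and> \<tau> j ` {..m j} \<subseteq> {0..T}" if "j \<in> J" for j
    using v[OF that] unfolding valid_def .
  have "\<exists>K p. 0 \<le> p 0 \<and> (\<forall>k<K. p k < p (Suc k)) \<and> p K \<le> T \<and>
    (\<forall>j\<in>J. \<exists>b. (\<forall>t. step_function (m j) (\<tau> j) (a j) t = step_function K p b t) \<and>
       (\<forall>y. step_integral (m j) (\<tau> j) (a j) y = step_integral K p b y))"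
    by (rule common_refinement) (use J v' T in auto)
  then obtain K p where p': "0 \<le> p 0" "\<forall>k<K. p k < p (Suc k)" "p K \<le> T"
    and r: "\<forall>j\<in>J. \<exists>b. (\<forall>t. step_function (m j) (\<tau> j) (a j) t = step_function K p b t) \<and>
       (\<forall>y. step_integral (m j) (\<tau> j) (a j) y = step_integral K p b y)"
    by (elim exE conjE) (rule that)
  have p: "0 \<le> p 0" "\<And>k. k < K \<Longrightarrow> p k < p (Suc k)" "p K \<le> T" using p' by auto
  from bchoice[OF r] obtain b where b': "\<forall>j\<in>J. (\<forall>t. step_function (m j) (\<tau> j) (a j) t = step_function K p (b j) t) \<and>
       (\<forall>y. step_integral (m j) (\<tau> j) (a j) y = step_integral K p (b j) y)" ..
  have b: "f j t = step_function K p (b j) t"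
    "step_integral (m j) (\<tau> j) (a j) y = step_integral K p (b j) y" if "j \<in> J" for j t y
    using bspec[OF b' that] unfolding f_def by auto
  have mono: "mono_on {..K} p"
  proof -
    have "i \<le> j \<Longrightarrow> j \<le> K \<Longrightarrow> p i \<le> p j" for i j
    proof (induction j)
      case (Suc j) then show ?case using p(2)[of j] by (cases "i = Suc j") auto
    qed simp
    then show ?thesis by (auto simp: monotone_on_def)
  qed
  define h where "h = (\<lambda>k. p (Suc k) - p k)"
  define D where "D = (\<lambda>k y. y (p (Suc k)) - y (p k) - (\<integral>t. indicator {p k<..p (Suc k)} t * S t \<partial>L))"
  have isf: "(\<integral>t. step_function K p c t \<partial>L) = (\<Sum>k<K. c k * h k)" for c
    unfolding h_def by (rule integral_step_function(1)[OF p(1) mono p(3)])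
  have fb: "forms_bound P K h s q D"
    unfolding h_def D_def by (rule increments[OF p])
  have indS: "integrable L (\<lambda>t. indicator {p k<..p (Suc k)} t * S t)" for k
  proof -
    have "(\<lambda>t. indicator {p k<..p (Suc k)} t * S t) = (\<lambda>t. step_function 1 (\<lambda>i. if i = 0 then p k else p (Suc k)) (\<lambda>_. 1) t * S t)"
      by (simp add: step_function_def)
    then show ?thesis using step_S_integrable by simp
  qed
  have FD: "F j y = (\<Sum>k<K. b j k * D k y)" if "j \<in> J" for j y
  proof -
    have "(\<integral>t. step_function K p (b j) t * S t \<partial>L) = (\<integral>t. (\<Sum>k<K. b j k * (indicator {p k<..p (Suc k)} t * S t)) \<partial>L)"
      unfolding step_function_def sum_distrib_right by (simp add: mult.assoc)
    also have "\<dots> = (\<Sum>k<K. b j k * (\<integral>t. indicator {p k<..p (Suc k)} t * S t \<partial>L))"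
      using indS by (subst Bochner_Integration.integral_sum) auto
    finally show ?thesis
      unfolding F_def centred_def b(2)[OF that] b(1)[OF that, unfolded f_def] D_def
      by (simp add: step_integral_def right_diff_distrib sum_subtractf)
  qed
  have prod: "(\<integral>t. f j t * f i t \<partial>L) = (\<Sum>k<K. b j k * b i k * h k)" if "j \<in> J" "i \<in> J" for i j
    using that by (simp add: b(1) step_function_mult[OF mono] isf)
  show ?lin
  proof -
    have "(\<Sum>j\<in>J. x j * F j y) = (\<Sum>k<K. (\<Sum>j\<in>J. x j * b j k) * D k y)" for y
    proof -
      have "(\<Sum>j\<in>J. x j * F j y) = (\<Sum>j\<in>J. \<Sum>k<K. x j * b j k * D k y)"
        by (intro sum.cong refl) (simp add: FD sum_distrib_left mult.assoc)
      also have "\<dots> = (\<Sum>k<K. (\<Sum>j\<in>J. x j * b j k) * D k y)"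
        unfolding sum_distrib_right by (rule sum.swap)
      finally show ?thesis .
    qed
    moreover have "(\<Sum>j\<in>J. x j * f j t)\<^sup>2 = step_function K p (\<lambda>k. (\<Sum>j\<in>J. x j * b j k)\<^sup>2) t" for t
    proof -
      have "(\<Sum>j\<in>J. x j * f j t) = step_function K p (\<lambda>k. \<Sum>j\<in>J. x j * b j k) t"
        unfolding step_function_sum[symmetric] by (intro sum.cong refl) (simp add: b(1))
      then show ?thesis by (simp add: power2_eq_square step_function_mult[OF mono])
    qed
    ultimately show ?thesis
      using fb unfolding forms_bound_def by (simp add: isf)
  qed
  show ?quad
  proof -
    have e1: "(\<Sum>j\<in>J. x j * ((F j y)\<^sup>2 - s * (\<integral>t. (f j t)\<^sup>2 \<partial>L)))
       = (\<Sum>j\<in>J. x j * ((\<Sum>k<K. b j k * D k y)\<^sup>2 - s * (\<Sum>k<K. (b j k)\<^sup>2 * h k)))" for y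
      using prod by (intro sum.cong refl) (simp add: FD power2_eq_square)
    have e2: "(\<Sum>j\<in>J. \<Sum>i\<in>J. x j * x i * (\<integral>t. f j t * f i t \<partial>L)\<^sup>2)
       = (\<Sum>j\<in>J. \<Sum>i\<in>J. x j * x i * (\<Sum>k<K. b j k * b i k * h k)\<^sup>2)"
      by (intro sum.cong refl) (simp add: prod)
    have "(\<Sum>j\<in>J. x j * (f j t)\<^sup>2)\<^sup>2 = step_function K p (\<lambda>k. (\<Sum>j\<in>J. x j * (b j k)\<^sup>2)\<^sup>2) t" for t
    proof -
      have "(\<Sum>j\<in>J. x j * (f j t)\<^sup>2) = step_function K p (\<lambda>k. \<Sum>j\<in>J. x j * (b j k)\<^sup>2) t"
        unfolding step_function_sum[symmetric]
        by (intro sum.cong refl) (simp add: b(1) power2_eq_square step_function_mult[OF mono])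
      then show ?thesis by (simp add: power2_eq_square step_function_mult[OF mono])
    qed
    then have e3: "(\<integral>t. (\<Sum>j\<in>J. x j * (f j t)\<^sup>2)\<^sup>2 \<partial>L) = (\<Sum>k<K. (\<Sum>j\<in>J. x j * (b j k)\<^sup>2)\<^sup>2 * h k)"
      by (simp add: isf)
    show ?thesis
      unfolding e1 e2 e3 using fb J unfolding forms_bound_def by blast
  qed
qed

text \<open>This takes the place of the Ito isometry: integrands close in L2[0,T] have integrals
  close in L2(P). The centred part costs \<open>s\<close> and the drift, by Cauchy-Schwarz, the
  squared norm of \<open>S\<close>; the factors 2 come from (u + v)^2 <= 2 u^2 + 2 v^2.\<close>

lemma step_integral_diff_bound:
  assumes "valid m \<tau>" "valid m' \<tau>'"
  shows "(\<integral>\<^sup>+y. ennreal ((step_integral m \<tau> a y - step_integral m' \<tau>' a' y)\<^sup>2) \<partial>P)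
    \<le> ennreal ((2 * s + 2 * (\<integral>t. (S t)\<^sup>2 \<partial>L)) * (\<integral>t. (step_function m \<tau> a t - step_function m' \<tau>' a' t)\<^sup>2 \<partial>L))"
proof -
  define f where "f = (\<lambda>t. step_function m \<tau> a t - step_function m' \<tau>' a' t)"
  define I where "I = (\<integral>t. (f t)\<^sup>2 \<partial>L)"
  have I0: "0 \<le> I" unfolding I_def by simp
  have two: "ennreal (2 * x) = 2 * ennreal x" for x
    using ennreal_mult'[of 2 x] by simp
  define d where "d = (\<integral>t. f t * S t \<partial>L)"
  define G where "G = (\<lambda>y. centred m \<tau> a y - centred m' \<tau>' a' y)"
  have fm: "f \<in> borel_measurable L" unfolding f_def using step_function_measurable by measurable
  have f2: "integrable L (\<lambda>t. (f t)\<^sup>2)"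
  proof (rule bounded_integrable)
    show "(\<lambda>t. (f t)\<^sup>2) \<in> borel_measurable L" using fm by measurable
    have "\<bar>f t\<bar> \<le> (\<Sum>i<m. \<bar>a i\<bar>) + (\<Sum>i<m'. \<bar>a' i\<bar>)" for t
      unfolding f_def using abs_step_function_le[of m \<tau> a t] abs_step_function_le[of m' \<tau>' a' t] by linarith
    then have "\<bar>f t\<bar>\<^sup>2 \<le> ((\<Sum>i<m. \<bar>a i\<bar>) + (\<Sum>i<m'. \<bar>a' i\<bar>))\<^sup>2" for t by (rule power_mono) simp
    then show "\<bar>(f t)\<^sup>2\<bar> \<le> ((\<Sum>i<m. \<bar>a i\<bar>) + (\<Sum>i<m'. \<bar>a' i\<bar>))\<^sup>2" for t by simp
  qed
  have d2: "d\<^sup>2 \<le> I * (\<integral>t. (S t)\<^sup>2 \<partial>L)"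
    unfolding d_def I_def by (rule Cauchy_Schwarz_integral(2)[OF fm S_measurable f2 S_integrable])
  have Gm: "G \<in> borel_measurable P"
    unfolding G_def centred_def using step_integral_measurable assms by measurable
  \<comment> \<open>The difference is the linear form with coefficients 1 and -1 in a family of two
    step integrals.\<close>
  have "(\<integral>\<^sup>+y. ennreal ((\<Sum>j\<in>{0::nat, 1}. (if j = 0 then 1 else - 1) * (if j = 0 then centred m \<tau> a y else centred m' \<tau>' a' y))\<^sup>2) \<partial>P)
     \<le> ennreal (s * (\<integral>t. (\<Sum>j\<in>{0::nat, 1}. (if j = 0 then 1 else - 1) * (if j = 0 then step_function m \<tau> a t else step_function m' \<tau>' a' t))\<^sup>2 \<partial>L))"
    using steps_forms_bound(1)[where J="{0, 1}" and m="\<lambda>j. if j = 0 then m else m'" and \<tau>="\<lambda>j. if j = 0 then \<tau> else \<tau>'" and x="\<lambda>j. if j = 0 then 1 else - 1" and a="\<lambda>j. if j = 0 then a else a'"]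
      assms by (simp split: if_splits)
  then have G2: "(\<integral>\<^sup>+y. ennreal ((G y)\<^sup>2) \<partial>P) \<le> ennreal (s * I)"
    unfolding G_def I_def f_def by simp
  have "step_integral m \<tau> a y - step_integral m' \<tau>' a' y = G y + d" for y
    unfolding G_def d_def f_def centred_def using step_S_integrable by (simp add: left_diff_distrib)
  then have e1: "(\<integral>\<^sup>+y. ennreal ((step_integral m \<tau> a y - step_integral m' \<tau>' a' y)\<^sup>2) \<partial>P) = (\<integral>\<^sup>+y. ennreal ((G y + d)\<^sup>2) \<partial>P)" by simp
  have e2: "(\<integral>\<^sup>+y. ennreal ((G y + d)\<^sup>2) \<partial>P) \<le> (\<integral>\<^sup>+y. 2 * ennreal ((G y)\<^sup>2) + ennreal (2 * d\<^sup>2) \<partial>P)"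
  proof (rule nn_integral_mono)
    fix y
    have "(G y + d)\<^sup>2 \<le> 2 * (G y)\<^sup>2 + 2 * d\<^sup>2" using sum_squares_bound[of "G y" d] by (simp add: power2_sum)
    then have "ennreal ((G y + d)\<^sup>2) \<le> ennreal (2 * (G y)\<^sup>2 + 2 * d\<^sup>2)" by (rule ennreal_leI)
    also have "\<dots> = 2 * ennreal ((G y)\<^sup>2) + ennreal (2 * d\<^sup>2)"
      unfolding two[symmetric] by (rule ennreal_plus) simp_all
    finally show "ennreal ((G y + d)\<^sup>2) \<le> 2 * ennreal ((G y)\<^sup>2) + ennreal (2 * d\<^sup>2)" .
  qed
  have e3: "(\<integral>\<^sup>+y. 2 * ennreal ((G y)\<^sup>2) + ennreal (2 * d\<^sup>2) \<partial>P) = 2 * (\<integral>\<^sup>+y. ennreal ((G y)\<^sup>2) \<partial>P) + ennreal (2 * d\<^sup>2)"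
    using Gm by (subst nn_integral_add) (auto simp: nn_integral_cmult emeasure_space_1)
  have e4: "2 * (\<integral>\<^sup>+y. ennreal ((G y)\<^sup>2) \<partial>P) + ennreal (2 * d\<^sup>2) \<le> 2 * ennreal (s * I) + ennreal (2 * (I * (\<integral>t. (S t)\<^sup>2 \<partial>L)))"
  proof (rule add_mono)
    show "2 * (\<integral>\<^sup>+y. ennreal ((G y)\<^sup>2) \<partial>P) \<le> 2 * ennreal (s * I)" by (rule mult_left_mono[OF G2]) simp
    show "ennreal (2 * d\<^sup>2) \<le> ennreal (2 * (I * (\<integral>t. (S t)\<^sup>2 \<partial>L)))" using d2 by (intro ennreal_leI) linarith
  qed
  have e5: "2 * ennreal (s * I) + ennreal (2 * (I * (\<integral>t. (S t)\<^sup>2 \<partial>L))) = ennreal (2 * (s * I) + 2 * (I * (\<integral>t. (S t)\<^sup>2 \<partial>L)))"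
    unfolding two[symmetric] by (rule ennreal_plus[symmetric]) (use s I0 in simp_all)
  have e6: "2 * (s * I) + 2 * (I * (\<integral>t. (S t)\<^sup>2 \<partial>L)) = (2 * s + 2 * (\<integral>t. (S t)\<^sup>2 \<partial>L)) * I"
    by (simp add: algebra_simps)
  show ?thesis
    using order_trans[OF e2[unfolded e3] e4[unfolded e5 e6]] unfolding e1[symmetric] I_def f_def .
qed

end

section \<open>Stochastic integrals of bounded functions\<close>

text \<open>The squared distances decay like 4^-k, so the L1 norms of consecutive differences decay
  like 2^-k and are summable. The sequence therefore converges almost surely, and Fatou in the
  second index identifies the limit in L2.\<close>

lemma L2_complete_fast:
  fixes F :: "nat \<Rightarrow> 'a \<Rightarrow> real"
  assumes M: "prob_space M" and m[measurable]: "\<And>k. F k \<in> borel_measurable M" and C: "0 \<le> C"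
    and cauchy: "\<And>k l. k \<le> l \<Longrightarrow> (\<integral>\<^sup>+\<omega>. ennreal ((F k \<omega> - F l \<omega>)\<^sup>2) \<partial>M) \<le> ennreal (C * (1/4) ^ k)"
  shows "\<exists>X. X \<in> borel_measurable M \<and> (\<lambda>k. \<integral>\<^sup>+\<omega>. ennreal ((F k \<omega> - X \<omega>)\<^sup>2) \<partial>M) \<longlonglongrightarrow> 0"
proof -
  interpret prob_space M by fact
  have L1: "(\<integral>\<^sup>+\<omega>. ennreal \<bar>F (Suc k) \<omega> - F k \<omega>\<bar> \<partial>M) \<le> ennreal ((C + 1) * (1/2) ^ k)" for k
  proof -
    have "(\<integral>\<^sup>+\<omega>. ennreal \<bar>F (Suc k) \<omega> - F k \<omega>\<bar> \<partial>M)
      \<le> (\<integral>\<^sup>+\<omega>. ennreal (2 ^ k) * ennreal ((F k \<omega> - F (Suc k) \<omega>)\<^sup>2) + ennreal ((1/2) ^ k) \<partial>M)"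
    proof (rule nn_integral_mono)
      fix \<omega>
      \<comment> \<open>Used with c = 2^k, which balances a square of order 4^-k against the
        additive term 1 / c.\<close>
      have e: "\<bar>x\<bar> \<le> c * x\<^sup>2 + 1 / c" if "0 < c" for x c :: real
      proof -
        have "0 \<le> (c * \<bar>x\<bar> - 1)\<^sup>2 + c * \<bar>x\<bar>" using that by simp
        then have "c * \<bar>x\<bar> \<le> c * (c * x\<^sup>2 + 1 / c)"
          using that by (simp add: power2_eq_square algebra_simps)
        then show ?thesis using that by (simp only: mult_le_cancel_left_pos)
      qed
      have "\<bar>F (Suc k) \<omega> - F k \<omega>\<bar> \<le> 2 ^ k * (F k \<omega> - F (Suc k) \<omega>)\<^sup>2 + (1/2) ^ k"
        using e[of "2 ^ k" "F k \<omega> - F (Suc k) \<omega>"] by (simp add: power_one_over abs_minus_commute)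
      then have "ennreal \<bar>F (Suc k) \<omega> - F k \<omega>\<bar> \<le> ennreal (2 ^ k * (F k \<omega> - F (Suc k) \<omega>)\<^sup>2 + (1/2) ^ k)" by (rule ennreal_leI)
      also have "\<dots> = ennreal (2 ^ k) * ennreal ((F k \<omega> - F (Suc k) \<omega>)\<^sup>2) + ennreal ((1/2) ^ k)"
        by (subst ennreal_plus) (simp_all add: ennreal_mult')
      finally show "ennreal \<bar>F (Suc k) \<omega> - F k \<omega>\<bar> \<le> ennreal (2 ^ k) * ennreal ((F k \<omega> - F (Suc k) \<omega>)\<^sup>2) + ennreal ((1/2) ^ k)" .
    qed
    also have "\<dots> = ennreal (2 ^ k) * (\<integral>\<^sup>+\<omega>. ennreal ((F k \<omega> - F (Suc k) \<omega>)\<^sup>2) \<partial>M) + ennreal ((1/2) ^ k)"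
      by (subst nn_integral_add) (simp_all add: nn_integral_cmult emeasure_space_1)
    also have "\<dots> \<le> ennreal (2 ^ k) * ennreal (C * (1/4) ^ k) + ennreal ((1/2) ^ k)"
      by (rule add_right_mono[OF mult_left_mono[OF cauchy]]) simp_all
    also have "\<dots> = ennreal (2 ^ k * (C * (1/4) ^ k) + (1/2) ^ k)"
      using C by (subst ennreal_plus) (simp_all add: ennreal_mult'')
    also have "2 ^ k * (C * (1/4) ^ k) + (1/2) ^ k = (C + 1) * (1/2) ^ k"
    proof -
      have "2 ^ k * (1/4 :: real) ^ k = (1/2) ^ k" by (simp flip: power_mult_distrib)
      then show ?thesis by (simp add: algebra_simps)
    qed
    finally show ?thesis .
  qed
  have "(\<integral>\<^sup>+\<omega>. (\<Sum>k. ennreal \<bar>F (Suc k) \<omega> - F k \<omega>\<bar>) \<partial>M) = (\<Sum>k. \<integral>\<^sup>+\<omega>. ennreal \<bar>F (Suc k) \<omega> - F k \<omega>\<bar> \<partial>M)"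
    by (rule nn_integral_suminf) measurable
  also have "\<dots> \<le> (\<Sum>k. ennreal ((C + 1) * (1/2) ^ k))"
    by (intro suminf_le L1) auto
  also have "\<dots> < \<infinity>"
  proof -
    have "summable (\<lambda>k. (C + 1) * (1/2 :: real) ^ k)" by (intro summable_mult summable_geometric) simp
    then have "(\<Sum>k. ennreal ((C + 1) * (1/2) ^ k)) \<noteq> top"
      using C by (intro ennreal_suminf_neq_top) auto
    then show ?thesis by (simp add: less_top)
  qed
  finally have "AE \<omega> in M. (\<Sum>k. ennreal \<bar>F (Suc k) \<omega> - F k \<omega>\<bar>) \<noteq> \<infinity>"
    by (intro nn_integral_PInf_AE) auto
  then have conv: "AE \<omega> in M. convergent (\<lambda>k. F k \<omega>)"
  proof eventually_elim
    case (elim \<omega>)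
    then have "summable (\<lambda>k. \<bar>F (Suc k) \<omega> - F k \<omega>\<bar>)"
      by (intro summable_suminf_not_top) auto
    then have "summable (\<lambda>k. F (Suc k) \<omega> - F k \<omega>)" by (rule summable_rabs_cancel)
    then have "convergent (\<lambda>n. \<Sum>k<n. F (Suc k) \<omega> - F k \<omega>)" by (simp add: summable_iff_convergent)
    then have "convergent (\<lambda>n. F n \<omega> - F 0 \<omega>)" by (simp add: sum_lessThan_telescope[of "\<lambda>k. F k \<omega>"])
    then have "convergent (\<lambda>n. (F n \<omega> - F 0 \<omega>) + F 0 \<omega>)" by (intro convergent_add convergent_const)
    then show ?case by simp
  qed
  define X where "X = (\<lambda>\<omega>. lim (\<lambda>k. F k \<omega>))"
  have Xm: "X \<in> borel_measurable M" unfolding X_def by (rule borel_measurable_lim_metric) simp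
  have bd: "(\<integral>\<^sup>+\<omega>. ennreal ((F k \<omega> - X \<omega>)\<^sup>2) \<partial>M) \<le> ennreal (C * (1/4) ^ k)" for k
  proof (rule nn_integral_square_le_limit)
    show "(\<lambda>\<omega>. F k \<omega> - F (l + k) \<omega>) \<in> borel_measurable M" for l by measurable
    show "AE \<omega> in M. (\<lambda>l. F k \<omega> - F (l + k) \<omega>) \<longlonglongrightarrow> F k \<omega> - X \<omega>"
      using conv
    proof eventually_elim
      case (elim \<omega>)
      then have "(\<lambda>k. F k \<omega>) \<longlonglongrightarrow> X \<omega>" unfolding X_def by (simp add: convergent_LIMSEQ_iff)
      then show ?case by (intro tendsto_diff tendsto_const LIMSEQ_ignore_initial_segment)
    qed
    show "(\<integral>\<^sup>+\<omega>. ennreal ((F k \<omega> - F (l + k) \<omega>)\<^sup>2) \<partial>M) \<le> ennreal (C * (1/4) ^ k)" for l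
      by (rule cauchy) simp
  qed simp
  have "(\<lambda>k. ennreal (C * (1/4) ^ k)) \<longlonglongrightarrow> ennreal (C * 0)"
    by (intro tendsto_ennrealI tendsto_mult tendsto_const LIMSEQ_power_zero) simp
  then have lim0: "(\<lambda>k. ennreal (C * (1/4) ^ k)) \<longlonglongrightarrow> 0" by simp
  have "(\<lambda>k. \<integral>\<^sup>+\<omega>. ennreal ((F k \<omega> - X \<omega>)\<^sup>2) \<partial>M) \<longlonglongrightarrow> 0"
    by (rule tendsto_sandwich[OF _ _ tendsto_const lim0]) (use bd in auto)
  then show ?thesis using Xm by blast
qed

text \<open>Uniform continuity on a fine equidistant grid. Step functions vanish at 0, which lies in
  no half-open cell, so the estimate leaves that point out.\<close>

lemma continuous_step_approx:
  fixes g :: "real \<Rightarrow> real"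
  assumes "0 < T" "continuous_on {0..T} g" "0 < e"
  shows "\<exists>m \<tau> a. mono_on {..m} \<tau> \<and> \<tau> ` {..m} \<subseteq> {0..T} \<and> (\<forall>t\<in>{0<..T}. \<bar>step_function m \<tau> a t - g t\<bar> \<le> e)"
proof -
  have "uniformly_continuous_on {0..T} g"
    by (rule compact_uniformly_continuous[OF assms(2)]) simp
  then obtain d where d: "0 < d" "\<And>x y. x \<in> {0..T} \<Longrightarrow> y \<in> {0..T} \<Longrightarrow> dist y x < d \<Longrightarrow> dist (g y) (g x) < e"
    using assms(3) unfolding uniformly_continuous_on_def by meson
  obtain N :: nat where N: "T / d < real N" using reals_Archimedean2 by blast
  have "0 < T / d" using assms d by simp
  then have N0: "0 < N" using N by (metis less_trans of_nat_0_less_iff)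
  define h where "h = T / real N"
  have h: "0 < h" "h < d" using N N0 d(1) assms(1) unfolding h_def by (auto simp: field_simps)
  define \<tau> where "\<tau> = (\<lambda>i::nat. real i * h)"
  have hT: "real N * h = T" unfolding h_def using N0 by simp
  have mono: "mono_on {..N} \<tau>" unfolding \<tau>_def using h by (intro monotone_onI mult_right_mono) auto
  have range: "\<tau> ` {..N} \<subseteq> {0..T}"
    unfolding \<tau>_def using h hT by (auto simp: mult_right_mono simp flip: hT)
  have "\<bar>step_function N \<tau> (\<lambda>i. g (\<tau> (Suc i))) t - g t\<bar> \<le> e" if t: "t \<in> {0<..T}" for t
  proof -
    \<comment> \<open>The index of the cell, open on the left and closed on the right, that contains
      t; the step function takes the value of \<open>g\<close> at its right end.\<close>
    define k where "k = nat (\<lceil>t / h\<rceil> - 1)"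
    have "0 < t / h" using t h by auto
    then have c1: "1 \<le> \<lceil>t / h\<rceil>" by linarith
    then have rk: "real k = of_int \<lceil>t / h\<rceil> - 1" unfolding k_def by simp
    have "real k < t / h" "t / h \<le> real k + 1" using rk by linarith+
    then have tk: "\<tau> k < t" "t \<le> \<tau> (Suc k)" using h unfolding \<tau>_def by (auto simp: field_simps)
    have kN: "k < N"
    proof -
      have "\<tau> k < real N * h" using tk(1) t hT by auto
      then show ?thesis unfolding \<tau>_def using h(1) by simp
    qed
    have "step_function N \<tau> (\<lambda>i. g (\<tau> (Suc i))) t = (\<Sum>i\<in>{k}. g (\<tau> (Suc i)) * indicator {\<tau> i<..\<tau> (Suc i)} t)"
      unfolding step_function_def
    proof (rule sum.mono_neutral_right)
      show "\<forall>i\<in>{..<N} - {k}. g (\<tau> (Suc i)) * indicator {\<tau> i<..\<tau> (Suc i)} t = 0"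
      proof
        fix i assume "i \<in> {..<N} - {k}"
        then consider "Suc i \<le> k" | "Suc k \<le> i" by fastforce
        then have "t \<notin> {\<tau> i<..\<tau> (Suc i)}"
        proof cases
          case 1
          then have "\<tau> (Suc i) \<le> \<tau> k" unfolding \<tau>_def using h by (intro mult_right_mono) auto
          then show ?thesis using tk by auto
        next
          case 2
          then have "\<tau> (Suc k) \<le> \<tau> i" unfolding \<tau>_def using h by (intro mult_right_mono) auto
          then show ?thesis using tk by auto
        qed
        then show "g (\<tau> (Suc i)) * indicator {\<tau> i<..\<tau> (Suc i)} t = 0" by simp
      qed
    qed (use kN in auto)
    also have "\<dots> = g (\<tau> (Suc k))" using tk by simp
    finally have eq: "step_function N \<tau> (\<lambda>i. g (\<tau> (Suc i))) t = g (\<tau> (Suc k))" .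
    have "\<tau> (Suc k) \<in> \<tau> ` {..N}" using kN by auto
    then have "\<tau> (Suc k) \<in> {0..T}" using range by auto
    moreover have "dist (\<tau> (Suc k)) t < d"
    proof -
      have "\<tau> (Suc k) - \<tau> k = h" unfolding \<tau>_def by (simp add: algebra_simps)
      then show ?thesis using tk h unfolding dist_real_def by simp
    qed
    ultimately have "dist (g (\<tau> (Suc k))) (g t) < e" using t by (intro d(2)) auto
    then show ?thesis unfolding eq dist_real_def by simp
  qed
  then show ?thesis using mono range by blast
qed

context observed
begin

text \<open>A measurable function is almost everywhere a limit of continuous ones. Clamping these to
  [-c, c] keeps the limit and allows dominated convergence, after which one continuous function is
  replaced by a step function.\<close>

lemma step_approx:
  fixes f :: "real \<Rightarrow> real"
  assumes f: "f \<in> borel_measurable L" and c: "\<And>t. t \<in> {0..T} \<Longrightarrow> \<bar>f t\<bar> \<le> c" and e: "0 < e"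
  shows "\<exists>m \<tau> a. valid m \<tau> \<and> (\<integral>t. (step_function m \<tau> a t - f t)\<^sup>2 \<partial>L) \<le> e"
proof -
  define f0 where "f0 = (\<lambda>t. if t \<in> {0..T} then f t else 0)"
  have c0: "0 \<le> c" using c[of 0] T by auto
  have "f0 \<in> borel_measurable lebesgue"
    unfolding f0_def by (rule borel_measurable_if_I[OF f]) simp
  then have "f0 measurable_on {0..T}" by (rule lebesgue_measurable_imp_measurable_on) simp
  then have "\<exists>N g. negligible N \<and> (\<forall>n. continuous_on UNIV (g n)) \<and>
      (\<forall>x. x \<notin> N \<longrightarrow> (\<lambda>n. g n x) \<longlonglongrightarrow> (if x \<in> {0..T} then f0 x else 0))"
    unfolding measurable_on_def .
  then obtain N and g :: "nat \<Rightarrow> real \<Rightarrow> real" where N: "negligible N" and g': "\<forall>n. continuous_on UNIV (g n)"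
    and lim': "\<forall>x. x \<notin> N \<longrightarrow> (\<lambda>n. g n x) \<longlonglongrightarrow> (if x \<in> {0..T} then f0 x else 0)"
    by (elim exE conjE) (rule that)
  have g: "continuous_on UNIV (g n)" for n using g' by simp
  have lim: "(\<lambda>n. g n x) \<longlonglongrightarrow> (if x \<in> {0..T} then f0 x else 0)" if "x \<notin> N" for x using lim' that by simp
  define G where "G = (\<lambda>n x. max (- c) (min c (g n x :: real)))"
  have Gc: "continuous_on {0..T} (G n)" for n
    unfolding G_def by (intro continuous_intros continuous_on_subset[OF g]) auto
  have Gb: "\<bar>G n x\<bar> \<le> c" for n x unfolding G_def using c0 by auto
  have Gm: "G n \<in> borel_measurable L" for n
    by (rule continuous_imp_measurable_on_sets_lebesgue[OF Gc]) simp
  have AEN: "AE t in L. t \<notin> N \<and> t \<in> {0..T}"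
  proof -
    have "AE t in lebesgue. t \<notin> N" using N by (simp add: negligible_iff_null_sets AE_not_in)
    then show ?thesis by (subst AE_restrict_space_iff) (auto elim!: eventually_mono)
  qed
  have "(\<lambda>n. \<integral>t. (G n t - f t)\<^sup>2 \<partial>L) \<longlonglongrightarrow> (\<integral>t. 0 \<partial>L)"
  proof (rule integral_dominated_convergence[where w="\<lambda>_. (2 * c)\<^sup>2"])
    show "(\<lambda>t. (G n t - f t)\<^sup>2) \<in> borel_measurable L" for n using Gm f by measurable
    show "integrable L (\<lambda>_. (2 * c)\<^sup>2)" by (rule bounded_integrable[where B="(2 * c)\<^sup>2"]) auto
    show "AE t in L. (\<lambda>n. (G n t - f t)\<^sup>2) \<longlonglongrightarrow> 0"
      using AEN
    proof eventually_elim
      case (elim t)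
      then have "(\<lambda>n. g n t) \<longlonglongrightarrow> f t" using lim[of t] by (simp add: f0_def)
      then have "(\<lambda>n. G n t) \<longlonglongrightarrow> max (- c) (min c (f t))"
        unfolding G_def by (intro tendsto_intros)
      moreover have "max (- c) (min c (f t)) = f t" using c[of t] elim by auto
      ultimately have "(\<lambda>n. (G n t - f t)\<^sup>2) \<longlonglongrightarrow> (f t - f t)\<^sup>2" by (intro tendsto_intros) simp
      then show ?case by simp
    qed
    show "AE t in L. norm ((G n t - f t)\<^sup>2) \<le> (2 * c)\<^sup>2" for n
      using AEN
    proof eventually_elim
      case (elim t)
      have "\<bar>G n t - f t\<bar> \<le> 2 * c" using Gb[of n t] c[of t] elim by auto
      from power_mono[OF this, of 2] show ?case by simp
    qed
  qed simp
  then have "\<forall>\<^sub>F n in sequentially. (\<integral>t. (G n t - f t)\<^sup>2 \<partial>L) < e / 4"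
    using e by (intro order_tendstoD(2)) auto
  then obtain n where n: "(\<integral>t. (G n t - f t)\<^sup>2 \<partial>L) < e / 4"
    by (auto simp: eventually_sequentially)
  \<comment> \<open>Chosen so that the uniform error contributes 2 \<eta>^2 T = e / 2; the other
    half of the budget is twice the distance to the continuous function, below e / 4.\<close>
  define \<eta> where "\<eta> = sqrt (e / (4 * T))"
  have \<eta>: "0 < \<eta>" "\<eta>\<^sup>2 * T = e / 4" unfolding \<eta>_def using e T by auto
  obtain m \<tau> a where v: "valid m \<tau>" and st: "\<And>t. t \<in> {0<..T} \<Longrightarrow> \<bar>step_function m \<tau> a t - G n t\<bar> \<le> \<eta>"
    using continuous_step_approx[OF T Gc[of n] \<eta>(1)] unfolding valid_def by blast
  have AE0: "AE t in L. t \<in> {0<..T}"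
  proof -
    have "AE t in lebesgue. t \<notin> {0}" by (rule AE_not_in) simp
    then show ?thesis by (subst AE_restrict_space_iff) (auto elim!: eventually_mono)
  qed
  have sq: "(u + v)\<^sup>2 \<le> 2 * u\<^sup>2 + 2 * v\<^sup>2" for u v :: real
    using sum_squares_bound[of u v] by (simp add: power2_sum)
  have "(\<integral>t. (step_function m \<tau> a t - f t)\<^sup>2 \<partial>L) \<le> (\<integral>t. 2 * \<eta>\<^sup>2 + 2 * (G n t - f t)\<^sup>2 \<partial>L)"
  proof (rule integral_mono_AE)
    have "\<bar>(step_function m \<tau> a t - f t)\<^sup>2\<bar> \<le> ((\<Sum>i<m. \<bar>a i\<bar>) + c)\<^sup>2" if "t \<in> {0..T}" for t
    proof -
      have "\<bar>step_function m \<tau> a t - f t\<bar> \<le> (\<Sum>i<m. \<bar>a i\<bar>) + c"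
        using abs_step_function_le[of m \<tau> a t] c[OF that] by linarith
      from power_mono[OF this, of 2] show ?thesis by simp
    qed
    then show "integrable L (\<lambda>t. (step_function m \<tau> a t - f t)\<^sup>2)"
      by (rule bounded_integrable[rotated]) (use f step_function_measurable in measurable)
    have "\<bar>2 * \<eta>\<^sup>2 + 2 * (G n t - f t)\<^sup>2\<bar> \<le> 2 * \<eta>\<^sup>2 + 2 * (2 * c)\<^sup>2" if "t \<in> {0..T}" for t
    proof -
      have "\<bar>G n t - f t\<bar> \<le> 2 * c" using Gb[of n t] c[OF that] by auto
      from power_mono[OF this, of 2] show ?thesis by simp
    qed
    then show "integrable L (\<lambda>t. 2 * \<eta>\<^sup>2 + 2 * (G n t - f t)\<^sup>2)"
      by (rule bounded_integrable[rotated]) (use f Gm in measurable)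
    show "AE t in L. (step_function m \<tau> a t - f t)\<^sup>2 \<le> 2 * \<eta>\<^sup>2 + 2 * (G n t - f t)\<^sup>2"
      using AE0
    proof eventually_elim
      case (elim t)
      have "(step_function m \<tau> a t - f t)\<^sup>2 = ((step_function m \<tau> a t - G n t) + (G n t - f t))\<^sup>2" by simp
      also have "\<dots> \<le> 2 * (step_function m \<tau> a t - G n t)\<^sup>2 + 2 * (G n t - f t)\<^sup>2"
        by (rule sq)
      also have "(step_function m \<tau> a t - G n t)\<^sup>2 \<le> \<eta>\<^sup>2"
        using power_mono[OF st[OF elim], of 2] by simp
      finally show ?case by simp
    qed
  qed
  also have "\<dots> = 2 * \<eta>\<^sup>2 * T + 2 * (\<integral>t. (G n t - f t)\<^sup>2 \<partial>L)"
  proof -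
    have "integrable L (\<lambda>t. (G n t - f t)\<^sup>2)"
    proof (rule bounded_integrable)
      show "(\<lambda>t. (G n t - f t)\<^sup>2) \<in> borel_measurable L" using Gm f by measurable
      show "\<bar>(G n t - f t)\<^sup>2\<bar> \<le> (2 * c)\<^sup>2" if "t \<in> {0..T}" for t
      proof -
        have "\<bar>G n t - f t\<bar> \<le> 2 * c" using Gb[of n t] c[OF that] by auto
        from power_mono[OF this, of 2] show ?thesis by simp
      qed
    qed
    moreover have "measure L (space L) = T" using T by (simp add: measure_restrict_space)
    moreover have "integrable L (\<lambda>t. 2 * \<eta>\<^sup>2)" by (rule bounded_integrable[where B="2 * \<eta>\<^sup>2"]) auto
    ultimately show ?thesis by (subst Bochner_Integration.integral_add) auto
  qed
  also have "\<dots> \<le> e" using n \<eta>(2) by simp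
  finally show ?thesis using v by blast
qed

text \<open>Nothing is known about a chosen object until existence is proved: integrals of good
  approximations form a Cauchy sequence by \<open>step_integral_diff_bound\<close>, and its limit is
  a witness for the choice.\<close>

lemma stochastic_integral_exists:
  assumes f: "f \<in> borel_measurable L" and c: "\<And>t. t \<in> {0..T} \<Longrightarrow> \<bar>f t\<bar> \<le> c"
  shows "has_stochastic_integral P T f (stochastic_integral P T f)"
proof -
  \<comment> \<open>The rate 4^-k makes the distance of the approximations k <= l at most 4 * 4^-k,
    the form that \<open>L2_complete_fast\<close> accepts.\<close>
  define good where "good = (\<lambda>(k :: nat) z. valid (fst z) (fst (snd z)) \<and>
    (\<integral>t. (step_function (fst z) (fst (snd z)) (snd (snd z)) t - f t)\<^sup>2 \<partial>L) \<le> (1/4) ^ k)"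
  have "\<exists>z. good k z" for k
  proof -
    have "0 < (1/4 :: real) ^ k" by simp
    then have "\<exists>m \<tau> a. valid m \<tau> \<and> (\<integral>t. (step_function m \<tau> a t - f t)\<^sup>2 \<partial>L) \<le> (1/4) ^ k"
      by (intro step_approx[where c=c]) (use f c in auto)
    then obtain m \<tau> a where "valid m \<tau>" "(\<integral>t. (step_function m \<tau> a t - f t)\<^sup>2 \<partial>L) \<le> (1/4) ^ k"
      by (elim exE conjE) (rule that)
    then show ?thesis by (intro exI[of _ "(m, \<tau>, a)"]) (simp add: good_def)
  qed
  from choice[OF allI[OF this]] obtain z where z: "\<forall>k. good k (z k)" ..
  define m \<tau> a where "m = (\<lambda>k. fst (z k))" and "\<tau> = (\<lambda>k. fst (snd (z k)))" and "a = (\<lambda>k. snd (snd (z k)))"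
  define g where "g = (\<lambda>k. step_function (m k) (\<tau> k) (a k))"
  define F where "F = (\<lambda>k. step_integral (m k) (\<tau> k) (a k))"
  have v: "valid (m k) (\<tau> k)" and ap: "(\<integral>t. (g k t - f t)\<^sup>2 \<partial>L) \<le> (1/4) ^ k" for k
    using z unfolding m_def \<tau>_def a_def g_def good_def by auto
  define C where "C = 2 * s + 2 * (\<integral>t. (S t)\<^sup>2 \<partial>L)"
  have C: "0 \<le> C" unfolding C_def using s by simp
  have gm: "g k \<in> borel_measurable L" for k unfolding g_def by (rule step_function_measurable)
  have gi: "integrable L (\<lambda>t. (g k t - f t)\<^sup>2)" for k
  proof (rule bounded_integrable)
    show "(\<lambda>t. (g k t - f t)\<^sup>2) \<in> borel_measurable L" using gm f by measurable
    show "\<bar>(g k t - f t)\<^sup>2\<bar> \<le> ((\<Sum>i<m k. \<bar>a k i\<bar>) + c)\<^sup>2" if "t \<in> {0..T}" for t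
    proof -
      have "\<bar>g k t - f t\<bar> \<le> (\<Sum>i<m k. \<bar>a k i\<bar>) + c"
        using abs_step_function_le[of "m k" "\<tau> k" "a k" t] c[OF that] unfolding g_def by linarith
      from power_mono[OF this, of 2] show ?thesis by simp
    qed
  qed
  have "\<exists>X. X \<in> borel_measurable P \<and> (\<lambda>k. \<integral>\<^sup>+y. ennreal ((F k y - X y)\<^sup>2) \<partial>P) \<longlonglongrightarrow> 0"
  proof (rule L2_complete_fast)
    show "prob_space P" by unfold_locales
    show "F k \<in> borel_measurable P" for k unfolding F_def by (rule step_integral_measurable[OF v])
    show "0 \<le> C * 4" using C by simp
    fix k l :: nat assume kl: "k \<le> l"
    have "(\<integral>\<^sup>+y. ennreal ((F k y - F l y)\<^sup>2) \<partial>P) \<le> ennreal (C * (\<integral>t. (g k t - g l t)\<^sup>2 \<partial>L))"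
      unfolding F_def g_def C_def by (rule step_integral_diff_bound[OF v v])
    also have "\<dots> \<le> ennreal (C * 4 * (1/4) ^ k)"
    proof (rule ennreal_leI)
      have "(\<integral>t. (g k t - g l t)\<^sup>2 \<partial>L) \<le> (\<integral>t. 2 * (g k t - f t)\<^sup>2 + 2 * (g l t - f t)\<^sup>2 \<partial>L)"
      proof (rule integral_mono')
        show "integrable L (\<lambda>t. 2 * (g k t - f t)\<^sup>2 + 2 * (g l t - f t)\<^sup>2)" using gi by simp
        show "(g k t - g l t)\<^sup>2 \<le> 2 * (g k t - f t)\<^sup>2 + 2 * (g l t - f t)\<^sup>2" for t
        proof -
          have "0 \<le> ((g k t - f t) + (g l t - f t))\<^sup>2" by simp
          then show ?thesis by (simp add: power2_eq_square algebra_simps)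
        qed
      qed simp
      also have "\<dots> = 2 * (\<integral>t. (g k t - f t)\<^sup>2 \<partial>L) + 2 * (\<integral>t. (g l t - f t)\<^sup>2 \<partial>L)"
        using gi by simp
      also have "\<dots> \<le> 4 * (1/4) ^ k"
      proof -
        have "(1/4 :: real) ^ l \<le> (1/4) ^ k" using kl by (intro power_decreasing) auto
        then show ?thesis using ap[of k] ap[of l] by linarith
      qed
      finally show "C * (\<integral>t. (g k t - g l t)\<^sup>2 \<partial>L) \<le> C * 4 * (1/4) ^ k"
        using mult_left_mono[OF _ C] by (simp add: mult.assoc)
    qed
    finally show "(\<integral>\<^sup>+y. ennreal ((F k y - F l y)\<^sup>2) \<partial>P) \<le> ennreal (C * 4 * (1/4) ^ k)" .
  qed
  then obtain X where X: "X \<in> borel_measurable P" "(\<lambda>k. \<integral>\<^sup>+y. ennreal ((F k y - X y)\<^sup>2) \<partial>P) \<longlonglongrightarrow> 0"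
    by blast
  have "(\<lambda>k. \<integral>\<^sup>+t. ennreal ((g k t - f t)\<^sup>2) \<partial>L) \<longlonglongrightarrow> 0"
  proof (rule tendsto_sandwich[OF _ _ tendsto_const])
    show "\<forall>\<^sub>F k in sequentially. (\<integral>\<^sup>+t. ennreal ((g k t - f t)\<^sup>2) \<partial>L) \<le> ennreal ((1/4) ^ k)"
      using gi ap by (intro always_eventually allI) (simp add: nn_integral_eq_integral ennreal_leI)
    have "(\<lambda>k. ennreal ((1/4) ^ k)) \<longlonglongrightarrow> ennreal 0"
      by (intro tendsto_ennrealI LIMSEQ_power_zero) simp
    then show "(\<lambda>k. ennreal ((1/4) ^ k)) \<longlonglongrightarrow> 0" by simp
  qed simp
  then have "has_stochastic_integral P T f X"
    unfolding has_stochastic_integral_def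
    using X v unfolding valid_def F_def g_def by blast
  then show ?thesis unfolding stochastic_integral_def by (rule someI[of "has_stochastic_integral P T f"])
qed

end

section \<open>Bounded approximations, and the bounds for the stochastic integrals\<close>

lemma step_function_at:
  assumes "mono_on {..m} \<tau>" "i < m" "\<tau> i < t" "t \<le> \<tau> (Suc i)"
  shows "step_function m \<tau> a t = a i"
proof -
  have "step_function m \<tau> a t = (\<Sum>k\<in>{i}. a k * indicator {\<tau> k<..\<tau> (Suc k)} t)"
    unfolding step_function_def
  proof (rule sum.mono_neutral_right)
    show "\<forall>k\<in>{..<m} - {i}. a k * indicator {\<tau> k<..\<tau> (Suc k)} t = 0"
    proof
      fix k assume k: "k \<in> {..<m} - {i}"
      then have "Suc k \<le> i \<Longrightarrow> \<tau> (Suc k) \<le> \<tau> i" "Suc i \<le> k \<Longrightarrow> \<tau> (Suc i) \<le> \<tau> k"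
        using assms(1,2) unfolding monotone_on_def by auto
      moreover have "Suc k \<le> i \<or> Suc i \<le> k" using k by fastforce
      ultimately have "t \<notin> {\<tau> k<..\<tau> (Suc k)}" using assms(3,4) by auto
      then show "a k * indicator {\<tau> k<..\<tau> (Suc k)} t = 0" by simp
    qed
  qed (use assms in auto)
  then show ?thesis using assms by simp
qed

text \<open>At each point at most one cell is active, so clamping coefficients is clamping values;
  the value 0 off all cells is unchanged because 0 lies in [-c, c].\<close>

lemma step_function_clip:
  assumes "mono_on {..m} \<tau>" "0 \<le> c"
  shows "step_function m \<tau> (\<lambda>i. max (- c) (min c (a i))) t = max (- c) (min c (step_function m \<tau> a t))"
proof (cases "\<exists>i<m. \<tau> i < t \<and> t \<le> \<tau> (Suc i)")
  case True
  then obtain i where "i < m" "\<tau> i < t" "t \<le> \<tau> (Suc i)" by auto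
  then show ?thesis using step_function_at[OF assms(1)] by simp
next
  case False
  then have "step_function m \<tau> b t = 0" for b
    unfolding step_function_def by (intro sum.neutral) (auto simp: indicator_def)
  then show ?thesis using assms(2) by simp
qed

context observed
begin

lemma bounded_convergence:
  fixes h :: "nat \<Rightarrow> real \<Rightarrow> real"
  assumes "\<And>l. h l \<in> borel_measurable L" "h0 \<in> borel_measurable L" "AE t in L. (\<lambda>l. h l t) \<longlonglongrightarrow> h0 t"
    and "\<And>l t. \<bar>h l t\<bar> \<le> B"
  shows "(\<lambda>l. \<integral>t. h l t \<partial>L) \<longlonglongrightarrow> (\<integral>t. h0 t \<partial>L)"
proof (rule integral_dominated_convergence[where w="\<lambda>_. B"])
  show "integrable L (\<lambda>_. B)" by (rule bounded_integrable[where B="\<bar>B\<bar>"]) auto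
qed (use assms in auto)

text \<open>The step functions attached to a given version may be unbounded, and then the integrals
  of products and fourth powers need not converge along with them. Clamping repairs this and changes
  the step integrals by an amount that tends to 0 in L2.\<close>

lemma clipped_approximation:
  assumes f: "f \<in> borel_measurable L" and c: "\<And>t. t \<in> {0..T} \<Longrightarrow> \<bar>f t\<bar> \<le> c"
    and X: "has_stochastic_integral P T f X"
  shows "\<exists>m \<tau> a. (\<forall>k. valid (m k) (\<tau> k) \<and> (\<forall>t. \<bar>step_function (m k) (\<tau> k) (a k) t\<bar> \<le> c)) \<and>
    (\<lambda>k. \<integral>\<^sup>+t. ennreal ((step_function (m k) (\<tau> k) (a k) t - f t)\<^sup>2) \<partial>L) \<longlonglongrightarrow> 0 \<and>
    (\<lambda>k. \<integral>\<^sup>+y. ennreal ((step_integral (m k) (\<tau> k) (a k) y - X y)\<^sup>2) \<partial>P) \<longlonglongrightarrow> 0"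
proof -
  have Xm: "X \<in> borel_measurable P" using X unfolding has_stochastic_integral_def by simp
  from X have "\<exists>m \<tau> a. (\<forall>k::nat. mono_on {..m k} (\<tau> k) \<and> \<tau> k ` {..m k} \<subseteq> {0..T}) \<and>
    (\<lambda>k. \<integral>\<^sup>+t. ennreal ((step_function (m k) (\<tau> k) (a k) t - f t)\<^sup>2) \<partial>L) \<longlonglongrightarrow> 0 \<and>
    (\<lambda>k. \<integral>\<^sup>+y. ennreal ((step_integral (m k) (\<tau> k) (a k) y - X y)\<^sup>2) \<partial>P) \<longlonglongrightarrow> 0"
    unfolding has_stochastic_integral_def by simp
  then obtain m \<tau> a where v': "\<forall>k::nat. mono_on {..m k} (\<tau> k) \<and> \<tau> k ` {..m k} \<subseteq> {0..T}"
    and lf: "(\<lambda>k. \<integral>\<^sup>+t. ennreal ((step_function (m k) (\<tau> k) (a k) t - f t)\<^sup>2) \<partial>L) \<longlonglongrightarrow> 0"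
    and lX: "(\<lambda>k. \<integral>\<^sup>+y. ennreal ((step_integral (m k) (\<tau> k) (a k) y - X y)\<^sup>2) \<partial>P) \<longlonglongrightarrow> 0"
    by (elim exE conjE) (rule that)
  have v: "valid (m k) (\<tau> k)" for k using v' unfolding valid_def by simp
  define clip where "clip = (\<lambda>x. max (- c) (min c x))"
  have c0: "0 \<le> c" using c[of 0] T by auto
  define g g' where "g = (\<lambda>k. step_function (m k) (\<tau> k) (a k))"
    and "g' = (\<lambda>k. step_function (m k) (\<tau> k) (\<lambda>i. clip (a k i)))"
  define F F' where "F = (\<lambda>k. step_integral (m k) (\<tau> k) (a k))"
    and "F' = (\<lambda>k. step_integral (m k) (\<tau> k) (\<lambda>i. clip (a k i)))"
  have lf': "(\<lambda>k. \<integral>\<^sup>+t. ennreal ((g k t - f t)\<^sup>2) \<partial>L) \<longlonglongrightarrow> 0"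
    and lX': "(\<lambda>k. \<integral>\<^sup>+y. ennreal ((F k y - X y)\<^sup>2) \<partial>P) \<longlonglongrightarrow> 0"
    using lf lX unfolding g_def F_def .
  have gg: "g' k t = clip (g k t)" for k t
    unfolding g'_def g_def clip_def by (rule step_function_clip) (use v' c0 in auto)
  have gm: "g k \<in> borel_measurable L" "g' k \<in> borel_measurable L" for k
    unfolding g_def g'_def by (rule step_function_measurable)+
  have sq: "\<bar>x\<bar> \<le> \<bar>y\<bar> \<Longrightarrow> x\<^sup>2 \<le> y\<^sup>2" for x y :: real using power_mono[of "\<bar>x\<bar>" "\<bar>y\<bar>" 2] by simp
  \<comment> \<open>Clamping is the projection onto [-c, c], which contains the value of
    \<open>f\<close>: it does not increase the distance to \<open>f\<close>, and it moves a point by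
    no more than that distance.\<close>
  have d1: "(g' k t - f t)\<^sup>2 \<le> (g k t - f t)\<^sup>2" "(g' k t - g k t)\<^sup>2 \<le> (g k t - f t)\<^sup>2" if "t \<in> {0..T}" for k t
    unfolding gg clip_def using c[OF that] c0 by (intro sq; auto simp: max_def min_def)+
  have l1: "(\<lambda>k. \<integral>\<^sup>+t. ennreal ((g' k t - f t)\<^sup>2) \<partial>L) \<longlonglongrightarrow> 0"
  proof (rule tendsto_sandwich[OF _ _ tendsto_const lf'])
    show "\<forall>\<^sub>F k in sequentially. (\<integral>\<^sup>+t. ennreal ((g' k t - f t)\<^sup>2) \<partial>L) \<le> (\<integral>\<^sup>+t. ennreal ((g k t - f t)\<^sup>2) \<partial>L)"
      by (intro always_eventually allI nn_integral_mono ennreal_leI d1) simp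
  qed simp
  define C where "C = 2 * s + 2 * (\<integral>t. (S t)\<^sup>2 \<partial>L)"
  have C: "0 \<le> C" unfolding C_def using s by simp
  have gi: "integrable L (\<lambda>t. (g k t - f t)\<^sup>2)" for k
  proof (rule bounded_integrable)
    show "(\<lambda>t. (g k t - f t)\<^sup>2) \<in> borel_measurable L" using gm f by measurable
    show "\<bar>(g k t - f t)\<^sup>2\<bar> \<le> ((\<Sum>i<m k. \<bar>a k i\<bar>) + c)\<^sup>2" if "t \<in> {0..T}" for t
    proof -
      have "\<bar>g k t - f t\<bar> \<le> (\<Sum>i<m k. \<bar>a k i\<bar>) + c"
        using abs_step_function_le[of "m k" "\<tau> k" "a k" t] c[OF that] unfolding g_def by linarith
      from power_mono[OF this, of 2] show ?thesis by simp
    qed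
  qed
  have bd: "(\<integral>\<^sup>+y. ennreal ((F' k y - X y)\<^sup>2) \<partial>P) \<le> ennreal (2 * C) * (\<integral>\<^sup>+t. ennreal ((g k t - f t)\<^sup>2) \<partial>L) + 2 * (\<integral>\<^sup>+y. ennreal ((F k y - X y)\<^sup>2) \<partial>P)" for k
  proof -
    have Fm: "F k \<in> borel_measurable P" "F' k \<in> borel_measurable P"
      unfolding F_def F'_def by (rule step_integral_measurable[OF v])+
    have "(\<integral>\<^sup>+y. ennreal ((F' k y - X y)\<^sup>2) \<partial>P) \<le> (\<integral>\<^sup>+y. 2 * ennreal ((F' k y - F k y)\<^sup>2) + 2 * ennreal ((F k y - X y)\<^sup>2) \<partial>P)"
    proof (rule nn_integral_mono)
      fix y
      have "(F' k y - X y)\<^sup>2 \<le> 2 * (F' k y - F k y)\<^sup>2 + 2 * (F k y - X y)\<^sup>2"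
      proof -
        have "0 \<le> ((F' k y - F k y) - (F k y - X y))\<^sup>2" by simp
        then show ?thesis by (simp add: power2_eq_square algebra_simps)
      qed
      then have "ennreal ((F' k y - X y)\<^sup>2) \<le> ennreal (2 * (F' k y - F k y)\<^sup>2 + 2 * (F k y - X y)\<^sup>2)" by (rule ennreal_leI)
      also have "\<dots> = ennreal (2 * (F' k y - F k y)\<^sup>2) + ennreal (2 * (F k y - X y)\<^sup>2)" by (rule ennreal_plus) simp_all
      also have "\<dots> = 2 * ennreal ((F' k y - F k y)\<^sup>2) + 2 * ennreal ((F k y - X y)\<^sup>2)" by (simp add: ennreal_mult')
      finally show "ennreal ((F' k y - X y)\<^sup>2) \<le> 2 * ennreal ((F' k y - F k y)\<^sup>2) + 2 * ennreal ((F k y - X y)\<^sup>2)" .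
    qed
    also have "\<dots> = 2 * (\<integral>\<^sup>+y. ennreal ((F' k y - F k y)\<^sup>2) \<partial>P) + 2 * (\<integral>\<^sup>+y. ennreal ((F k y - X y)\<^sup>2) \<partial>P)"
      using Fm Xm by (simp add: nn_integral_add nn_integral_cmult)
    also have "2 * (\<integral>\<^sup>+y. ennreal ((F' k y - F k y)\<^sup>2) \<partial>P) \<le> ennreal (2 * C) * (\<integral>\<^sup>+t. ennreal ((g k t - f t)\<^sup>2) \<partial>L)"
    proof -
      have "(\<integral>\<^sup>+y. ennreal ((F' k y - F k y)\<^sup>2) \<partial>P) \<le> ennreal (C * (\<integral>t. (g' k t - g k t)\<^sup>2 \<partial>L))"
        unfolding F_def F'_def g_def g'_def C_def by (rule step_integral_diff_bound[OF v v])
      also have "\<dots> \<le> ennreal (C * (\<integral>t. (g k t - f t)\<^sup>2 \<partial>L))"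
        by (intro ennreal_leI mult_left_mono C integral_mono' gi) (use d1 in auto)
      also have "\<dots> = ennreal C * (\<integral>\<^sup>+t. ennreal ((g k t - f t)\<^sup>2) \<partial>L)"
        using gi C by (simp add: nn_integral_eq_integral ennreal_mult')
      finally have "2 * (\<integral>\<^sup>+y. ennreal ((F' k y - F k y)\<^sup>2) \<partial>P) \<le> 2 * (ennreal C * (\<integral>\<^sup>+t. ennreal ((g k t - f t)\<^sup>2) \<partial>L))"
        by (rule mult_left_mono) simp
      then show ?thesis using C by (simp add: ennreal_mult' mult.assoc)
    qed
    finally show ?thesis by (simp add: add_right_mono)
  qed
  have l2: "(\<lambda>k. \<integral>\<^sup>+y. ennreal ((F' k y - X y)\<^sup>2) \<partial>P) \<longlonglongrightarrow> 0"
  proof (rule tendsto_sandwich[OF _ _ tendsto_const])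
    show "(\<lambda>k. ennreal (2 * C) * (\<integral>\<^sup>+t. ennreal ((g k t - f t)\<^sup>2) \<partial>L) + 2 * (\<integral>\<^sup>+y. ennreal ((F k y - X y)\<^sup>2) \<partial>P)) \<longlonglongrightarrow> 0"
      using tendsto_add[OF ennreal_tendsto_cmult[OF _ lf', of "ennreal (2 * C)"] ennreal_tendsto_cmult[OF _ lX', of 2]]
      by simp
  qed (use bd in auto)
  have b: "\<bar>g' k t\<bar> \<le> c" for k t unfolding gg clip_def using c0 by auto
  show ?thesis
    by (intro exI[of _ m] exI[of _ \<tau>] exI[of _ "\<lambda>k i. clip (a k i)"] conjI allI v)
      (use b l1 l2 in \<open>auto simp: g'_def F'_def\<close>)
qed

text \<open>Clamped step functions satisfy both bounds by \<open>steps_forms_bound\<close>. Along a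
  common subsequence the left sides are handled by Fatou and the right sides converge by dominated
  convergence, where the uniform bound c is essential.\<close>

lemma stochastic_integrals_bound:
  fixes J :: "nat set" and f :: "nat \<Rightarrow> real \<Rightarrow> real" and x :: "nat \<Rightarrow> real"
  assumes J: "finite J" and f: "\<And>j. j \<in> J \<Longrightarrow> f j \<in> borel_measurable L"
    and c: "\<And>j t. j \<in> J \<Longrightarrow> t \<in> {0..T} \<Longrightarrow> \<bar>f j t\<bar> \<le> c"
    and X: "\<And>j. j \<in> J \<Longrightarrow> has_stochastic_integral P T (f j) (X j)"
  defines "Z \<equiv> \<lambda>j y. X j y - (\<integral>t. f j t * S t \<partial>L)"
  shows "(\<integral>\<^sup>+y. ennreal ((\<Sum>j\<in>J. x j * Z j y)\<^sup>2) \<partial>P) \<le> ennreal (s * (\<integral>t. (\<Sum>j\<in>J. x j * f j t)\<^sup>2 \<partial>L))" (is ?lin)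
    and "(\<integral>\<^sup>+y. ennreal ((\<Sum>j\<in>J. x j * ((Z j y)\<^sup>2 - s * (\<integral>t. (f j t)\<^sup>2 \<partial>L)))\<^sup>2) \<partial>P)
       \<le> ennreal (2 * s\<^sup>2 * (\<Sum>j\<in>J. \<Sum>i\<in>J. x j * x i * (\<integral>t. f j t * f i t \<partial>L)\<^sup>2)
           + q * (\<integral>t. (\<Sum>j\<in>J. x j * (f j t)\<^sup>2)\<^sup>2 \<partial>L))" (is ?quad)
proof -
  define R where "R = (\<lambda>j m \<tau> a. (\<forall>k::nat. valid (m k) (\<tau> k) \<and> (\<forall>t. \<bar>step_function (m k) (\<tau> k) (a k) t\<bar> \<le> c)) \<and>
    (\<lambda>k. \<integral>\<^sup>+t. ennreal ((step_function (m k) (\<tau> k) (a k) t - f j t)\<^sup>2) \<partial>L) \<longlonglongrightarrow> 0 \<and>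
    (\<lambda>k. \<integral>\<^sup>+y. ennreal ((step_integral (m k) (\<tau> k) (a k) y - X j y)\<^sup>2) \<partial>P) \<longlonglongrightarrow> 0)"
  define good where "good = (\<lambda>j z. R j (fst z) (fst (snd z)) (snd (snd z)))"
  have "\<forall>j\<in>J. \<exists>z. good j z"
  proof
    fix j assume j: "j \<in> J"
    have "\<exists>m \<tau> a. R j m \<tau> a"
      unfolding R_def by (rule clipped_approximation) (use f c X j in auto)
    then obtain m \<tau> a where "R j m \<tau> a" by (elim exE) (rule that)
    then have "good j (m, \<tau>, a)" by (simp add: good_def)
    then show "\<exists>z. good j z" ..
  qed
  from bchoice[OF this] obtain z where z: "\<forall>j\<in>J. good j (z j)" ..
  define m \<tau> a where "m = (\<lambda>j. fst (z j))" and "\<tau> = (\<lambda>j. fst (snd (z j)))" and "a = (\<lambda>j. snd (snd (z j)))"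
  define g where "g = (\<lambda>k j t. step_function (m j k) (\<tau> j k) (a j k) t)"
  define F where "F = (\<lambda>k j y. step_integral (m j k) (\<tau> j k) (a j k) y)"
  have v: "valid (m j k) (\<tau> j k)" and gb: "\<bar>g k j t\<bar> \<le> c"
    and lg: "(\<lambda>k. \<integral>\<^sup>+t. ennreal ((g k j t - f j t)\<^sup>2) \<partial>L) \<longlonglongrightarrow> 0"
    and lF: "(\<lambda>k. \<integral>\<^sup>+y. ennreal ((F k j y - X j y)\<^sup>2) \<partial>P) \<longlonglongrightarrow> 0" if "j \<in> J" for j k t
    using bspec[OF z that] unfolding good_def R_def m_def \<tau>_def a_def g_def F_def by auto
  have Xm: "X j \<in> borel_measurable P" if "j \<in> J" for j
    using X[OF that] unfolding has_stochastic_integral_def by simp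
  have Fm: "F k j \<in> borel_measurable P" if "j \<in> J" for j k
    unfolding F_def by (rule step_integral_measurable[OF v[OF that]])
  have gm: "g k j \<in> borel_measurable L" for j k
    unfolding g_def by (rule step_function_measurable)
  \<comment> \<open>Two extractions, first for the integrals and then for the integrands: the almost
    sure convergence of the former survives the second extraction, and the L2 convergence of the
    latter survives the first.\<close>
  have "\<exists>r. strict_mono r \<and> (AE y in P. \<forall>j\<in>J. (\<lambda>k. F (r k) j y) \<longlonglongrightarrow> X j y)"
    by (rule L2_AE_subseq[OF J]) (use Fm Xm lF in auto)
  then obtain r1 where r1: "strict_mono r1" "AE y in P. \<forall>j\<in>J. (\<lambda>k. F (r1 k) j y) \<longlonglongrightarrow> X j y" by auto
  have "\<exists>r. strict_mono r \<and> (AE t in L. \<forall>j\<in>J. (\<lambda>k. g (r1 (r k)) j t) \<longlonglongrightarrow> f j t)"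
  proof (rule L2_AE_subseq[OF J, where u="\<lambda>k. g (r1 k)"])
    show "(\<lambda>k. \<integral>\<^sup>+t. ennreal ((g (r1 k) j t - f j t)\<^sup>2) \<partial>L) \<longlonglongrightarrow> 0" if "j \<in> J" for j
      using LIMSEQ_subseq_LIMSEQ[OF lg[OF that] r1(1)] by (simp add: o_def)
  qed (use gm f in auto)
  then obtain r2 where r2: "strict_mono r2" "AE t in L. \<forall>j\<in>J. (\<lambda>k. g (r1 (r2 k)) j t) \<longlonglongrightarrow> f j t" by auto
  define r where "r = (\<lambda>k. r1 (r2 k))"
  have gl: "AE t in L. \<forall>j\<in>J. (\<lambda>k. g (r k) j t) \<longlonglongrightarrow> f j t" using r2 unfolding r_def by simp
  have Fl: "AE y in P. \<forall>j\<in>J. (\<lambda>k. F (r k) j y) \<longlonglongrightarrow> X j y"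
    using r1(2)
  proof eventually_elim
    case (elim y)
    show ?case
    proof
      fix j assume "j \<in> J"
      then have "(\<lambda>k. F (r1 k) j y) \<longlonglongrightarrow> X j y" using elim by simp
      from LIMSEQ_subseq_LIMSEQ[OF this r2(1)] show "(\<lambda>k. F (r k) j y) \<longlonglongrightarrow> X j y"
        by (simp add: o_def r_def)
    qed
  qed
  define Zk where "Zk = (\<lambda>k j y. F (r k) j y - (\<integral>t. g (r k) j t * S t \<partial>L))"
  have S1: "integrable L (\<lambda>t. c * \<bar>S t\<bar>)"
  proof -
    have "integrable L (\<lambda>t. c * S t)"
      by (rule Cauchy_Schwarz_integral(1)[OF _ S_measurable _ S_integrable])
        (auto intro!: bounded_integrable[where B="c\<^sup>2"])
    then have "integrable L (\<lambda>t. \<bar>c * S t\<bar>)" by (rule integrable_abs)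
    then have "integrable L (\<lambda>t. \<bar>c\<bar> * \<bar>S t\<bar>)" by (simp add: abs_mult)
    then show ?thesis by (cases "0 \<le> c") (auto simp: abs_if[of c])
  qed
  have drift: "(\<lambda>k. \<integral>t. g (r k) j t * S t \<partial>L) \<longlonglongrightarrow> (\<integral>t. f j t * S t \<partial>L)" if j: "j \<in> J" for j
  proof (rule integral_dominated_convergence[OF _ _ S1])
    show "(\<lambda>t. f j t * S t) \<in> borel_measurable L" using f[OF j] S_measurable by measurable
    show "(\<lambda>t. g (r k) j t * S t) \<in> borel_measurable L" for k using gm S_measurable by measurable
    show "AE t in L. (\<lambda>k. g (r k) j t * S t) \<longlonglongrightarrow> f j t * S t"
      using gl by eventually_elim (use j in \<open>auto intro!: tendsto_intros\<close>)
    show "AE t in L. norm (g (r k) j t * S t) \<le> c * \<bar>S t\<bar>" for k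
      using gb[OF j] by (intro AE_I2) (auto simp: abs_mult intro!: mult_right_mono)
  qed
  have Zl: "AE y in P. \<forall>j\<in>J. (\<lambda>k. Zk k j y) \<longlonglongrightarrow> Z j y"
    using Fl by eventually_elim (auto simp: Zk_def Z_def intro!: tendsto_diff drift)
  have Zm: "Zk k j \<in> borel_measurable P" if "j \<in> J" for k j
    unfolding Zk_def using Fm[OF that] by measurable
  have Zc: "Zk k j = centred (m j (r k)) (\<tau> j (r k)) (a j (r k))" for k j
    unfolding Zk_def centred_def F_def g_def by auto
  have prodl: "(\<lambda>k. \<integral>t. g (r k) j t * g (r k) i t \<partial>L) \<longlonglongrightarrow> (\<integral>t. f j t * f i t \<partial>L)" if ji: "j \<in> J" "i \<in> J" for i j
  proof (rule bounded_convergence[where B="c * c"])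
    show "(\<lambda>t. g (r k) j t * g (r k) i t) \<in> borel_measurable L" for k using gm by measurable
    show "(\<lambda>t. f j t * f i t) \<in> borel_measurable L" using f ji by measurable
    show "AE t in L. (\<lambda>k. g (r k) j t * g (r k) i t) \<longlonglongrightarrow> f j t * f i t"
      using gl by eventually_elim (use ji in \<open>auto intro!: tendsto_intros\<close>)
    show "\<bar>g (r k) j t * g (r k) i t\<bar> \<le> c * c" for k t
      unfolding abs_mult by (intro mult_mono gb ji) (use gb[OF ji(1), of 0 0] in auto)
  qed
  have sq2: "(\<lambda>k. \<integral>t. (g (r k) j t)\<^sup>2 \<partial>L) \<longlonglongrightarrow> (\<integral>t. (f j t)\<^sup>2 \<partial>L)" if "j \<in> J" for j
    using prodl[OF that that] by (simp add: power2_eq_square)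
  show ?lin
  proof (rule nn_integral_square_le_limit)
    show "(\<lambda>y. \<Sum>j\<in>J. x j * Zk k j y) \<in> borel_measurable P" for k
      by (intro borel_measurable_sum borel_measurable_times borel_measurable_const Zm)
    show "AE y in P. (\<lambda>k. \<Sum>j\<in>J. x j * Zk k j y) \<longlonglongrightarrow> (\<Sum>j\<in>J. x j * Z j y)"
      using Zl by eventually_elim (auto intro!: tendsto_intros)
    show "(\<integral>\<^sup>+y. ennreal ((\<Sum>j\<in>J. x j * Zk k j y)\<^sup>2) \<partial>P) \<le> ennreal (s * (\<integral>t. (\<Sum>j\<in>J. x j * g (r k) j t)\<^sup>2 \<partial>L))" for k
      unfolding Zc g_def by (rule steps_forms_bound(1)[OF J v])
    have "(\<lambda>k. \<integral>t. (\<Sum>j\<in>J. x j * g (r k) j t)\<^sup>2 \<partial>L) \<longlonglongrightarrow> (\<integral>t. (\<Sum>j\<in>J. x j * f j t)\<^sup>2 \<partial>L)"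
    proof (rule bounded_convergence[where B="(\<Sum>j\<in>J. \<bar>x j\<bar> * c)\<^sup>2"])
      show "(\<lambda>t. (\<Sum>j\<in>J. x j * g (r k) j t)\<^sup>2) \<in> borel_measurable L" for k using gm by measurable
      show "(\<lambda>t. (\<Sum>j\<in>J. x j * f j t)\<^sup>2) \<in> borel_measurable L"
        by (intro borel_measurable_power borel_measurable_sum borel_measurable_times borel_measurable_const f)
      show "AE t in L. (\<lambda>k. (\<Sum>j\<in>J. x j * g (r k) j t)\<^sup>2) \<longlonglongrightarrow> (\<Sum>j\<in>J. x j * f j t)\<^sup>2"
        using gl by eventually_elim (auto intro!: tendsto_intros)
      show "\<bar>(\<Sum>j\<in>J. x j * g (r k) j t)\<^sup>2\<bar> \<le> (\<Sum>j\<in>J. \<bar>x j\<bar> * c)\<^sup>2" for k t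
      proof -
        have "\<bar>\<Sum>j\<in>J. x j * g (r k) j t\<bar> \<le> (\<Sum>j\<in>J. \<bar>x j\<bar> * c)"
          by (rule order_trans[OF sum_abs sum_mono]) (auto simp: abs_mult intro!: mult_left_mono gb)
        from power_mono[OF this, of 2] show ?thesis by simp
      qed
    qed
    then show "(\<lambda>k. s * (\<integral>t. (\<Sum>j\<in>J. x j * g (r k) j t)\<^sup>2 \<partial>L)) \<longlonglongrightarrow> s * (\<integral>t. (\<Sum>j\<in>J. x j * f j t)\<^sup>2 \<partial>L)"
      by (intro tendsto_intros)
  qed
  show ?quad
  proof (rule nn_integral_square_le_limit)
    show "(\<lambda>y. \<Sum>j\<in>J. x j * ((Zk k j y)\<^sup>2 - s * (\<integral>t. (g (r k) j t)\<^sup>2 \<partial>L))) \<in> borel_measurable P" for k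
      by (intro borel_measurable_sum borel_measurable_times borel_measurable_const borel_measurable_diff borel_measurable_power Zm)
    show "AE y in P. (\<lambda>k. \<Sum>j\<in>J. x j * ((Zk k j y)\<^sup>2 - s * (\<integral>t. (g (r k) j t)\<^sup>2 \<partial>L)))
        \<longlonglongrightarrow> (\<Sum>j\<in>J. x j * ((Z j y)\<^sup>2 - s * (\<integral>t. (f j t)\<^sup>2 \<partial>L)))"
      using Zl by eventually_elim (auto intro!: tendsto_intros sq2)
    show "(\<integral>\<^sup>+y. ennreal ((\<Sum>j\<in>J. x j * ((Zk k j y)\<^sup>2 - s * (\<integral>t. (g (r k) j t)\<^sup>2 \<partial>L)))\<^sup>2) \<partial>P)
       \<le> ennreal (2 * s\<^sup>2 * (\<Sum>j\<in>J. \<Sum>i\<in>J. x j * x i * (\<integral>t. g (r k) j t * g (r k) i t \<partial>L)\<^sup>2)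
           + q * (\<integral>t. (\<Sum>j\<in>J. x j * (g (r k) j t)\<^sup>2)\<^sup>2 \<partial>L))" for k
      unfolding Zc g_def by (rule steps_forms_bound(2)[OF J v])
    have quart: "(\<lambda>k. \<integral>t. (\<Sum>j\<in>J. x j * (g (r k) j t)\<^sup>2)\<^sup>2 \<partial>L) \<longlonglongrightarrow> (\<integral>t. (\<Sum>j\<in>J. x j * (f j t)\<^sup>2)\<^sup>2 \<partial>L)"
    proof (rule bounded_convergence[where B="(\<Sum>j\<in>J. \<bar>x j\<bar> * c\<^sup>2)\<^sup>2"])
      show "(\<lambda>t. (\<Sum>j\<in>J. x j * (g (r k) j t)\<^sup>2)\<^sup>2) \<in> borel_measurable L" for k using gm by measurable
      show "(\<lambda>t. (\<Sum>j\<in>J. x j * (f j t)\<^sup>2)\<^sup>2) \<in> borel_measurable L"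
        by (intro borel_measurable_power borel_measurable_sum borel_measurable_times borel_measurable_const f)
      show "AE t in L. (\<lambda>k. (\<Sum>j\<in>J. x j * (g (r k) j t)\<^sup>2)\<^sup>2) \<longlonglongrightarrow> (\<Sum>j\<in>J. x j * (f j t)\<^sup>2)\<^sup>2"
        using gl by eventually_elim (auto intro!: tendsto_intros)
      show "\<bar>(\<Sum>j\<in>J. x j * (g (r k) j t)\<^sup>2)\<^sup>2\<bar> \<le> (\<Sum>j\<in>J. \<bar>x j\<bar> * c\<^sup>2)\<^sup>2" for k t
      proof -
        have g2: "(g (r k) j t)\<^sup>2 \<le> c\<^sup>2" if "j \<in> J" for j
        proof -
          have "\<bar>g (r k) j t\<bar>\<^sup>2 \<le> c\<^sup>2" by (rule power_mono[OF gb[OF that]]) simp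
          then show ?thesis by simp
        qed
        have "\<bar>\<Sum>j\<in>J. x j * (g (r k) j t)\<^sup>2\<bar> \<le> (\<Sum>j\<in>J. \<bar>x j\<bar> * c\<^sup>2)"
          by (rule order_trans[OF sum_abs sum_mono]) (auto simp: abs_mult intro!: mult_left_mono g2)
        from power_mono[OF this, of 2] show ?thesis by simp
      qed
    qed
    show "(\<lambda>k. 2 * s\<^sup>2 * (\<Sum>j\<in>J. \<Sum>i\<in>J. x j * x i * (\<integral>t. g (r k) j t * g (r k) i t \<partial>L)\<^sup>2)
           + q * (\<integral>t. (\<Sum>j\<in>J. x j * (g (r k) j t)\<^sup>2)\<^sup>2 \<partial>L)) \<longlonglongrightarrow>
        2 * s\<^sup>2 * (\<Sum>j\<in>J. \<Sum>i\<in>J. x j * x i * (\<integral>t. f j t * f i t \<partial>L)\<^sup>2)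
           + q * (\<integral>t. (\<Sum>j\<in>J. x j * (f j t)\<^sup>2)\<^sup>2 \<partial>L)"
      by (intro tendsto_add tendsto_mult tendsto_const tendsto_sum tendsto_power prodl quart)
  qed
qed

end

section \<open>The law of the observations\<close>

lemma cadlag_continuous:
  assumes "continuous_on {0..T} f"
  shows "cadlag T f"
  unfolding cadlag_def
proof (intro conjI ballI)
  have lim: "(f \<longlongrightarrow> f t) (at t within {0..T})" if "t \<in> {0..T}" for t
    using assms that by (simp add: continuous_on_def)
  show "(f \<longlongrightarrow> f t) (at_right t)" if "t \<in> {0..<T}" for t
    using tendsto_within_subset[OF lim, of t "{t..T}"] that by (simp add: at_within_Icc_at_right)
  show "\<exists>l. (f \<longlongrightarrow> l) (at_left t)" if "t \<in> {0<..T}" for t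
    using tendsto_within_subset[OF lim, of t "{0..t}"] that by (auto simp: at_within_Icc_at_left)
qed

lemma cadlag_linear:
  assumes "cadlag T x" "cadlag T y"
  shows "cadlag T (\<lambda>t. a * x t + b * y t)"
  unfolding cadlag_def
proof (intro conjI ballI)
  show "((\<lambda>t. a * x t + b * y t) \<longlongrightarrow> a * x t + b * y t) (at_right t)" if "t \<in> {0..<T}" for t
    using assms that unfolding cadlag_def by (intro tendsto_intros) auto
  show "\<exists>l. ((\<lambda>t. a * x t + b * y t) \<longlongrightarrow> l) (at_left t)" if "t \<in> {0<..T}" for t
  proof -
    have "\<exists>l. (x \<longlongrightarrow> l) (at_left t)" "\<exists>l. (y \<longlongrightarrow> l) (at_left t)"
      using assms that unfolding cadlag_def by auto
    then obtain l l' where "(x \<longlongrightarrow> l) (at_left t)" "(y \<longlongrightarrow> l') (at_left t)"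
      by (elim exE) (rule that)
    then have "((\<lambda>t. a * x t + b * y t) \<longlongrightarrow> a * l + b * l') (at_left t)" by (intro tendsto_intros)
    then show ?thesis ..
  qed
qed

text \<open>Restriction changes values only outside [0,T], while right limits are taken before T and
  left limits after 0, so near each relevant point nothing changes.\<close>

lemma cadlag_restrict:
  assumes "cadlag T x"
  shows "cadlag T (\<lambda>t\<in>{0..T}. x t)"
  unfolding cadlag_def
proof (intro conjI ballI)
  fix t assume t: "t \<in> {0..<T}"
  have "\<forall>\<^sub>F u in at_right t. x u = (\<lambda>t\<in>{0..T}. x t) u"
    using eventually_at_right_real[of t T] t by (auto elim!: eventually_mono)
  moreover have "(x \<longlongrightarrow> x t) (at_right t)" using assms t unfolding cadlag_def by auto
  ultimately have "((\<lambda>t\<in>{0..T}. x t) \<longlongrightarrow> x t) (at_right t)" by (rule Lim_transform_eventually[rotated])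
  then show "((\<lambda>t\<in>{0..T}. x t) \<longlongrightarrow> (\<lambda>t\<in>{0..T}. x t) t) (at_right t)" using t by simp
next
  fix t assume t: "t \<in> {0<..T}"
  have "\<forall>\<^sub>F u in at_left t. x u = (\<lambda>t\<in>{0..T}. x t) u"
    using eventually_at_left_real[of 0 t] t by (auto elim!: eventually_mono)
  moreover have "\<exists>l. (x \<longlongrightarrow> l) (at_left t)" using assms t unfolding cadlag_def by auto
  then obtain l where "(x \<longlongrightarrow> l) (at_left t)" ..
  ultimately have "((\<lambda>t\<in>{0..T}. x t) \<longlongrightarrow> l) (at_left t)" by (rule Lim_transform_eventually[rotated])
  then show "\<exists>l. ((\<lambda>t\<in>{0..T}. x t) \<longlongrightarrow> l) (at_left t)" ..
qed

lemma measurable_skorokhod: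
  assumes "\<And>t. t \<in> {0..T} \<Longrightarrow> (\<lambda>\<omega>. Y t \<omega>) \<in> borel_measurable M"
    and "\<And>\<omega>. \<omega> \<in> space M \<Longrightarrow> cadlag T (\<lambda>t. Y t \<omega>)"
  shows "(\<lambda>\<omega>. \<lambda>t\<in>{0..T}. Y t \<omega>) \<in> measurable M (skorokhod T)"
  unfolding skorokhod_def
proof (rule measurable_restrict_space2)
  show "(\<lambda>\<omega>. \<lambda>t\<in>{0..T}. Y t \<omega>) \<in> space M \<rightarrow> {x. cadlag T x}"
    using cadlag_restrict[OF assms(2)] by auto
  show "(\<lambda>\<omega>. \<lambda>t\<in>{0..T}. Y t \<omega>) \<in> measurable M (Pi\<^sub>M {0..T} (\<lambda>_. borel))"
    by (rule measurable_restrict) (rule assms(1))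
qed

lemma coordinate_skorokhod: "t \<in> {0..T} \<Longrightarrow> (\<lambda>y. y t) \<in> borel_measurable (skorokhod T)"
  unfolding skorokhod_def by (rule measurable_restrict_space1[OF measurable_component_singleton])

lemma cadlag_skorokhod: "y \<in> space (skorokhod T) \<Longrightarrow> cadlag T y"
  unfolding skorokhod_def by (simp add: space_restrict_space)

lemma forms_bound_distr:
  assumes V: "V \<in> measurable M N" and D: "\<And>k. k < K \<Longrightarrow> D k \<in> borel_measurable N"
    and fb: "forms_bound M K h s q (\<lambda>k \<omega>. D k (V \<omega>))"
  shows "forms_bound (distr M N V) K h s q D"
  unfolding forms_bound_def
proof (intro conjI allI impI)
  have m: "(\<lambda>y. \<Sum>k<K. a k * D k y) \<in> borel_measurable N" for a
    using D by (intro borel_measurable_sum borel_measurable_times borel_measurable_const) auto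
  show "(\<integral>\<^sup>+y. ennreal ((\<Sum>k<K. a k * D k y)\<^sup>2) \<partial>distr M N V) \<le> ennreal (s * (\<Sum>k<K. (a k)\<^sup>2 * h k))" for a
    using fb m[of a] unfolding forms_bound_def by (subst nn_integral_distr[OF V]) auto
  fix J :: "nat set" and x :: "nat \<Rightarrow> real" and a assume J: "finite J"
  have m2: "(\<lambda>y. ennreal ((\<Sum>j\<in>J. x j * ((\<Sum>k<K. a j k * D k y)\<^sup>2 - s * (\<Sum>k<K. (a j k)\<^sup>2 * h k)))\<^sup>2)) \<in> borel_measurable N"
    by (intro measurable_compose[OF _ measurable_ennreal] borel_measurable_power borel_measurable_sum[of J] borel_measurable_times borel_measurable_const borel_measurable_diff m)
  show "(\<integral>\<^sup>+y. ennreal ((\<Sum>j\<in>J. x j * ((\<Sum>k<K. a j k * D k y)\<^sup>2 - s * (\<Sum>k<K. (a j k)\<^sup>2 * h k)))\<^sup>2) \<partial>distr M N V)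
        \<le> ennreal (2 * s\<^sup>2 * (\<Sum>j\<in>J. \<Sum>i\<in>J. x j * x i * (\<Sum>k<K. a j k * a i k * h k)\<^sup>2)
             + q * (\<Sum>k<K. (\<Sum>j\<in>J. x j * (a j k)\<^sup>2)\<^sup>2 * h k))"
    using fb J m2 unfolding forms_bound_def by (subst nn_integral_distr[OF V]) auto
qed

lemma forms_bound_cong:
  assumes "\<And>k \<omega>. k < K \<Longrightarrow> D k \<omega> = D' k \<omega>"
  shows "forms_bound M K h s q D \<longleftrightarrow> forms_bound M K h s q D'"
proof -
  have "(\<Sum>k<K. a k * D k \<omega>) = (\<Sum>k<K. a k * D' k \<omega>)" for a \<omega>
    using assms by (intro sum.cong) auto
  then show ?thesis unfolding forms_bound_def by (simp only:)
qed

text \<open>Continuity keeps the observed path cadlag after the drift is added; the second part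
  matches the increments of the drift with the centring in the locale
  \<open>observed\<close>.\<close>

lemma primitive:
  fixes S :: "real \<Rightarrow> real"
  assumes S: "integrable (lebesgue_on {0..T}) S"
  shows "continuous_on {0..T} (\<lambda>t. \<integral>u. S u \<partial>lebesgue_on {0..t})"
    and "\<And>a b. 0 \<le> a \<Longrightarrow> a \<le> b \<Longrightarrow> b \<le> T \<Longrightarrow> (\<integral>u. S u \<partial>lebesgue_on {0..b}) - (\<integral>u. S u \<partial>lebesgue_on {0..a})
       = (\<integral>u. indicator {a<..b} u * S u \<partial>lebesgue_on {0..T})"
proof -
  have S': "integrable lebesgue (\<lambda>u. indicator {0..T} u * S u)"
    using S by (subst (asm) integrable_restrict_space) auto
  have St: "integrable lebesgue (\<lambda>u. indicator {0..t} u * S u)" if "t \<le> T" for t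
  proof -
    have "integrable lebesgue (\<lambda>u. indicator {0..t} u *\<^sub>R (indicator {0..T} u * S u))"
      by (rule integrable_mult_indicator[OF _ S']) simp
    moreover have "indicator {0..t} u *\<^sub>R (indicator {0..T} u * S u) = indicator {0..t} u * S u" for u
      using that by (auto simp: indicator_def)
    ultimately show ?thesis by (simp only:)
  qed
  have I: "(\<integral>u. S u \<partial>lebesgue_on {0..t}) = (\<integral>u. indicator {0..t} u * S u \<partial>lebesgue)" for t
    by (subst integral_restrict_space) auto
  have "(\<integral>u. S u \<partial>lebesgue_on {0..t}) = integral {0..t} S" if "t \<le> T" for t
  proof (rule lebesgue_integral_eq_integral)
    show "integrable (lebesgue_on {0..t}) S" using St[OF that] by (subst integrable_restrict_space) auto
  qed simp
  moreover have "continuous_on {0..T} (\<lambda>t. integral {0..t} S)"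
    by (rule indefinite_integral_continuous_1[OF integrable_on_lebesgue_on[OF S]]) simp
  ultimately show "continuous_on {0..T} (\<lambda>t. \<integral>u. S u \<partial>lebesgue_on {0..t})"
    by (subst continuous_on_cong[OF refl, where g="\<lambda>t. integral {0..t} S"]) auto
  fix a b :: real assume ab: "0 \<le> a" "a \<le> b" "b \<le> T"
  have "(\<integral>u. S u \<partial>lebesgue_on {0..b}) - (\<integral>u. S u \<partial>lebesgue_on {0..a})
     = (\<integral>u. indicator {0..b} u * S u - indicator {0..a} u * S u \<partial>lebesgue)"
    unfolding I by (rule Bochner_Integration.integral_diff[symmetric]; rule St) (use ab in auto)
  also have "\<dots> = (\<integral>u. indicator {0..T} u *\<^sub>R (indicator {a<..b} u * S u) \<partial>lebesgue)"
    by (intro Bochner_Integration.integral_cong refl) (use ab in \<open>auto simp: indicator_def\<close>)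
  also have "\<dots> = (\<integral>u. indicator {a<..b} u * S u \<partial>lebesgue_on {0..T})"
    by (rule integral_restrict_space[symmetric]) simp
  finally show "(\<integral>u. S u \<partial>lebesgue_on {0..b}) - (\<integral>u. S u \<partial>lebesgue_on {0..a})
       = (\<integral>u. indicator {a<..b} u * S u \<partial>lebesgue_on {0..T})" .
qed

text \<open>The law of the observations is the image of \<open>M\<close> under \<open>V\<close>,
  which forms the noise path, followed by \<open>B\<close>, which adds the drift. The centred
  increments of the image path are the noise increments, so \<open>increments_forms_bound\<close>
  can be pulled through the image measure.\<close>

theorem observed_law:
  assumes lv: "levy_measure \<nu>" and Q: "noise_law \<nu> T \<sigma>\<^sub>1 \<sigma>\<^sub>2 Q" and T: "0 < T"
    and Sm: "S \<in> borel_measurable (lebesgue_on {0..T})" and S2: "integrable (lebesgue_on {0..T}) (\<lambda>t. (S t)\<^sup>2)"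
  shows "observed (observation_law T Q S) T (\<sigma>\<^sub>1\<^sup>2 + \<sigma>\<^sub>2\<^sup>2) (\<sigma>\<^sub>2 ^ 4 * (\<integral>x. x ^ 4 \<partial>\<nu>)) S"
proof -
  have S1: "integrable (lebesgue_on {0..T}) S"
  proof -
    have "integrable (lebesgue_on {0..T}) (\<lambda>t. 1 * S t)"
      by (rule Cauchy_Schwarz_integral(1)[OF _ Sm _ S2]) (auto intro!: finite_measure.integrable_const finite_measureI simp: emeasure_restrict_space T less_imp_le)
    then show ?thesis by simp
  qed
  from Q obtain M :: "sample measure" and w \<mu> z where M: "prob_space M" "brownian_motion M w"
    "poisson_random_measure M (jump_compensator \<nu>) \<mu>" "independent_bm_prm M w (jump_compensator \<nu>) \<mu>"
    and z: "\<forall>t\<in>{0..T}. compensated_jump_integral M \<nu> \<mu> t (z t)"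
    and zc: "\<forall>\<omega>\<in>space M. cadlag T (\<lambda>t. z t \<omega>)"
    and Qd: "Q = distr M (skorokhod T) (\<lambda>\<omega>. \<lambda>t\<in>{0..T}. \<sigma>\<^sub>1 * w t \<omega> + \<sigma>\<^sub>2 * z t \<omega>)"
    unfolding noise_law_def by (elim exE conjE) (rule that)
  interpret prob_space M by fact
  interpret driving_noise M \<nu> w \<mu>
    by unfold_locales (use M lv in auto)
  define A where "A = (\<lambda>t. \<integral>u. S u \<partial>lebesgue_on {0..t})"
  define V where "V = (\<lambda>\<omega>. \<lambda>t\<in>{0..T}. \<sigma>\<^sub>1 * w t \<omega> + \<sigma>\<^sub>2 * z t \<omega>)"
  define B where "B = (\<lambda>x. \<lambda>t\<in>{0..T}. A t + x t)"
  have zm: "z t \<in> borel_measurable M" if "t \<in> {0..T}" for t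
    using bspec[OF z that] unfolding compensated_jump_integral_def by simp
  have Vm: "V \<in> measurable M (skorokhod T)"
    unfolding V_def
  proof (rule measurable_skorokhod)
    show "(\<lambda>\<omega>. \<sigma>\<^sub>1 * w t \<omega> + \<sigma>\<^sub>2 * z t \<omega>) \<in> borel_measurable M" if "t \<in> {0..T}" for t
      using w_measurable[of t] zm[OF that] that by auto
    show "cadlag T (\<lambda>t. \<sigma>\<^sub>1 * w t \<omega> + \<sigma>\<^sub>2 * z t \<omega>)" if w: "\<omega> \<in> space M" for \<omega>
    proof (rule cadlag_linear)
      have "continuous_on {0..} (\<lambda>t. w t \<omega>)" using M(2) w unfolding brownian_motion_def by blast
      then show "cadlag T (\<lambda>t. w t \<omega>)" by (intro cadlag_continuous) (rule continuous_on_subset, auto)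
      show "cadlag T (\<lambda>t. z t \<omega>)" using zc w by blast
    qed
  qed
  have Bm: "B \<in> measurable (skorokhod T) (skorokhod T)"
    unfolding B_def
  proof (rule measurable_skorokhod)
    show "(\<lambda>x. A t + x t) \<in> borel_measurable (skorokhod T)" if "t \<in> {0..T}" for t
      using coordinate_skorokhod[OF that] by measurable
    show "cadlag T (\<lambda>t. A t + x t)" if "x \<in> space (skorokhod T)" for x
    proof -
      have "cadlag T A" unfolding A_def by (rule cadlag_continuous[OF primitive(1)[OF S1]])
      from cadlag_linear[OF this cadlag_skorokhod[OF that], of 1 1] show ?thesis by simp
    qed
  qed
  have B': "B = (\<lambda>x. \<lambda>t\<in>{0..T}. (\<integral>u. S u \<partial>lebesgue_on {0..t}) + x t)"
    by (simp add: B_def A_def)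
  have P: "observation_law T Q S = distr M (skorokhod T) (B \<circ> V)"
    unfolding observation_law_def Qd V_def[symmetric] B'[symmetric]
    by (rule distr_distr[OF Bm Vm])
  have BV: "B \<circ> V \<in> measurable M (skorokhod T)" using Vm Bm by (rule measurable_comp)
  interpret P: prob_space "observation_law T Q S"
    unfolding P by (rule prob_space_distr[OF BV])
  show "observed (observation_law T Q S) T (\<sigma>\<^sub>1\<^sup>2 + \<sigma>\<^sub>2\<^sup>2) (\<sigma>\<^sub>2 ^ 4 * (\<integral>x. x ^ 4 \<partial>\<nu>)) S"
  proof unfold_locales
    show "0 < T" "0 \<le> \<sigma>\<^sub>1\<^sup>2 + \<sigma>\<^sub>2\<^sup>2" "0 \<le> \<sigma>\<^sub>2 ^ 4 * (\<integral>x. x ^ 4 \<partial>\<nu>)" using T by auto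
    show "S \<in> borel_measurable (lebesgue_on {0..T})" "integrable (lebesgue_on {0..T}) (\<lambda>t. (S t)\<^sup>2)" by fact+
    show "(\<lambda>y. y t) \<in> borel_measurable (observation_law T Q S)" if "0 \<le> t" "t \<le> T" for t
      unfolding P using coordinate_skorokhod[of t T] that by simp
    fix K :: nat and p :: "nat \<Rightarrow> real"
    assume p: "0 \<le> p 0" "\<And>k. k < K \<Longrightarrow> p k < p (Suc k)" "p K \<le> T"
    have pmono: "i \<le> j \<Longrightarrow> j \<le> K \<Longrightarrow> p i \<le> p j" for i j
    proof (induction j)
      case (Suc j) then show ?case using p(2)[of j] by (cases "i = Suc j") auto
    qed simp
    have pn: "0 \<le> p k" "p k \<le> T" if "k \<le> K" for k using pmono[of 0 k] pmono[of k K] p that by auto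
    show "forms_bound (observation_law T Q S) K (\<lambda>k. p (Suc k) - p k) (\<sigma>\<^sub>1\<^sup>2 + \<sigma>\<^sub>2\<^sup>2) (\<sigma>\<^sub>2 ^ 4 * (\<integral>x. x ^ 4 \<partial>\<nu>))
      (\<lambda>k y. y (p (Suc k)) - y (p k) - (\<integral>t. indicator {p k<..p (Suc k)} t * S t \<partial>lebesgue_on {0..T}))"
      unfolding P
    proof (rule forms_bound_distr[OF BV])
      show "(\<lambda>y. y (p (Suc k)) - y (p k) - (\<integral>t. indicator {p k<..p (Suc k)} t * S t \<partial>lebesgue_on {0..T})) \<in> borel_measurable (skorokhod T)"
        if "k < K" for k
        using pn[of k] pn[of "Suc k"] that
        by (intro borel_measurable_diff coordinate_skorokhod borel_measurable_const) auto
      have eq: "(B \<circ> V) \<omega> (p (Suc k)) - (B \<circ> V) \<omega> (p k) - (\<integral>t. indicator {p k<..p (Suc k)} t * S t \<partial>lebesgue_on {0..T})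
        = \<sigma>\<^sub>1 * (w (p (Suc k)) \<omega> - w (p k) \<omega>) + \<sigma>\<^sub>2 * (z (p (Suc k)) \<omega> - z (p k) \<omega>)" if "k < K" for k \<omega>
      proof -
        have "A (p (Suc k)) - A (p k) = (\<integral>t. indicator {p k<..p (Suc k)} t * S t \<partial>lebesgue_on {0..T})"
          unfolding A_def by (rule primitive(2)[OF S1]) (use pn[of k] pn[of "Suc k"] p(2)[of k] that in auto)
        then show ?thesis
          unfolding B_def V_def using pn[of k] pn[of "Suc k"] that by (simp add: algebra_simps)
      qed
      have "forms_bound M K (\<lambda>k. p (Suc k) - p k) (\<sigma>\<^sub>1\<^sup>2 + \<sigma>\<^sub>2\<^sup>2) (\<sigma>\<^sub>2 ^ 4 * (\<integral>x. x ^ 4 \<partial>\<nu>))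
        (\<lambda>k \<omega>. \<sigma>\<^sub>1 * (w (p (Suc k)) \<omega> - w (p k) \<omega>) + \<sigma>\<^sub>2 * (z (p (Suc k)) \<omega> - z (p k) \<omega>))"
        by (rule increments_forms_bound[OF p(1) p(2) p(3)]) (use z in auto)
      then show "forms_bound M K (\<lambda>k. p (Suc k) - p k) (\<sigma>\<^sub>1\<^sup>2 + \<sigma>\<^sub>2\<^sup>2) (\<sigma>\<^sub>2 ^ 4 * (\<integral>x. x ^ 4 \<partial>\<nu>))
        (\<lambda>k \<omega>. (B \<circ> V) \<omega> (p (Suc k)) - (B \<circ> V) \<omega> (p k) - (\<integral>t. indicator {p k<..p (Suc k)} t * S t \<partial>lebesgue_on {0..T}))"
        by (subst forms_bound_cong[OF eq])
    qed
  qed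
qed

section \<open>Fourier coefficients of the observations\<close>

lemma periodic1_shift: "periodic1 h \<Longrightarrow> h (t + real i) = h t"
proof (induction i)
  case (Suc i)
  then have "h (t + real i + 1) = h (t + real i)" unfolding periodic1_def by blast
  then show ?case using Suc by (simp add: add_ac)
qed simp

text \<open>Translates of [0,1) tile [0,n) without overlap; the end point n is kept as a separate,
  negligible term. Facts known on one period are thereby carried to [0,n].\<close>

lemma periodic_decomposition:
  assumes "periodic1 h"
  shows "indicator {0..real n} t * h t = (\<Sum>i<n. indicator {0..<1} (t - real i) * h (t - real i)) + h (real n) * indicator {real n} t"
proof -
  have "indicator {0..<real n} t * h t = (\<Sum>i<n. indicator {0..<1} (t - real i) * h (t - real i))"
  proof (induction n)
    case (Suc n)
    have "h (t - real n) = h t" using periodic1_shift[OF assms, of "t - real n" n] by simp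
    then have "indicator {0..<real (Suc n)} t * h t = indicator {0..<real n} t * h t + indicator {0..<1} (t - real n) * h (t - real n)"
      by (auto simp: indicator_def)
    then show ?case using Suc by simp
  qed simp
  moreover have "indicator {0..real n} t * h t = indicator {0..<real n} t * h t + h (real n) * indicator {real n} t"
    by (auto simp: indicator_def)
  ultimately show ?thesis by simp
qed

lemma periodic_measurable:
  assumes "periodic1 h" "h \<in> borel_measurable (lebesgue_on {0..1})"
  shows "h \<in> borel_measurable (lebesgue_on {0..real n})"
proof -
  have "(\<lambda>t. if t \<in> {0..1} then h t else 0) \<in> borel_measurable lebesgue"
    by (rule borel_measurable_if_I[OF assms(2)]) simp
  then have "(\<lambda>t. indicator {0..<1} t * (if t \<in> {0..1} then h t else 0)) \<in> borel_measurable lebesgue"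
    by (intro borel_measurable_times borel_measurable_indicator) auto
  moreover have "indicator {0..<1} t * (if t \<in> {0..1} then h t else 0) = indicator {0..<1} t * h t" for t
    by (auto simp: indicator_def)
  ultimately have h0: "(\<lambda>t. indicator {0..<1} t * h t) \<in> borel_measurable lebesgue" by (simp only:)
  have sh: "(\<lambda>t. indicator {0..<1} (t - real i) * h (t - real i)) \<in> borel_measurable lebesgue" for i
    using borel_measurable_affine[OF h0, of 1 "- real i"] by simp
  have "(\<lambda>t. (\<Sum>i<n. indicator {0..<1} (t - real i) * h (t - real i)) + h (real n) * indicator {real n} t) \<in> borel_measurable lebesgue"
    by (rule borel_measurable_add[OF borel_measurable_sum[OF sh]])
      (intro borel_measurable_times borel_measurable_const borel_measurable_indicator, simp)
  then have "(\<lambda>t. indicator {0..real n} t * h t) \<in> borel_measurable lebesgue"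
    unfolding periodic_decomposition[OF assms(1)] .
  then show ?thesis by (subst borel_measurable_restrict_space_iff) auto
qed

lemma periodic_integral:
  assumes per: "periodic1 h" and int: "integrable (lebesgue_on {0..1}) h"
  shows "integrable (lebesgue_on {0..real n}) h"
    and "(\<integral>t. h t \<partial>lebesgue_on {0..real n}) = real n * (\<integral>t. h t \<partial>lebesgue_on {0..1})"
proof -
  define I where "I = (\<integral>t. h t \<partial>lebesgue_on {0..1})"
  have null: "has_bochner_integral lebesgue (\<lambda>t. c * indicator {a} t) 0" for c a :: real
  proof -
    have "has_bochner_integral lebesgue (\<lambda>t. c * indicator {a} t) (c * measure lebesgue {a})"
      by (intro has_bochner_integral_mult_right has_bochner_integral_real_indicator) auto
    then show ?thesis by simp
  qed
  have "has_bochner_integral lebesgue (\<lambda>t. indicator {0..1} t * h t) I"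
    using int unfolding I_def has_bochner_integral_iff
    by (simp add: integrable_restrict_space integral_restrict_space)
  from has_bochner_integral_diff[OF this null[of "h 1" 1]]
  have "has_bochner_integral lebesgue (\<lambda>t. indicator {0..1} t * h t - h 1 * indicator {1} t) I" by simp
  moreover have "indicator {0..1} t * h t - h 1 * indicator {1} t = indicator {0..<1} t * h t" for t :: real
    by (auto simp: indicator_def)
  ultimately have h0: "has_bochner_integral lebesgue (\<lambda>t. indicator {0..<1} t * h t) I" by simp
  have hi: "has_bochner_integral lebesgue (\<lambda>t. indicator {0..<1} (t - real i) * h (t - real i)) I" for i
    using h0 has_bochner_integral_lebesgue_real_affine_iff[of 1 "\<lambda>t. indicator {0..<1} t * h t" I "- real i"] by simp
  have "has_bochner_integral lebesgue (\<lambda>t. (\<Sum>i<n. indicator {0..<1} (t - real i) * h (t - real i)) + h (real n) * indicator {real n} t) ((\<Sum>i<n. I) + 0)"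
    by (intro has_bochner_integral_add has_bochner_integral_sum hi null)
  then have "has_bochner_integral lebesgue (\<lambda>t. indicator {0..real n} t * h t) (real n * I)"
    unfolding periodic_decomposition[OF per] by simp
  then show "integrable (lebesgue_on {0..real n}) h" "(\<integral>t. h t \<partial>lebesgue_on {0..real n}) = real n * I"
    unfolding has_bochner_integral_iff by (simp_all add: integrable_restrict_space integral_restrict_space)
qed

lemma L2_unit_mult: "L2_unit f \<Longrightarrow> L2_unit g \<Longrightarrow> integrable (lebesgue_on {0..1}) (\<lambda>t. f t * g t)"
  unfolding L2_unit_def by (intro Cauchy_Schwarz_integral(1)) auto

lemma periodic1_mult: "periodic1 f \<Longrightarrow> periodic1 g \<Longrightarrow> periodic1 (\<lambda>t. f t * g t)"
  unfolding periodic1_def by simp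

text \<open>Pythagoras: the part of the signal outside the first n basis functions enters every
  estimator's loss as the same nonnegative constant. The second claim, Bessel's inequality, is the
  case where the coefficients are those of the signal.\<close>

lemma norm2_expansion:
  assumes S: "L2_unit S" and \<phi>: "orthonormal_basis_unit \<phi>"
  shows "norm2_unit (\<lambda>t. (\<Sum>j=1..n. a j * \<phi> j t) - S t)
     = (\<Sum>j=1..n. (a j - inner_unit S (\<phi> j))\<^sup>2) + (norm2_unit S - (\<Sum>j=1..n. (inner_unit S (\<phi> j))\<^sup>2))"
    and "(\<Sum>j=1..n. (inner_unit S (\<phi> j))\<^sup>2) \<le> norm2_unit S"
proof -
  have L2: "L2_unit (\<phi> j)" and on: "i \<ge> 1 \<Longrightarrow> inner_unit (\<phi> i) (\<phi> j) = (if i = j then 1 else 0)" if "j \<ge> 1" for i j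
    using \<phi> that unfolding orthonormal_basis_unit_def by auto
  have expand: "norm2_unit (\<lambda>t. (\<Sum>j=1..n. a j * \<phi> j t) - S t)
     = (\<Sum>j=1..n. (a j)\<^sup>2) - 2 * (\<Sum>j=1..n. a j * inner_unit S (\<phi> j)) + norm2_unit S" for a
  proof -
    have sq: "(u - v)\<^sup>2 = u * u - 2 * (v * u) + v\<^sup>2" for u v :: real
      by (simp add: power2_eq_square algebra_simps)
    have iS: "integrable (lebesgue_on {0..1}) (\<lambda>t. (S t)\<^sup>2)" using S unfolding L2_unit_def by simp
    have i1: "integrable (lebesgue_on {0..1}) (\<lambda>t. \<Sum>j=1..n. a j * (S t * \<phi> j t))"
      by (intro Bochner_Integration.integrable_sum integrable_mult_right L2_unit_mult S L2) auto
    have i2: "integrable (lebesgue_on {0..1}) (\<lambda>t. \<Sum>i=1..n. \<Sum>j=1..n. a i * a j * (\<phi> i t * \<phi> j t))"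
      by (intro Bochner_Integration.integrable_sum integrable_mult_right L2_unit_mult L2) auto
    have "norm2_unit (\<lambda>t. (\<Sum>j=1..n. a j * \<phi> j t) - S t)
      = (\<integral>t. (\<Sum>i=1..n. \<Sum>j=1..n. a i * a j * (\<phi> i t * \<phi> j t)) - 2 * (\<Sum>j=1..n. a j * (S t * \<phi> j t)) + (S t)\<^sup>2 \<partial>lebesgue_on {0..1})"
      unfolding norm2_unit_def
    proof (intro Bochner_Integration.integral_cong refl)
      fix t
      have "(\<Sum>i=1..n. \<Sum>j=1..n. a i * a j * (\<phi> i t * \<phi> j t)) = (\<Sum>j=1..n. a j * \<phi> j t) * (\<Sum>j=1..n. a j * \<phi> j t)"
        unfolding sum_product by (intro sum.cong refl) simp
      moreover have "(\<Sum>j=1..n. a j * (S t * \<phi> j t)) = S t * (\<Sum>j=1..n. a j * \<phi> j t)"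
        unfolding sum_distrib_left by (intro sum.cong refl) simp
      ultimately show "((\<Sum>j=1..n. a j * \<phi> j t) - S t)\<^sup>2
        = (\<Sum>i=1..n. \<Sum>j=1..n. a i * a j * (\<phi> i t * \<phi> j t)) - 2 * (\<Sum>j=1..n. a j * (S t * \<phi> j t)) + (S t)\<^sup>2"
        by (simp only: sq)
    qed
    also have "\<dots> = (\<integral>t. (\<Sum>i=1..n. \<Sum>j=1..n. a i * a j * (\<phi> i t * \<phi> j t)) \<partial>lebesgue_on {0..1})
        - 2 * (\<integral>t. (\<Sum>j=1..n. a j * (S t * \<phi> j t)) \<partial>lebesgue_on {0..1}) + norm2_unit S"
      unfolding norm2_unit_def using i1 i2 iS by simp
    also have "(\<integral>t. (\<Sum>j=1..n. a j * (S t * \<phi> j t)) \<partial>lebesgue_on {0..1}) = (\<Sum>j=1..n. a j * inner_unit S (\<phi> j))"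
      unfolding inner_unit_def using L2_unit_mult[OF S L2] by (subst Bochner_Integration.integral_sum) auto
    also have "(\<integral>t. (\<Sum>i=1..n. \<Sum>j=1..n. a i * a j * (\<phi> i t * \<phi> j t)) \<partial>lebesgue_on {0..1})
        = (\<Sum>i=1..n. \<Sum>j=1..n. a i * a j * inner_unit (\<phi> i) (\<phi> j))"
      unfolding inner_unit_def using L2_unit_mult[OF L2 L2]
      by (subst Bochner_Integration.integral_sum, force, intro sum.cong refl, subst Bochner_Integration.integral_sum) auto
    also have "\<dots> = (\<Sum>i=1..n. \<Sum>j=1..n. if i = j then a i * a i else 0)"
      by (intro sum.cong refl) (auto simp: on)
    also have "\<dots> = (\<Sum>j=1..n. (a j)\<^sup>2)"
      by (intro sum.cong refl) (auto simp: power2_eq_square)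
    finally show ?thesis .
  qed
  show "norm2_unit (\<lambda>t. (\<Sum>j=1..n. a j * \<phi> j t) - S t)
     = (\<Sum>j=1..n. (a j - inner_unit S (\<phi> j))\<^sup>2) + (norm2_unit S - (\<Sum>j=1..n. (inner_unit S (\<phi> j))\<^sup>2))"
    unfolding expand by (simp add: power2_diff sum.distrib sum_subtractf sum_distrib_left mult.assoc)
  have "0 \<le> norm2_unit (\<lambda>t. (\<Sum>j=1..n. inner_unit S (\<phi> j) * \<phi> j t) - S t)"
    unfolding norm2_unit_def by simp
  then show "(\<Sum>j=1..n. (inner_unit S (\<phi> j))\<^sup>2) \<le> norm2_unit S"
    unfolding expand by (simp add: power2_eq_square)
qed

lemma sum_abs_power2_le: "(\<Sum>j\<in>J. \<bar>x j\<bar>)\<^sup>2 \<le> real (card J) * (\<Sum>j\<in>J. (x j)\<^sup>2)" for x :: "'a \<Rightarrow> real"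
  using Cauchy_Schwarz_ineq_sum[of "\<lambda>_. 1" "\<lambda>j. \<bar>x j\<bar>" J] by simp

text \<open>By periodicity the basis is orthogonal on [0,n] with squared norm n, so each error has
  second moment at most s / n and the Gram sum reduces to its diagonal. The jump term is a fourth
  order integral controlled by the bound of the basis. For the trigonometric coefficients
  measurability is enough, since the error of \<open>sigma_hat\<close> stays in the final
  inequality.\<close>

theorem coefficient_bounds:
  fixes x :: "nat \<Rightarrow> real"
  assumes lv: "levy_measure \<nu>" and n: "1 \<le> n" and Q: "noise_law \<nu> (real n) \<sigma>\<^sub>1 \<sigma>\<^sub>2 Q"
    and S: "periodic1 S" "L2_unit S"
    and \<phi>: "orthonormal_basis_unit \<phi>" "\<And>j. j \<ge> 1 \<Longrightarrow> periodic1 (\<phi> j)"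
    and b: "\<And>j t. 1 \<le> j \<Longrightarrow> j \<le> n \<Longrightarrow> 0 \<le> t \<Longrightarrow> t \<le> 1 \<Longrightarrow> \<bar>\<phi> j t\<bar> \<le> \<phi>b"
  defines "P \<equiv> observation_law (real n) Q S" and "s \<equiv> \<sigma>\<^sub>1\<^sup>2 + \<sigma>\<^sub>2\<^sup>2"
  defines "e \<equiv> \<lambda>j y. coef_hat P n \<phi> j y - inner_unit S (\<phi> j)"
  shows "\<And>j. 1 \<le> j \<Longrightarrow> j \<le> n \<Longrightarrow> coef_hat P n \<phi> j \<in> borel_measurable P"
    and "coef_hat P n trig j \<in> borel_measurable P"
    and "prob_space P"
    and "(\<integral>\<^sup>+y. ennreal ((\<Sum>j=1..n. x j * e j y)\<^sup>2) \<partial>P) \<le> ennreal (s / real n * (\<Sum>j=1..n. (x j)\<^sup>2))"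
    and "(\<integral>\<^sup>+y. ennreal ((\<Sum>j=1..n. x j * ((e j y)\<^sup>2 - s / real n))\<^sup>2) \<partial>P)
      \<le> ennreal ((2 + (\<integral>x. x ^ 4 \<partial>\<nu>)) * (1 + \<phi>b ^ 4) * (s / real n)\<^sup>2 * (\<Sum>j=1..n. (x j)\<^sup>2))"
proof -
  define N where "N = real n"
  have N: "0 < N" unfolding N_def using n by simp
  have Sm: "S \<in> borel_measurable (lebesgue_on {0..N})"
    unfolding N_def using S by (intro periodic_measurable) (auto simp: L2_unit_def)
  have S2: "integrable (lebesgue_on {0..N}) (\<lambda>t. (S t)\<^sup>2)"
    unfolding N_def
    by (rule periodic_integral(1)) (use S in \<open>auto simp: L2_unit_def periodic1_def\<close>)
  define q where "q = \<sigma>\<^sub>2 ^ 4 * (\<integral>x. x ^ 4 \<partial>\<nu>)"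
  interpret O: observed P N s q S
    unfolding P_def s_def q_def N_def[symmetric]
    by (rule observed_law) (use lv Q N Sm S2 in \<open>auto simp: N_def\<close>)
  show "prob_space P" by unfold_locales
  have L2: "L2_unit (\<phi> j)" and on: "i \<ge> 1 \<Longrightarrow> inner_unit (\<phi> i) (\<phi> j) = (if i = j then 1 else 0)" if "j \<ge> 1" for i j
    using \<phi> that unfolding orthonormal_basis_unit_def by auto
  have \<phi>m: "\<phi> j \<in> borel_measurable O.L" if "j \<ge> 1" for j
    unfolding N_def using \<phi>(2)[OF that] L2[OF that] by (intro periodic_measurable) (auto simp: L2_unit_def)
  \<comment> \<open>The bound is given on [0,1] and extended to the line through the fractional
    part; \<open>periodic1_shift\<close> translates by natural numbers only, hence the two signs of
    t.\<close>
  have \<phi>b: "\<bar>\<phi> j t\<bar> \<le> \<phi>b" if "j \<in> {1..n}" for j t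
  proof -
    have "\<phi> j (frac t) = \<phi> j t"
    proof (cases "0 \<le> t")
      case True
      then have "t = frac t + real (nat \<lfloor>t\<rfloor>)" by (simp add: frac_def)
      then show ?thesis using periodic1_shift[OF \<phi>(2), of j "frac t" "nat \<lfloor>t\<rfloor>"] that by simp
    next
      case False
      then have "frac t = t + real (nat (- \<lfloor>t\<rfloor>))" by (simp add: frac_def)
      then show ?thesis using periodic1_shift[OF \<phi>(2), of j t "nat (- \<lfloor>t\<rfloor>)"] that by simp
    qed
    then show ?thesis using b[of j "frac t"] that frac_lt_1[of t] by (auto simp: less_imp_le)
  qed
  define X where "X = (\<lambda>j. stochastic_integral P N (\<phi> j))"
  have X: "has_stochastic_integral P N (\<phi> j) (X j)" if "j \<in> {1..n}" for j
    unfolding X_def using \<phi>m[of j] \<phi>b[OF that] that by (intro O.stochastic_integral_exists) auto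
  have coef: "coef_hat P n \<phi> j y = X j y / N" for j y
    unfolding coef_hat_def X_def N_def by simp
  show "coef_hat P n \<phi> j \<in> borel_measurable P" if "1 \<le> j" "j \<le> n" for j
    using X[of j] that unfolding coef[abs_def] has_stochastic_integral_def by auto
  show "coef_hat P n trig j \<in> borel_measurable P"
  proof -
    have "has_stochastic_integral P N (trig j) (stochastic_integral P N (trig j))"
    proof (rule O.stochastic_integral_exists)
      have "trig j \<in> borel_measurable borel" unfolding trig_def[abs_def] by simp
      then show "trig j \<in> borel_measurable O.L"
        by (intro measurable_restrict_space1) (rule measurable_completion, simp)
      have "\<bar>sqrt 2 * cos x\<bar> \<le> sqrt 2" "\<bar>sqrt 2 * sin x\<bar> \<le> sqrt 2" "1 \<le> sqrt 2" for x :: real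
        by (auto simp: abs_mult mult_left_le)
      then show "\<bar>trig j t\<bar> \<le> sqrt 2" for t unfolding trig_def by simp
    qed
    then show ?thesis unfolding coef_hat_def[abs_def] has_stochastic_integral_def N_def by auto
  qed
  have ip: "(\<integral>t. \<phi> j t * \<phi> i t \<partial>O.L) = (if j = i then N else 0)" if "j \<ge> 1" "i \<ge> 1" for i j
    using periodic_integral(2)[OF periodic1_mult[OF \<phi>(2) \<phi>(2)] L2_unit_mult[OF L2 L2], of j i n] on[of i j] that
    unfolding inner_unit_def N_def by simp
  have iS: "(\<integral>t. \<phi> j t * S t \<partial>O.L) = N * inner_unit S (\<phi> j)" if "j \<ge> 1" for j
    using periodic_integral(2)[OF periodic1_mult[OF \<phi>(2) S(1)] L2_unit_mult[OF L2 S(2)], of j n] that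
    unfolding inner_unit_def N_def by (simp add: mult.commute)
  define Z where "Z = (\<lambda>j y. X j y - (\<integral>t. \<phi> j t * S t \<partial>O.L))"
  have eZ: "e j y = Z j y / N" if "j \<in> {1..n}" for j y
    unfolding e_def Z_def coef using iS[of j] that N by (simp add: field_simps)
  have sm: "\<And>j. j \<in> {1..n} \<Longrightarrow> \<phi> j \<in> borel_measurable O.L" using \<phi>m by auto
  have sb1: "(\<integral>\<^sup>+y. ennreal ((\<Sum>j=1..n. a j * Z j y)\<^sup>2) \<partial>P) \<le> ennreal (s * (\<integral>t. (\<Sum>j=1..n. a j * \<phi> j t)\<^sup>2 \<partial>O.L))" for a
    unfolding Z_def by (rule O.stochastic_integrals_bound(1)) (use sm \<phi>b X in auto)
  have sb2: "(\<integral>\<^sup>+y. ennreal ((\<Sum>j=1..n. a j * ((Z j y)\<^sup>2 - s * (\<integral>t. (\<phi> j t)\<^sup>2 \<partial>O.L)))\<^sup>2) \<partial>P)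
       \<le> ennreal (2 * s\<^sup>2 * (\<Sum>j=1..n. \<Sum>i=1..n. a j * a i * (\<integral>t. \<phi> j t * \<phi> i t \<partial>O.L)\<^sup>2)
           + q * (\<integral>t. (\<Sum>j=1..n. a j * (\<phi> j t)\<^sup>2)\<^sup>2 \<partial>O.L))" for a
    unfolding Z_def by (rule O.stochastic_integrals_bound(2)) (use sm \<phi>b X in auto)
  show "(\<integral>\<^sup>+y. ennreal ((\<Sum>j=1..n. x j * e j y)\<^sup>2) \<partial>P) \<le> ennreal (s / real n * (\<Sum>j=1..n. (x j)\<^sup>2))"
  proof -
    have "(\<Sum>j=1..n. x j * e j y) = (\<Sum>j=1..n. x j / N * Z j y)" for y
      by (intro sum.cong refl) (simp add: eZ)
    then have "(\<integral>\<^sup>+y. ennreal ((\<Sum>j=1..n. x j * e j y)\<^sup>2) \<partial>P) \<le> ennreal (s * (\<integral>t. (\<Sum>j=1..n. x j / N * \<phi> j t)\<^sup>2 \<partial>O.L))"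
      using sb1[of "\<lambda>j. x j / N"] by (simp only:)
    also have "(\<integral>t. (\<Sum>j=1..n. x j / N * \<phi> j t)\<^sup>2 \<partial>O.L) = (\<Sum>j=1..n. (x j)\<^sup>2) / N"
    proof -
      have ii: "integrable O.L (\<lambda>t. \<phi> i t * \<phi> j t)" if "i \<ge> 1" "j \<ge> 1" for i j
        unfolding N_def by (rule periodic_integral(1)[OF periodic1_mult[OF \<phi>(2) \<phi>(2)] L2_unit_mult[OF L2 L2]]) (use that in auto)
      have "(\<integral>t. (\<Sum>j=1..n. x j / N * \<phi> j t)\<^sup>2 \<partial>O.L) = (\<integral>t. (\<Sum>i=1..n. \<Sum>j=1..n. x i / N * (x j / N) * (\<phi> i t * \<phi> j t)) \<partial>O.L)"
        unfolding power2_eq_square sum_product by (intro Bochner_Integration.integral_cong sum.cong refl) simp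
      also have "\<dots> = (\<Sum>i=1..n. \<Sum>j=1..n. x i / N * (x j / N) * (\<integral>t. \<phi> i t * \<phi> j t \<partial>O.L))"
        using ii by (subst Bochner_Integration.integral_sum, force, intro sum.cong refl, subst Bochner_Integration.integral_sum) auto
      also have "\<dots> = (\<Sum>i=1..n. \<Sum>j=1..n. if i = j then (x i)\<^sup>2 / N else 0)"
        using N by (intro sum.cong refl) (auto simp: ip power2_eq_square)
      also have "\<dots> = (\<Sum>i=1..n. (x i)\<^sup>2 / N)" by (intro sum.cong refl) auto
      finally show ?thesis by (simp add: sum_divide_distrib)
    qed
    finally show ?thesis by (simp add: N_def)
  qed
  define k4 where "k4 = (\<integral>x. x ^ 4 \<partial>\<nu>)"
  have k4: "0 \<le> k4" unfolding k4_def by simp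
  define A where "A = (\<Sum>j=1..n. (x j)\<^sup>2)"
  have A0: "0 \<le> A" unfolding A_def by (simp add: sum_nonneg)
  show "(\<integral>\<^sup>+y. ennreal ((\<Sum>j=1..n. x j * ((e j y)\<^sup>2 - s / real n))\<^sup>2) \<partial>P)
      \<le> ennreal ((2 + (\<integral>x. x ^ 4 \<partial>\<nu>)) * (1 + \<phi>b ^ 4) * (s / real n)\<^sup>2 * (\<Sum>j=1..n. (x j)\<^sup>2))"
    unfolding k4_def[symmetric] A_def[symmetric]
  proof -
    have "(\<Sum>j=1..n. x j * ((e j y)\<^sup>2 - s / real n)) = (\<Sum>j=1..n. x j / N\<^sup>2 * ((Z j y)\<^sup>2 - s * (\<integral>t. (\<phi> j t)\<^sup>2 \<partial>O.L)))" for y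
    proof (intro sum.cong refl)
      fix j assume j: "j \<in> {1..n}"
      then have "(\<integral>t. (\<phi> j t)\<^sup>2 \<partial>O.L) = N" using ip[of j j] by (simp add: power2_eq_square)
      then show "x j * ((e j y)\<^sup>2 - s / real n) = x j / N\<^sup>2 * ((Z j y)\<^sup>2 - s * (\<integral>t. (\<phi> j t)\<^sup>2 \<partial>O.L))"
        unfolding eZ[OF j] N_def[symmetric] using N by (simp add: power_divide field_simps power2_eq_square)
    qed
    then have "(\<integral>\<^sup>+y. ennreal ((\<Sum>j=1..n. x j * ((e j y)\<^sup>2 - s / real n))\<^sup>2) \<partial>P)
      \<le> ennreal (2 * s\<^sup>2 * (\<Sum>j=1..n. \<Sum>i=1..n. x j / N\<^sup>2 * (x i / N\<^sup>2) * (\<integral>t. \<phi> j t * \<phi> i t \<partial>O.L)\<^sup>2)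
           + q * (\<integral>t. (\<Sum>j=1..n. x j / N\<^sup>2 * (\<phi> j t)\<^sup>2)\<^sup>2 \<partial>O.L))"
      using sb2[of "\<lambda>j. x j / N\<^sup>2"] by (simp only:)
    also have "\<dots> \<le> ennreal ((2 + k4) * (1 + \<phi>b ^ 4) * (s / real n)\<^sup>2 * A)"
    proof (rule ennreal_leI)
      have "(\<Sum>j=1..n. \<Sum>i=1..n. x j / N\<^sup>2 * (x i / N\<^sup>2) * (\<integral>t. \<phi> j t * \<phi> i t \<partial>O.L)\<^sup>2)
         = (\<Sum>j=1..n. \<Sum>i=1..n. if j = i then (x j)\<^sup>2 / N\<^sup>2 else 0)"
        using N by (intro sum.cong refl) (auto simp: ip power2_eq_square)
      also have "\<dots> = (\<Sum>j=1..n. (x j)\<^sup>2 / N\<^sup>2)" by (intro sum.cong refl) auto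
      finally have e1: "(\<Sum>j=1..n. \<Sum>i=1..n. x j / N\<^sup>2 * (x i / N\<^sup>2) * (\<integral>t. \<phi> j t * \<phi> i t \<partial>O.L)\<^sup>2) = A / N\<^sup>2"
        unfolding A_def by (simp add: sum_divide_distrib)
      \<comment> \<open>Cauchy-Schwarz on n summands costs a factor n, integration over [0,n]
        another one; against N^4 from the squared weights this leaves the order 1 / n^2 of the
        diagonal term.\<close>
      have pw: "(\<Sum>j=1..n. x j / N\<^sup>2 * (\<phi> j t)\<^sup>2)\<^sup>2 \<le> \<phi>b ^ 4 * A / N ^ 3" for t
      proof -
        have p2: "(\<phi> j t)\<^sup>2 \<le> \<phi>b\<^sup>2" if "j \<in> {1..n}" for j
        proof -
          have "\<bar>\<phi> j t\<bar>\<^sup>2 \<le> \<phi>b\<^sup>2" by (rule power_mono[OF \<phi>b[OF that]]) simp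
          then show ?thesis by simp
        qed
        have "\<bar>\<Sum>j=1..n. x j / N\<^sup>2 * (\<phi> j t)\<^sup>2\<bar> \<le> (\<Sum>j=1..n. \<bar>x j\<bar> / N\<^sup>2 * \<phi>b\<^sup>2)"
        proof (rule order_trans[OF sum_abs sum_mono])
          fix j assume j: "j \<in> {1..n}"
          have "\<bar>x j / N\<^sup>2 * (\<phi> j t)\<^sup>2\<bar> = \<bar>x j\<bar> / N\<^sup>2 * (\<phi> j t)\<^sup>2" by (simp add: abs_mult)
          also have "\<dots> \<le> \<bar>x j\<bar> / N\<^sup>2 * \<phi>b\<^sup>2" by (rule mult_left_mono[OF p2[OF j]]) simp
          finally show "\<bar>x j / N\<^sup>2 * (\<phi> j t)\<^sup>2\<bar> \<le> \<bar>x j\<bar> / N\<^sup>2 * \<phi>b\<^sup>2" .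
        qed
        also have "\<dots> = (\<phi>b\<^sup>2 / N\<^sup>2) * (\<Sum>j=1..n. \<bar>x j\<bar>)"
          unfolding sum_distrib_left by (intro sum.cong refl) simp
        finally have "\<bar>\<Sum>j=1..n. x j / N\<^sup>2 * (\<phi> j t)\<^sup>2\<bar>\<^sup>2 \<le> ((\<phi>b\<^sup>2 / N\<^sup>2) * (\<Sum>j=1..n. \<bar>x j\<bar>))\<^sup>2"
          by (rule power_mono) simp
        also have "\<dots> = (\<phi>b\<^sup>2 / N\<^sup>2)\<^sup>2 * (\<Sum>j=1..n. \<bar>x j\<bar>)\<^sup>2" by (rule power_mult_distrib)
        also have "\<dots> \<le> (\<phi>b\<^sup>2 / N\<^sup>2)\<^sup>2 * (N * A)"
          unfolding A_def N_def using sum_abs_power2_le[of x "{1..n}"] by (intro mult_left_mono) auto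
        also have "\<dots> = \<phi>b ^ 4 * A / N ^ 3"
          using N by (simp add: power_divide field_simps eval_nat_numeral)
        finally show ?thesis by simp
      qed
      have "(\<integral>t. (\<Sum>j=1..n. x j / N\<^sup>2 * (\<phi> j t)\<^sup>2)\<^sup>2 \<partial>O.L) \<le> (\<integral>t. \<phi>b ^ 4 * A / N ^ 3 \<partial>O.L)"
      proof (rule integral_mono')
        show "integrable O.L (\<lambda>t. \<phi>b ^ 4 * A / N ^ 3)"
          by (rule O.bounded_integrable[where B="\<bar>\<phi>b ^ 4 * A / N ^ 3\<bar>"]) auto
        show "(\<Sum>j=1..n. x j / N\<^sup>2 * (\<phi> j t)\<^sup>2)\<^sup>2 \<le> \<phi>b ^ 4 * A / N ^ 3" for t by (rule pw)
        show "0 \<le> \<phi>b ^ 4 * A / N ^ 3" using A0 N by simp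
      qed
      also have "\<dots> = \<phi>b ^ 4 * A / N\<^sup>2"
        using N by (simp add: measure_restrict_space power2_eq_square power3_eq_cube)
      finally have e2: "(\<integral>t. (\<Sum>j=1..n. x j / N\<^sup>2 * (\<phi> j t)\<^sup>2)\<^sup>2 \<partial>O.L) \<le> \<phi>b ^ 4 * A / N\<^sup>2" .
      \<comment> \<open>Since \<open>\<sigma>\<^sub>2\<^sup>2\<close> is at most \<open>s\<close>,
        the jump part can be measured in units of s^2 as well.\<close>
      have q: "q \<le> s\<^sup>2 * k4"
      proof -
        have "(\<sigma>\<^sub>2\<^sup>2)\<^sup>2 \<le> s\<^sup>2" unfolding s_def by (intro power_mono) auto
        then show ?thesis unfolding q_def k4_def[symmetric] using k4 by (intro mult_right_mono) (auto simp flip: power_mult)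
      qed
      have B0: "0 \<le> \<phi>b ^ 4 * A / N\<^sup>2" using A0 by simp
      have "2 * s\<^sup>2 * (\<Sum>j=1..n. \<Sum>i=1..n. x j / N\<^sup>2 * (x i / N\<^sup>2) * (\<integral>t. \<phi> j t * \<phi> i t \<partial>O.L)\<^sup>2)
           + q * (\<integral>t. (\<Sum>j=1..n. x j / N\<^sup>2 * (\<phi> j t)\<^sup>2)\<^sup>2 \<partial>O.L) \<le> 2 * s\<^sup>2 * (A / N\<^sup>2) + s\<^sup>2 * k4 * (\<phi>b ^ 4 * A / N\<^sup>2)"
        unfolding e1
        by (intro add_left_mono order_trans[OF mult_left_mono[OF e2 O.q] mult_right_mono[OF q B0]])
      also have "\<dots> = (2 + k4 * \<phi>b ^ 4) * (s / N)\<^sup>2 * A"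
        using N by (simp add: field_simps power_divide)
      also have "\<dots> \<le> (2 + k4) * (1 + \<phi>b ^ 4) * (s / N)\<^sup>2 * A"
      proof -
        have "0 \<le> \<phi>b ^ 4" by (rule zero_le_even_power) simp
        then have "2 + k4 * \<phi>b ^ 4 \<le> (2 + k4) * (1 + \<phi>b ^ 4)" using k4 by (simp add: algebra_simps)
        then show ?thesis using A0 by (intro mult_right_mono) auto
      qed
      finally show "2 * s\<^sup>2 * (\<Sum>j=1..n. \<Sum>i=1..n. x j / N\<^sup>2 * (x i / N\<^sup>2) * (\<integral>t. \<phi> j t * \<phi> i t \<partial>O.L)\<^sup>2)
           + q * (\<integral>t. (\<Sum>j=1..n. x j / N\<^sup>2 * (\<phi> j t)\<^sup>2)\<^sup>2 \<partial>O.L) \<le> (2 + k4) * (1 + \<phi>b ^ 4) * (s / real n)\<^sup>2 * A"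
        unfolding N_def .
    qed
    finally show "(\<integral>\<^sup>+y. ennreal ((\<Sum>j=1..n. x j * ((e j y)\<^sup>2 - s / real n))\<^sup>2) \<partial>P)
      \<le> ennreal ((2 + k4) * (1 + \<phi>b ^ 4) * (s / real n)\<^sup>2 * A)" .
  qed
qed

section \<open>The oracle inequality\<close>

text \<open>Young's inequality with weight k. For b = 0 the quotient is 0 by convention, and the
  second hypothesis makes the left side vanish too.\<close>

lemma double_abs_le:
  fixes b M k :: real
  assumes "0 \<le> b" "b = 0 \<Longrightarrow> M = 0" "0 < k"
  shows "2 * \<bar>M\<bar> \<le> k * b + M\<^sup>2 / b / k"
proof (cases "b = 0")
  case False
  then have b: "0 < b" using assms(1) by simp
  have "0 \<le> (k * b - \<bar>M\<bar>)\<^sup>2 / (k * b)" using assms b by simp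
  also have "(k * b - \<bar>M\<bar>)\<^sup>2 / (k * b) = k * b + M\<^sup>2 / b / k - 2 * \<bar>M\<bar>"
    using b assms(3) by (simp add: field_simps power2_eq_square)
  finally show ?thesis by simp
qed (use assms in simp)

text \<open>The squared bias of the weighted estimate before shrinkage, within the first n
  coefficients; the part of the signal beyond them is common to all weights and is added
  later.\<close>

definition bias :: "nat \<Rightarrow> (nat \<Rightarrow> real) \<Rightarrow> (nat \<Rightarrow> real) \<Rightarrow> real" where
  "bias n \<theta> l = (\<Sum>j=1..n. ((1 - l j) * \<theta> j)\<^sup>2)"

text \<open>
  Here \<open>e\<close> is the vector of errors of the empirical coefficients and \<open>s\<close> their variance. If a
  denominator vanishes then so does its numerator, and the quotient is 0 as it should be.
\<close>

definition remainder :: "nat \<Rightarrow> (nat \<Rightarrow> real) \<Rightarrow> real \<Rightarrow> (nat \<Rightarrow> real) \<Rightarrow> real \<Rightarrow> (nat \<Rightarrow> real) \<Rightarrow> real" where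
  "remainder n \<theta> s l c e = 20 * c\<^sup>2
     + 4 * ((\<Sum>j=1..n. (1 - l j) * \<theta> j * e j)\<^sup>2 / bias n \<theta> l)
     + 4 * ((\<Sum>j=1..n. l j * (1 - l j) * \<theta> j * e j)\<^sup>2 / bias n \<theta> l)
     + 8 * ((\<Sum>j=1..n. l j * ((e j)\<^sup>2 - s))\<^sup>2 / (s * (\<Sum>j=1..n. (l j)\<^sup>2)))
     + 2 * ((\<Sum>j=1..n. (l j)\<^sup>2 * ((e j)\<^sup>2 - s))\<^sup>2 / (s * (\<Sum>j=1..n. (l j)\<^sup>2)))"

text \<open>The loss \<open>E\<close> is the unpenalised cost plus \<open>U\<close>, a variance
  error and two sums free of the weight, which cancel when weights are compared; \<open>h\<close>
  stands for the estimated variance of one coefficient. \<open>R1\<close> is the loss of precision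
  in recovering bias and variance from \<open>E\<close>, and \<open>R2\<close> collects the terms of
  Young's inequality that carry 1 / \<delta>.\<close>

lemma weight_bounds:
  fixes \<theta> e l :: "nat \<Rightarrow> real" and c s \<delta> :: real
  assumes l: "\<And>j. j \<in> {1..n} \<Longrightarrow> 0 \<le> l j \<and> l j \<le> 1" and d: "1 \<le> d" "d \<le> n"
    and l1: "\<And>j. j \<in> {1..d} \<Longrightarrow> l j = 1" and s: "0 < s" and \<delta>: "0 < \<delta>" "\<delta> < 1/2"
    and t: "\<And>j. j \<in> {1..n} \<Longrightarrow> ts j = (1 - (if 1 \<le> j \<and> j \<le> d then c / sqrt (\<Sum>i=1..d. (\<theta> i + e i)\<^sup>2) else 0)) * (\<theta> j + e j)"
  defines "E \<equiv> \<Sum>j=1..n. (l j * ts j - \<theta> j)\<^sup>2"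
  shows "\<exists>U R1 R2. 0 \<le> R1 \<and> 0 \<le> R2 \<and> R1 + R2 = remainder n \<theta> s l c e \<and>
     s * (\<Sum>j=1..n. (l j)\<^sup>2) \<le> 4 * E + R1 \<and> \<bar>U\<bar> \<le> \<delta> * E + \<delta> / 4 * R1 + R2 / \<delta> \<and>
     (\<forall>h. E = (\<Sum>j=1..n. (l j)\<^sup>2 * (ts j)\<^sup>2) - 2 * (\<Sum>j=1..n. l j * (ts j * (\<theta> j + e j) - h))
        + U + 2 * (s - h) * (\<Sum>j=1..n. l j) + (\<Sum>j=1..n. (\<theta> j)\<^sup>2) + 2 * (\<Sum>j=1..n. \<theta> j * e j))"
proof -
  define g where "g = (\<lambda>j. if 1 \<le> j \<and> j \<le> d then c / sqrt (\<Sum>i=1..d. (\<theta> i + e i)\<^sup>2) else 0)"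
  define z where "z = (\<lambda>j. l j * g j * (\<theta> j + e j))"
  define M1 M2 where "M1 = (\<Sum>j=1..n. (1 - l j) * \<theta> j * e j)" and "M2 = (\<Sum>j=1..n. l j * (1 - l j) * \<theta> j * e j)"
  define B1 B2 where "B1 = (\<Sum>j=1..n. l j * ((e j)\<^sup>2 - s))" and "B2 = (\<Sum>j=1..n. (l j)\<^sup>2 * ((e j)\<^sup>2 - s))"
  define b V W D where "b = bias n \<theta> l" and "V = s * (\<Sum>j=1..n. (l j)\<^sup>2)"
    and "W = (\<Sum>j=1..n. (l j * e j)\<^sup>2)" and "D = (\<Sum>j=1..n. z j * (l j * e j))"
  have b0: "0 \<le> b" unfolding b_def bias_def by (simp add: sum_nonneg)
  have W0: "0 \<le> W" unfolding W_def by (simp add: sum_nonneg)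
  have V0: "0 < V"
  proof -
    have "(l 1)\<^sup>2 \<le> (\<Sum>j=1..n. (l j)\<^sup>2)" by (rule member_le_sum) (use d in auto)
    then have "0 < (\<Sum>j=1..n. (l j)\<^sup>2)" using l1[of 1] d by simp
    then show ?thesis unfolding V_def using s by simp
  qed
  have WV: "W = V + B2"
    unfolding W_def V_def B2_def
    by (simp add: power_mult_distrib right_diff_distrib sum_subtractf sum_distrib_left mult.commute)
  have tz: "l j * ts j = l j * (\<theta> j + e j) - z j" if "j \<in> {1..n}" for j
    using t[OF that] unfolding z_def g_def by (simp add: left_diff_distrib right_diff_distrib mult_ac)
  \<comment> \<open>The shrinkage displaces the estimate by a vector of length c in the direction of
    the first d coefficients. If these all vanish, so does the vector.\<close>
  have zz: "(\<Sum>j=1..n. (z j)\<^sup>2) \<le> c\<^sup>2"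
  proof -
    define R where "R = (\<Sum>i=1..d. (\<theta> i + e i)\<^sup>2)"
    have R0: "0 \<le> R" unfolding R_def by (simp add: sum_nonneg)
    have "(\<Sum>j=1..n. (z j)\<^sup>2) = (\<Sum>j=1..d. (z j)\<^sup>2)"
      by (rule sum.mono_neutral_right) (use d in \<open>auto simp: z_def g_def\<close>)
    also have "\<dots> = (\<Sum>j=1..d. (c / sqrt R)\<^sup>2 * (\<theta> j + e j)\<^sup>2)"
    proof (intro sum.cong refl)
      fix j assume "j \<in> {1..d}"
      then have "z j = c / sqrt R * (\<theta> j + e j)" by (simp add: z_def g_def R_def l1)
      then show "(z j)\<^sup>2 = (c / sqrt R)\<^sup>2 * (\<theta> j + e j)\<^sup>2" by (simp only: power_mult_distrib)
    qed
    also have "\<dots> = (c / sqrt R)\<^sup>2 * R" unfolding R_def sum_distrib_left ..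
    also have "\<dots> \<le> c\<^sup>2" using R0 by (cases "R = 0") (auto simp: power_divide)
    finally show ?thesis .
  qed
  have D2: "D\<^sup>2 \<le> c\<^sup>2 * W"
    unfolding D_def W_def
    by (rule order_trans[OF Cauchy_Schwarz_ineq_sum mult_right_mono[OF zz]]) (simp add: sum_nonneg)
  \<comment> \<open>\<open>z\<close> lives on the first d indices, where the weight is 1; the factor
    \<open>l j\<close> can thus be inserted freely, which lets \<open>W\<close> control
    \<open>D\<close>.\<close>
  have Dz: "D = (\<Sum>j=1..n. z j * e j)"
    unfolding D_def
  proof (intro sum.cong refl)
    fix j show "z j * (l j * e j) = z j * e j"
      by (cases "1 \<le> j \<and> j \<le> d") (auto simp: z_def g_def l1)
  qed
  have M1b: "M1\<^sup>2 \<le> b * (\<Sum>j=1..n. (e j)\<^sup>2)"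
    unfolding M1_def b_def bias_def by (rule Cauchy_Schwarz_ineq_sum)
  have M2b: "M2\<^sup>2 \<le> b * W"
    unfolding M2_def b_def bias_def W_def
    using Cauchy_Schwarz_ineq_sum[of "\<lambda>j. (1 - l j) * \<theta> j" "\<lambda>j. l j * e j" "{1..n}"] by (simp add: mult_ac)
  \<comment> \<open>The sum of l \<theta> e is split into the weight-free sum of \<theta> e minus
    \<open>M1\<close>; the coefficient 1 - l left in \<open>M1\<close> is the one that the bias can
    absorb.\<close>
  define U where "U = - 2 * M1 + 2 * B1 - 2 * D"
  define R1 where "R1 = 4 * c\<^sup>2 + 4 * (M2\<^sup>2 / b) + B2\<^sup>2 / V"
  define R2 where "R2 = 16 * c\<^sup>2 + 4 * (M1\<^sup>2 / b) + 8 * (B1\<^sup>2 / V) + B2\<^sup>2 / V"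
  have "0 \<le> R1" "0 \<le> R2" unfolding R1_def R2_def using b0 V0 by auto
  moreover have "R1 + R2 = remainder n \<theta> s l c e"
    unfolding R1_def R2_def remainder_def M1_def M2_def B1_def B2_def b_def V_def by simp
  moreover have bV: "b + V \<le> 4 * E + R1"
  proof -
    \<comment> \<open>The loss without shrinkage. It equals b - 2 M2 + W, which by Young's
      inequality is at least half of b + V up to remainders, while it exceeds 2 E by at most 2
      c^2.\<close>
    define G where "G = (\<Sum>j=1..n. (l j * (\<theta> j + e j) - \<theta> j)\<^sup>2)"
    have "G = (\<Sum>j=1..n. ((1 - l j) * \<theta> j)\<^sup>2 - 2 * (l j * (1 - l j) * \<theta> j * e j) + (l j * e j)\<^sup>2)"
      unfolding G_def by (intro sum.cong refl) algebra
    also have "\<dots> = b - 2 * M2 + W"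
      unfolding b_def bias_def M2_def W_def by (simp add: sum.distrib sum_subtractf sum_distrib_left)
    finally have G: "G = b - 2 * M2 + W" .
    have "G \<le> (\<Sum>j=1..n. 2 * (l j * ts j - \<theta> j)\<^sup>2 + 2 * (z j)\<^sup>2)"
      unfolding G_def
    proof (rule sum_mono)
      fix j assume j: "j \<in> {1..n}"
      have "(u + v)\<^sup>2 \<le> 2 * u\<^sup>2 + 2 * v\<^sup>2" for u v :: real
        using sum_squares_bound[of u v] by (simp add: power2_sum)
      from this[of "l j * ts j - \<theta> j" "z j"]
      show "(l j * (\<theta> j + e j) - \<theta> j)\<^sup>2 \<le> 2 * (l j * ts j - \<theta> j)\<^sup>2 + 2 * (z j)\<^sup>2"
        using tz[OF j] by simp
    qed
    also have "\<dots> = 2 * E + 2 * (\<Sum>j=1..n. (z j)\<^sup>2)"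
      unfolding E_def by (simp add: sum.distrib sum_distrib_left)
    finally have "G \<le> 2 * E + 2 * c\<^sup>2" using zz by simp
    moreover have "2 * \<bar>M2\<bar> \<le> 1/2 * b + M2\<^sup>2 / b / (1/2)"
      by (rule double_abs_le) (use b0 M2b in auto)
    moreover have "2 * \<bar>B2\<bar> \<le> 1 * V + B2\<^sup>2 / V / 1"
      by (rule double_abs_le) (use V0 in auto)
    ultimately show ?thesis unfolding R1_def G WV by (simp add: abs_if split: if_splits)
  qed
  moreover have "V \<le> 4 * E + R1" using bV b0 by simp
  \<comment> \<open>The shares are chosen to add up: \<delta> / 4 of \<open>b\<close> for
    \<open>M1\<close>, and \<delta> / 8 of \<open>V\<close> for each of \<open>B1\<close> and
    \<open>D\<close>. Together they give \<delta> / 4 (b + V), at most \<delta> E + \<delta> / 4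
    R1.\<close>
  moreover have "\<bar>U\<bar> \<le> \<delta> * E + \<delta> / 4 * R1 + R2 / \<delta>"
  proof -
    have m1: "2 * \<bar>M1\<bar> \<le> \<delta> / 4 * b + M1\<^sup>2 / b / (\<delta> / 4)"
      by (rule double_abs_le) (use b0 M1b \<delta> in auto)
    have b1: "2 * \<bar>B1\<bar> \<le> \<delta> / 8 * V + B1\<^sup>2 / V / (\<delta> / 8)"
      by (rule double_abs_le) (use V0 \<delta> in auto)
    have "2 * \<bar>D\<bar> \<le> \<delta> / 16 * W + D\<^sup>2 / W / (\<delta> / 16)"
      by (rule double_abs_le) (use W0 D2 \<delta> in auto)
    moreover have "D\<^sup>2 / W \<le> c\<^sup>2" using D2 W0 by (cases "W = 0") (auto simp: divide_le_eq)
    then have "D\<^sup>2 / W / (\<delta> / 16) \<le> c\<^sup>2 / (\<delta> / 16)" using \<delta> by (intro divide_right_mono) auto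
    \<comment> \<open>The random quantity \<open>W\<close> is replaced by \<open>V\<close>; the
      coefficient of the fluctuation is raised from \<delta> / 16 to 1 / \<delta> so that it fits
      into \<open>R2\<close>.\<close>
    moreover have "\<delta> / 16 * W \<le> \<delta> / 8 * V + B2\<^sup>2 / V / \<delta>"
    proof -
      define w where "w = B2\<^sup>2 / V"
      have w0: "0 \<le> w" unfolding w_def using V0 by simp
      have "2 * \<bar>B2\<bar> \<le> 2 * V + B2\<^sup>2 / V / 2" by (rule double_abs_le) (use V0 in auto)
      then have "W \<le> 2 * V + w"
        unfolding WV w_def[symmetric] using V0 w0 abs_ge_self[of B2] by linarith
      then have "\<delta> / 16 * W \<le> \<delta> / 16 * (2 * V + w)" using \<delta> by (intro mult_left_mono) auto
      also have "\<dots> = \<delta> / 8 * V + \<delta> / 16 * w" by (simp add: field_simps)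
      also have "\<delta> / 16 * w \<le> 1 / \<delta> * w"
      proof (rule mult_right_mono)
        have "\<delta> * \<delta> \<le> 1 * 1" using \<delta> by (intro mult_mono) auto
        then show "\<delta> / 16 \<le> 1 / \<delta>" using \<delta> by (simp add: field_simps)
      qed (rule w0)
      finally show ?thesis unfolding w_def by (simp add: mult.commute)
    qed
    ultimately have d1: "2 * \<bar>D\<bar> \<le> \<delta> / 8 * V + B2\<^sup>2 / V / \<delta> + c\<^sup>2 / (\<delta> / 16)" by linarith
    have "\<bar>U\<bar> \<le> 2 * \<bar>M1\<bar> + 2 * \<bar>B1\<bar> + 2 * \<bar>D\<bar>" unfolding U_def by linarith
    also have "\<dots> \<le> \<delta> / 4 * (b + V) + R2 / \<delta>"
      using m1 b1 d1 unfolding R2_def by (simp add: add_divide_distrib distrib_left)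
    also have "\<dots> \<le> \<delta> / 4 * (4 * E + R1) + R2 / \<delta>"
      using bV \<delta> by (intro add_right_mono mult_left_mono) auto
    finally show ?thesis by (simp add: distrib_left)
  qed
  moreover have "E = (\<Sum>j=1..n. (l j)\<^sup>2 * (ts j)\<^sup>2) - 2 * (\<Sum>j=1..n. l j * (ts j * (\<theta> j + e j) - h))
        + U + 2 * (s - h) * (\<Sum>j=1..n. l j) + (\<Sum>j=1..n. (\<theta> j)\<^sup>2) + 2 * (\<Sum>j=1..n. \<theta> j * e j)" for h
  proof -
    have "E = (\<Sum>j=1..n. (l j)\<^sup>2 * (ts j)\<^sup>2 - 2 * (l j * (ts j * (\<theta> j + e j) - h))
        + (- 2 * ((1 - l j) * \<theta> j * e j) + 2 * (l j * ((e j)\<^sup>2 - s)) - 2 * (z j * e j))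
        + 2 * (s - h) * l j + (\<theta> j)\<^sup>2 + 2 * (\<theta> j * e j))"
      unfolding E_def
    proof (intro sum.cong refl)
      fix j assume j: "j \<in> {1..n}"
      have z: "z j = l j * (\<theta> j + e j) - l j * ts j" using tz[OF j] by simp
      show "(l j * ts j - \<theta> j)\<^sup>2 = (l j)\<^sup>2 * (ts j)\<^sup>2 - 2 * (l j * (ts j * (\<theta> j + e j) - h))
        + (- 2 * ((1 - l j) * \<theta> j * e j) + 2 * (l j * ((e j)\<^sup>2 - s)) - 2 * (z j * e j))
        + 2 * (s - h) * l j + (\<theta> j)\<^sup>2 + 2 * (\<theta> j * e j)"
        unfolding z by algebra
    qed
    then show ?thesis
      unfolding U_def M1_def B1_def Dz by (simp only: sum.distrib sum_subtractf sum_distrib_left)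
  qed
  ultimately show ?thesis unfolding V_def by blast
qed

lemma remainder_nonneg:
  assumes "0 \<le> s" shows "0 \<le> remainder n \<theta> s l c e"
proof -
  have b: "0 \<le> bias n \<theta> l" unfolding bias_def by (simp add: sum_nonneg)
  have v: "0 \<le> s * (\<Sum>j=1..n. (l j)\<^sup>2)" using assms by (simp add: sum_nonneg)
  have "0 \<le> x\<^sup>2 / bias n \<theta> l" "0 \<le> x\<^sup>2 / (s * (\<Sum>j=1..n. (l j)\<^sup>2))" for x
    by (rule divide_nonneg_nonneg[OF _ b] divide_nonneg_nonneg[OF _ v], simp)+
  then show ?thesis unfolding remainder_def by (intro add_nonneg_nonneg mult_nonneg_nonneg) simp_all
qed

text \<open>Hypothesis \<open>J\<close> says that \<open>l\<close> is at least as cheap as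
  \<open>l'\<close>. Subtracting the two identities of \<open>weight_bounds\<close> leaves
  \<open>U\<close>, \<open>U'\<close>, the error of \<open>h\<close> and the difference of
  penalties, all absorbable. \<open>K\<close> is the common energy of the signal beyond n.\<close>

lemma weight_comparison:
  fixes \<theta> e l l' :: "nat \<Rightarrow> real" and c c' s h \<delta> L K :: real
  assumes l: "\<And>j. j \<in> {1..n} \<Longrightarrow> 0 \<le> l j \<and> l j \<le> 1" "1 \<le> d" "d \<le> n" "\<And>j. j \<in> {1..d} \<Longrightarrow> l j = 1" "(\<Sum>j=1..n. l j) \<le> L"
    and l': "\<And>j. j \<in> {1..n} \<Longrightarrow> 0 \<le> l' j \<and> l' j \<le> 1" "1 \<le> d'" "d' \<le> n" "\<And>j. j \<in> {1..d'} \<Longrightarrow> l' j = 1" "(\<Sum>j=1..n. l' j) \<le> L"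
    and s: "0 < s" and \<delta>: "0 < \<delta>" "\<delta> < 1/2"
    and t: "\<And>j. j \<in> {1..n} \<Longrightarrow> ts j = (1 - (if 1 \<le> j \<and> j \<le> d then c / sqrt (\<Sum>i=1..d. (\<theta> i + e i)\<^sup>2) else 0)) * (\<theta> j + e j)"
    and t': "\<And>j. j \<in> {1..n} \<Longrightarrow> ts' j = (1 - (if 1 \<le> j \<and> j \<le> d' then c' / sqrt (\<Sum>i=1..d'. (\<theta> i + e i)\<^sup>2) else 0)) * (\<theta> j + e j)"
    and J: "(\<Sum>j=1..n. (l j)\<^sup>2 * (ts j)\<^sup>2) - 2 * (\<Sum>j=1..n. l j * (ts j * (\<theta> j + e j) - h)) + \<delta> * h * (\<Sum>j=1..n. (l j)\<^sup>2)
      \<le> (\<Sum>j=1..n. (l' j)\<^sup>2 * (ts' j)\<^sup>2) - 2 * (\<Sum>j=1..n. l' j * (ts' j * (\<theta> j + e j) - h)) + \<delta> * h * (\<Sum>j=1..n. (l' j)\<^sup>2)"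
    and K: "0 \<le> K"
  shows "(\<Sum>j=1..n. (l j * ts j - \<theta> j)\<^sup>2) + K \<le> (1 + 5 * \<delta>) / (1 - \<delta>) * ((\<Sum>j=1..n. (l' j * ts' j - \<theta> j)\<^sup>2) + K)
     + 2 / \<delta> * (remainder n \<theta> s l c e + remainder n \<theta> s l' c' e) + 5 * L * \<bar>h - s\<bar>"
proof -
  define E E' where "E = (\<Sum>j=1..n. (l j * ts j - \<theta> j)\<^sup>2)" and "E' = (\<Sum>j=1..n. (l' j * ts' j - \<theta> j)\<^sup>2)"
  define a a' q q' where "a = (\<Sum>j=1..n. l j)" and "a' = (\<Sum>j=1..n. l' j)"
    and "q = (\<Sum>j=1..n. (l j)\<^sup>2)" and "q' = (\<Sum>j=1..n. (l' j)\<^sup>2)"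
  have "\<exists>U R1 R2. 0 \<le> R1 \<and> 0 \<le> R2 \<and> R1 + R2 = remainder n \<theta> s l c e \<and>
     s * q \<le> 4 * E + R1 \<and> \<bar>U\<bar> \<le> \<delta> * E + \<delta> / 4 * R1 + R2 / \<delta> \<and>
     (\<forall>h. E = (\<Sum>j=1..n. (l j)\<^sup>2 * (ts j)\<^sup>2) - 2 * (\<Sum>j=1..n. l j * (ts j * (\<theta> j + e j) - h))
        + U + 2 * (s - h) * a + (\<Sum>j=1..n. (\<theta> j)\<^sup>2) + 2 * (\<Sum>j=1..n. \<theta> j * e j))"
    unfolding E_def a_def q_def by (rule weight_bounds[where d=d and c=c]; fact l s \<delta> t)
  then obtain U R1 R2 where R: "0 \<le> R1" "0 \<le> R2" "R1 + R2 = remainder n \<theta> s l c e"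
    and U: "\<bar>U\<bar> \<le> \<delta> * E + \<delta> / 4 * R1 + R2 / \<delta>"
    and IA: "\<forall>h. E = (\<Sum>j=1..n. (l j)\<^sup>2 * (ts j)\<^sup>2) - 2 * (\<Sum>j=1..n. l j * (ts j * (\<theta> j + e j) - h))
        + U + 2 * (s - h) * a + (\<Sum>j=1..n. (\<theta> j)\<^sup>2) + 2 * (\<Sum>j=1..n. \<theta> j * e j)"
    by (elim exE conjE) (rule that)
  have "\<exists>U R1 R2. 0 \<le> R1 \<and> 0 \<le> R2 \<and> R1 + R2 = remainder n \<theta> s l' c' e \<and>
     s * q' \<le> 4 * E' + R1 \<and> \<bar>U\<bar> \<le> \<delta> * E' + \<delta> / 4 * R1 + R2 / \<delta> \<and>
     (\<forall>h. E' = (\<Sum>j=1..n. (l' j)\<^sup>2 * (ts' j)\<^sup>2) - 2 * (\<Sum>j=1..n. l' j * (ts' j * (\<theta> j + e j) - h))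
        + U + 2 * (s - h) * a' + (\<Sum>j=1..n. (\<theta> j)\<^sup>2) + 2 * (\<Sum>j=1..n. \<theta> j * e j))"
    unfolding E'_def a'_def q'_def by (rule weight_bounds[where d=d' and c=c']; fact l' s \<delta> t')
  then obtain U' R1' R2' where R': "0 \<le> R1'" "0 \<le> R2'" "R1' + R2' = remainder n \<theta> s l' c' e"
    and V': "s * q' \<le> 4 * E' + R1'"
    and U': "\<bar>U'\<bar> \<le> \<delta> * E' + \<delta> / 4 * R1' + R2' / \<delta>"
    and IA': "\<forall>h. E' = (\<Sum>j=1..n. (l' j)\<^sup>2 * (ts' j)\<^sup>2) - 2 * (\<Sum>j=1..n. l' j * (ts' j * (\<theta> j + e j) - h))
        + U' + 2 * (s - h) * a' + (\<Sum>j=1..n. (\<theta> j)\<^sup>2) + 2 * (\<Sum>j=1..n. \<theta> j * e j)"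
    by (elim exE conjE) (rule that)
  note I = spec[OF IA, of h] and I' = spec[OF IA', of h]
  define x where "x = \<bar>h - s\<bar>"
  have x0: "0 \<le> x" unfolding x_def by simp
  have E0: "0 \<le> E" "0 \<le> E'" unfolding E_def E'_def by (simp_all add: sum_nonneg)
  have aq: "0 \<le> a" "a \<le> L" "0 \<le> a'" "a' \<le> L" "0 \<le> q" "q \<le> L" "0 \<le> q'" "q' \<le> L"
  proof -
    show "0 \<le> a" "0 \<le> a'" "0 \<le> q" "0 \<le> q'" unfolding a_def a'_def q_def q'_def using l(1) l'(1) by (auto intro!: sum_nonneg)
    show "a \<le> L" "a' \<le> L" unfolding a_def a'_def by fact+
    have "q \<le> a" unfolding q_def a_def using l(1) by (intro sum_mono) (simp add: power2_eq_square mult_left_le)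
    then show "q \<le> L" using \<open>a \<le> L\<close> by simp
    have "q' \<le> a'" unfolding q'_def a'_def using l'(1) by (intro sum_mono) (simp add: power2_eq_square mult_left_le)
    then show "q' \<le> L" using \<open>a' \<le> L\<close> by simp
  qed
  have xa: "2 * (s - h) * (a - a') \<le> 2 * (L * x)"
  proof -
    have "(s - h) * (a - a') \<le> \<bar>s - h\<bar> * \<bar>a - a'\<bar>" by (simp flip: abs_mult)
    also have "\<dots> \<le> x * L" unfolding x_def using aq by (intro mult_mono) auto
    finally have "2 * ((s - h) * (a - a')) \<le> 2 * (x * L)" by linarith
    then show ?thesis by (simp only: mult.assoc mult.commute[of L x])
  qed
  \<comment> \<open>The penalty of \<open>l'\<close> costs \<delta> s q', at most 4 \<delta> E' plus
    a remainder; with \<delta> E' from \<open>U'\<close> this makes the 5 \<delta> in the numerator.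
    The denominator 1 - \<delta> comes from \<delta> E in the bound for \<open>U\<close>.\<close>
  have hq: "\<delta> * h * (q' - q) \<le> \<delta> * (s * q') + \<delta> * (L * x)"
  proof -
    have "(h - s) * (q' - q) \<le> \<bar>h - s\<bar> * \<bar>q' - q\<bar>" by (simp flip: abs_mult)
    also have "\<dots> \<le> x * L" unfolding x_def using aq by (intro mult_mono) auto
    finally have "(h - s) * (q' - q) \<le> L * x" by (simp add: mult.commute)
    moreover have "s * (q' - q) \<le> s * q'" using s aq by (intro mult_left_mono) auto
    ultimately have "h * (q' - q) \<le> s * q' + L * x" by (simp add: algebra_simps)
    then have "\<delta> * (h * (q' - q)) \<le> \<delta> * (s * q' + L * x)" using \<delta> by (intro mult_left_mono) auto
    then show ?thesis by (simp add: distrib_left mult.assoc)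
  qed
  have Lx: "0 \<le> L * x" using aq x0 by simp
  have "E - E' \<le> \<bar>U\<bar> + \<bar>U'\<bar> + 2 * (s - h) * (a - a') + \<delta> * h * (q' - q)"
    using J I I' abs_ge_self[of U] abs_ge_minus_self[of U'] unfolding q_def[symmetric] q'_def[symmetric]
    by (simp add: algebra_simps)
  also have "\<dots> \<le> (\<delta> * E + \<delta> / 4 * R1 + R2 / \<delta>) + (\<delta> * E' + \<delta> / 4 * R1' + R2' / \<delta>) + 2 * (L * x) + (\<delta> * (4 * E' + R1') + \<delta> * (L * x))"
    using U U' xa hq mult_left_mono[OF V', of \<delta>] \<delta> by linarith
  finally have 1: "(1 - \<delta>) * E \<le> (1 + 5 * \<delta>) * E' + (\<delta> / 4 * R1 + R2 / \<delta> + \<delta> / 4 * R1' + R2' / \<delta> + \<delta> * R1') + (2 + \<delta>) * (L * x)"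
    by (simp add: algebra_simps)
  \<comment> \<open>The remainder \<open>R1'\<close> occurs with \<delta> / 4 from \<open>U'\<close>
    and with \<delta> from the penalty; both together stay below the 1 / \<delta> carried by
    \<open>R2'\<close>.\<close>
  have dd: "\<delta> / 4 + \<delta> \<le> 1 / \<delta>"
  proof -
    have "\<delta> * \<delta> \<le> 1/2 * (1/2)" using \<delta> by (intro mult_mono) auto
    then show ?thesis using \<delta> by (simp add: field_simps)
  qed
  have "(\<delta> / 4 + \<delta>) * R1' \<le> 1 / \<delta> * R1'" by (rule mult_right_mono[OF dd R'(1)])
  moreover have "\<delta> / 4 * R1 \<le> 1 / \<delta> * R1" using dd \<delta> by (intro mult_right_mono R(1)) linarith
  moreover have "(\<delta> / 4 + \<delta>) * R1' = \<delta> / 4 * R1' + \<delta> * R1'" by (rule distrib_right)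
  moreover have "1 / \<delta> * (R1 + R2 + (R1' + R2')) = 1 / \<delta> * R1 + R2 / \<delta> + 1 / \<delta> * R1' + R2' / \<delta>"
    by (simp add: add_divide_distrib)
  ultimately have 2: "\<delta> / 4 * R1 + R2 / \<delta> + \<delta> / 4 * R1' + R2' / \<delta> + \<delta> * R1' \<le> 1 / \<delta> * (remainder n \<theta> s l c e + remainder n \<theta> s l' c' e)"
    unfolding R(3)[symmetric] R'(3)[symmetric] by linarith
  define Y where "Y = 1 / \<delta> * (remainder n \<theta> s l c e + remainder n \<theta> s l' c' e)"
  have Y0: "0 \<le> Y" unfolding Y_def using remainder_nonneg[of s] s \<delta> by simp
  have "(2 + \<delta>) * (L * x) \<le> 5 / 2 * (L * x)" using \<delta> Lx by (intro mult_right_mono) auto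
  then have "(1 - \<delta>) * E \<le> (1 + 5 * \<delta>) * E' + Y + 5 / 2 * (L * x)" using 1 2 unfolding Y_def by linarith
  \<comment> \<open>The leading factor is at least 1, so the common term may be added on both
    sides.\<close>
  moreover have "(1 - \<delta>) * K \<le> (1 + 5 * \<delta>) * K" using K \<delta> by (intro mult_right_mono) auto
  ultimately have 3: "(1 - \<delta>) * (E + K) \<le> (1 + 5 * \<delta>) * (E' + K) + (Y + 5 / 2 * (L * x))"
    by (simp add: distrib_left)
  have "E + K \<le> ((1 + 5 * \<delta>) * (E' + K) + (Y + 5 / 2 * (L * x))) / (1 - \<delta>)"
    using 3 \<delta> by (simp add: pos_le_divide_eq mult.commute)
  also have "\<dots> = (1 + 5 * \<delta>) / (1 - \<delta>) * (E' + K) + 1 / (1 - \<delta>) * (Y + 5 / 2 * (L * x))"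
    using add_divide_distrib[of "(1 + 5 * \<delta>) * (E' + K)" "Y + 5 / 2 * (L * x)" "1 - \<delta>"]
    by (simp only: times_divide_eq_left mult_1)
  \<comment> \<open>As \<delta> < 1/2 the reciprocal is below 2; this turns 1 / \<delta> into 2 /
    \<delta> and 5 / 2 into 5.\<close>
  also have "1 / (1 - \<delta>) * (Y + 5 / 2 * (L * x)) \<le> 2 * (Y + 5 / 2 * (L * x))"
    using \<delta> Y0 Lx by (intro mult_right_mono) (auto simp: field_simps)
  finally show ?thesis unfolding E_def E'_def Y_def x_def by simp
qed

section \<open>Expectation of the remainder and conclusion\<close>

lemma nn_integral_quotient_le:
  fixes F :: "'a \<Rightarrow> real"
  assumes F: "F \<in> borel_measurable M" and le: "(\<integral>\<^sup>+y. ennreal ((F y)\<^sup>2) \<partial>M) \<le> ennreal B"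
    and d: "0 \<le> d" and B: "B \<le> t * d" and k: "0 \<le> k" and t: "0 \<le> t"
  shows "(\<integral>\<^sup>+y. ennreal (k * ((F y)\<^sup>2 / d)) \<partial>M) \<le> ennreal (k * t)"
proof -
  have "(\<integral>\<^sup>+y. ennreal (k * ((F y)\<^sup>2 / d)) \<partial>M) = (\<integral>\<^sup>+y. ennreal (k / d) * ennreal ((F y)\<^sup>2) \<partial>M)"
    using k d by (intro nn_integral_cong) (simp add: ennreal_mult[symmetric])
  also have "\<dots> = ennreal (k / d) * (\<integral>\<^sup>+y. ennreal ((F y)\<^sup>2) \<partial>M)"
    using F by (intro nn_integral_cmult) measurable
  also have "\<dots> \<le> ennreal (k / d) * ennreal (t * d)"
    by (intro mult_left_mono order_trans[OF le ennreal_leI[OF B]]) simp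
  also have "\<dots> = ennreal (k / d * (t * d))" by (rule ennreal_mult[symmetric]) (use k d t in auto)
  also have "\<dots> \<le> ennreal (k * t)" using k t by (intro ennreal_leI) (cases "d = 0", auto)
  finally show ?thesis .
qed

text \<open>Every quotient divides a squared form by a quantity to which its second moment is
  proportional, so the signal drops out and a multiple of \<open>s\<close> remains. For the forms
  with l^2 and l (1 - l) this uses that weights are at most 1.\<close>

lemma remainder_expectation:
  fixes e :: "nat \<Rightarrow> 'a \<Rightarrow> real"
  assumes P: "prob_space P" and em: "\<And>j. j \<in> {1..n} \<Longrightarrow> e j \<in> borel_measurable P" and s: "0 < s" and G: "0 \<le> G"
    and l: "\<And>j. j \<in> {1..n} \<Longrightarrow> 0 \<le> l j \<and> l j \<le> 1"
    and F1: "\<And>x. (\<integral>\<^sup>+y. ennreal ((\<Sum>j=1..n. x j * e j y)\<^sup>2) \<partial>P) \<le> ennreal (s * (\<Sum>j=1..n. (x j)\<^sup>2))"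
    and F2: "\<And>x. (\<integral>\<^sup>+y. ennreal ((\<Sum>j=1..n. x j * ((e j y)\<^sup>2 - s))\<^sup>2) \<partial>P) \<le> ennreal (G * s\<^sup>2 * (\<Sum>j=1..n. (x j)\<^sup>2))"
  shows "(\<lambda>y. remainder n \<theta> s l c (\<lambda>j. e j y)) \<in> borel_measurable P"
    and "(\<integral>\<^sup>+y. ennreal (remainder n \<theta> s l c (\<lambda>j. e j y)) \<partial>P) \<le> ennreal (20 * c\<^sup>2 + 8 * s + 10 * (G * s))"
proof -
  interpret prob_space P by fact
  define b V where "b = bias n \<theta> l" and "V = s * (\<Sum>j=1..n. (l j)\<^sup>2)"
  define M1 M2 where "M1 = (\<lambda>y. \<Sum>j=1..n. (1 - l j) * \<theta> j * e j y)" and "M2 = (\<lambda>y. \<Sum>j=1..n. l j * (1 - l j) * \<theta> j * e j y)"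
  define B1 B2 where "B1 = (\<lambda>y. \<Sum>j=1..n. l j * ((e j y)\<^sup>2 - s))" and "B2 = (\<lambda>y. \<Sum>j=1..n. (l j)\<^sup>2 * ((e j y)\<^sup>2 - s))"
  have m: "M1 \<in> borel_measurable P" "M2 \<in> borel_measurable P" "B1 \<in> borel_measurable P" "B2 \<in> borel_measurable P"
    unfolding M1_def M2_def B1_def B2_def
    by (intro borel_measurable_sum borel_measurable_times borel_measurable_const borel_measurable_diff borel_measurable_power em; assumption)+
  have rem: "remainder n \<theta> s l c (\<lambda>j. e j y) = 20 * c\<^sup>2 + 4 * ((M1 y)\<^sup>2 / b) + 4 * ((M2 y)\<^sup>2 / b) + 8 * ((B1 y)\<^sup>2 / V) + 2 * ((B2 y)\<^sup>2 / V)" for y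
    unfolding remainder_def M1_def M2_def B1_def B2_def b_def V_def ..
  show "(\<lambda>y. remainder n \<theta> s l c (\<lambda>j. e j y)) \<in> borel_measurable P"
    unfolding rem using m by measurable
  have b0: "0 \<le> b" unfolding b_def bias_def by (simp add: sum_nonneg)
  have V0: "0 \<le> V" unfolding V_def using s by (simp add: sum_nonneg)
  have f1: "(\<integral>\<^sup>+y. ennreal ((M1 y)\<^sup>2) \<partial>P) \<le> ennreal (s * (\<Sum>j=1..n. ((1 - l j) * \<theta> j)\<^sup>2))"
    and f2: "(\<integral>\<^sup>+y. ennreal ((M2 y)\<^sup>2) \<partial>P) \<le> ennreal (s * (\<Sum>j=1..n. (l j * (1 - l j) * \<theta> j)\<^sup>2))"
    and f3: "(\<integral>\<^sup>+y. ennreal ((B1 y)\<^sup>2) \<partial>P) \<le> ennreal (G * s\<^sup>2 * (\<Sum>j=1..n. (l j)\<^sup>2))"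
    and f4: "(\<integral>\<^sup>+y. ennreal ((B2 y)\<^sup>2) \<partial>P) \<le> ennreal (G * s\<^sup>2 * (\<Sum>j=1..n. ((l j)\<^sup>2)\<^sup>2))"
    unfolding M1_def M2_def B1_def B2_def by (rule F1 F2)+
  have i1: "(\<integral>\<^sup>+y. ennreal (4 * ((M1 y)\<^sup>2 / b)) \<partial>P) \<le> ennreal (4 * s)"
    by (rule nn_integral_quotient_le[OF m(1) f1 b0])
      (use s in \<open>auto simp: b_def bias_def\<close>)
  have i2: "(\<integral>\<^sup>+y. ennreal (4 * ((M2 y)\<^sup>2 / b)) \<partial>P) \<le> ennreal (4 * s)"
  proof (rule nn_integral_quotient_le[OF m(2) f2 b0])
    have "(\<Sum>j=1..n. (l j * (1 - l j) * \<theta> j)\<^sup>2) \<le> b"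
      unfolding b_def bias_def
    proof (rule sum_mono)
      fix j assume j: "j \<in> {1..n}"
      have "(l j)\<^sup>2 * ((1 - l j) * \<theta> j)\<^sup>2 \<le> 1 * ((1 - l j) * \<theta> j)\<^sup>2"
        using l[OF j] by (intro mult_right_mono) (auto simp: power_le_one)
      then show "(l j * (1 - l j) * \<theta> j)\<^sup>2 \<le> ((1 - l j) * \<theta> j)\<^sup>2" by (simp add: power_mult_distrib mult.assoc)
    qed
    then show "s * (\<Sum>j=1..n. (l j * (1 - l j) * \<theta> j)\<^sup>2) \<le> s * b" using s by (intro mult_left_mono) auto
  qed (use s in auto)
  have i3: "(\<integral>\<^sup>+y. ennreal (8 * ((B1 y)\<^sup>2 / V)) \<partial>P) \<le> ennreal (8 * (G * s))"
    by (rule nn_integral_quotient_le[OF m(3) f3 V0])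
      (use s G in \<open>auto simp: V_def power2_eq_square\<close>)
  have i4: "(\<integral>\<^sup>+y. ennreal (2 * ((B2 y)\<^sup>2 / V)) \<partial>P) \<le> ennreal (2 * (G * s))"
  proof (rule nn_integral_quotient_le[OF m(4) f4 V0])
    have "(\<Sum>j=1..n. ((l j)\<^sup>2)\<^sup>2) \<le> (\<Sum>j=1..n. (l j)\<^sup>2)"
    proof (rule sum_mono)
      fix j assume j: "j \<in> {1..n}"
      have "(l j)\<^sup>2 \<le> 1" using l[OF j] by (simp add: power_le_one)
      then have "(l j)\<^sup>2 * (l j)\<^sup>2 \<le> (l j)\<^sup>2" by (rule mult_left_le) simp
      then show "((l j)\<^sup>2)\<^sup>2 \<le> (l j)\<^sup>2" by (simp only: power2_eq_square[of "(l j)\<^sup>2"])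
    qed
    then have "G * s\<^sup>2 * (\<Sum>j=1..n. ((l j)\<^sup>2)\<^sup>2) \<le> G * s\<^sup>2 * (\<Sum>j=1..n. (l j)\<^sup>2)" using G by (intro mult_left_mono) auto
    also have "\<dots> = G * s * V" unfolding V_def by (simp add: power2_eq_square)
    finally show "G * s\<^sup>2 * (\<Sum>j=1..n. ((l j)\<^sup>2)\<^sup>2) \<le> G * s * V" .
  qed (use s G in auto)
  have "(\<integral>\<^sup>+y. ennreal (remainder n \<theta> s l c (\<lambda>j. e j y)) \<partial>P)
     = (\<integral>\<^sup>+y. ennreal (20 * c\<^sup>2) + ennreal (4 * ((M1 y)\<^sup>2 / b)) + ennreal (4 * ((M2 y)\<^sup>2 / b))
         + ennreal (8 * ((B1 y)\<^sup>2 / V)) + ennreal (2 * ((B2 y)\<^sup>2 / V)) \<partial>P)"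
    unfolding rem using b0 V0 by (intro nn_integral_cong) simp
  also have "\<dots> = ennreal (20 * c\<^sup>2) + (\<integral>\<^sup>+y. ennreal (4 * ((M1 y)\<^sup>2 / b)) \<partial>P) + (\<integral>\<^sup>+y. ennreal (4 * ((M2 y)\<^sup>2 / b)) \<partial>P)
         + (\<integral>\<^sup>+y. ennreal (8 * ((B1 y)\<^sup>2 / V)) \<partial>P) + (\<integral>\<^sup>+y. ennreal (2 * ((B2 y)\<^sup>2 / V)) \<partial>P)"
    using m by (simp add: nn_integral_add emeasure_space_1)
  also have "\<dots> \<le> ennreal (20 * c\<^sup>2) + ennreal (4 * s) + ennreal (4 * s) + ennreal (8 * (G * s)) + ennreal (2 * (G * s))"
    by (intro add_mono order_refl i1 i2 i3 i4)
  also have "\<dots> = ennreal (20 * c\<^sup>2 + 4 * s + 4 * s + 8 * (G * s) + 2 * (G * s))"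
    using s G by (simp add: ennreal_plus[symmetric] del: ennreal_plus)
  also have "20 * c\<^sup>2 + 4 * s + 4 * s + 8 * (G * s) + 2 * (G * s) = 20 * c\<^sup>2 + 8 * s + 10 * (G * s)" by simp
  finally show "(\<integral>\<^sup>+y. ennreal (remainder n \<theta> s l c (\<lambda>j. e j y)) \<partial>P) \<le> ennreal (20 * c\<^sup>2 + 8 * s + 10 * (G * s))" .
qed

theorem theorem4p1:
  fixes \<nu> :: "real measure"
    and \<phi> :: "nat \<Rightarrow> real \<Rightarrow> real"
    and \<phi>bar \<sigma>low \<sigma>up r :: "nat \<Rightarrow> real"
    and \<Lambda> :: "nat \<Rightarrow> (nat \<Rightarrow> real) set"
    and d :: "nat \<Rightarrow> (nat \<Rightarrow> real) \<Rightarrow> nat"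
    and c :: "nat \<Rightarrow> (nat \<Rightarrow> real) \<Rightarrow> real"
  assumes "levy_measure \<nu>"
    and "\<And>n. n \<ge> 1 \<Longrightarrow> 0 < \<sigma>low n \<and> \<sigma>low n \<le> \<sigma>up n"
    and "\<And>\<epsilon>. \<epsilon> > 0 \<Longrightarrow> liminf (\<lambda>n. ereal (real n powr \<epsilon> * \<sigma>low n)) > 0"
    and "\<And>\<epsilon>. \<epsilon> > 0 \<Longrightarrow> (\<lambda>n. real n powr (- \<epsilon>) * \<sigma>up n) \<longlonglongrightarrow> 0"
    and "orthonormal_basis_unit \<phi>"
    and "\<And>j. j \<ge> 1 \<Longrightarrow> periodic1 (\<phi> j)"
    and "\<And>n j t. 1 \<le> j \<Longrightarrow> j \<le> n \<Longrightarrow> 0 \<le> t \<Longrightarrow> t \<le> 1 \<Longrightarrow> \<bar>\<phi> j t\<bar> \<le> \<phi>bar n"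
    and "\<And>n. n \<ge> 1 \<Longrightarrow> weight_family n (\<Lambda> n) (d n)"
    and "\<And>n. n \<ge> 1 \<Longrightarrow> r n > 0"
    and "filterlim r at_top sequentially"
    and "\<And>\<epsilon>. \<epsilon> > 0 \<Longrightarrow> (\<lambda>n. r n / real n powr \<epsilon>) \<longlonglongrightarrow> 0"
    and "c = (\<lambda>n lam. shrinkage_coef n (\<sigma>low n) (\<sigma>up n) (r n) (d n lam))"
  shows "\<exists>l>0. \<forall>n\<ge>1. \<forall>\<delta>. 0 < \<delta> \<longrightarrow> \<delta> < 1/2 \<longrightarrow>
    (\<forall>\<sigma>\<^sub>1 \<sigma>\<^sub>2 \<sigma> Q S P lam_star.
       noise_law \<nu> (real n) \<sigma>\<^sub>1 \<sigma>\<^sub>2 Q \<longrightarrow>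
       \<sigma>low n \<le> \<sigma>\<^sub>1\<^sup>2 \<longrightarrow> \<sigma> = \<sigma>\<^sub>1\<^sup>2 + \<sigma>\<^sub>2\<^sup>2 \<longrightarrow> \<sigma> \<le> \<sigma>up n \<longrightarrow>
       periodic1 S \<longrightarrow> L2_unit S \<longrightarrow>
       P = observation_law (real n) Q S \<longrightarrow>
       selects_model P n \<phi> (c n) (d n) \<delta> (\<Lambda> n) lam_star \<longrightarrow>
       risk P (\<lambda>y. S_star P n \<phi> (c n) (d n) (lam_star y) y) S
         \<le> ennreal ((1 + 5 * \<delta>) / (1 - \<delta>))
             * Min ((\<lambda>lam. risk P (S_star P n \<phi> (c n) (d n) lam) S) ` \<Lambda> n)
           + ennreal (l * (Psi n (\<phi>bar n) \<sigma> (\<Lambda> n) (c n) / (real n * \<delta>)))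
           + ennreal (12 * weight_size n (\<Lambda> n) / real n)
             * (\<integral>\<^sup>+y. ennreal \<bar>sigma_hat P n y - \<sigma>\<bar> \<partial>P))"
proof -
  note low = assms(2) and basis = assms(5) and per = assms(6) and bound = assms(7) and fam = assms(8)
  \<comment> \<open>The factor of \<open>coefficient_bounds\<close>. It depends on the Levy measure
    alone, so the final constant is uniform in n, \<delta>, the noise law and the signal.\<close>
  define C where "C = 2 + (\<integral>x. x ^ 4 \<partial>\<nu>)"
  have C: "2 \<le> C" unfolding C_def by simp
  show ?thesis
  \<comment> \<open>The numbers 28 = 20 + 8 and 10 come from \<open>remainder_expectation\<close>,
    the factor 4 from the coefficient 4 / \<delta> of the summed remainders.\<close>
  proof (intro exI[of _ "4 * (28 + 10 * C)"] conjI allI impI)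
    show "0 < 4 * (28 + 10 * C)" using C by simp
    fix n :: nat and \<delta> \<sigma>\<^sub>1 \<sigma>\<^sub>2 \<sigma> :: real and Q P :: "(real \<Rightarrow> real) measure" and S :: "real \<Rightarrow> real"
      and lam_star :: "(real \<Rightarrow> real) \<Rightarrow> nat \<Rightarrow> real"
    assume n: "1 \<le> n" and \<delta>: "0 < \<delta>" "\<delta> < 1/2" and Q: "noise_law \<nu> (real n) \<sigma>\<^sub>1 \<sigma>\<^sub>2 Q"
      and \<sigma>1: "\<sigma>low n \<le> \<sigma>\<^sub>1\<^sup>2" and \<sigma>: "\<sigma> = \<sigma>\<^sub>1\<^sup>2 + \<sigma>\<^sub>2\<^sup>2" and S: "periodic1 S" "L2_unit S"
      and P: "P = observation_law (real n) Q S"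
      and sel: "selects_model P n \<phi> (c n) (d n) \<delta> (\<Lambda> n) lam_star"
    define s where "s = \<sigma> / real n"
    have \<sigma>0: "0 < \<sigma>" using \<sigma>1 low[OF n] \<sigma> by (smt (verit) zero_le_power2)
    have s0: "0 < s" unfolding s_def using \<sigma>0 n by simp
    define \<theta> where "\<theta> = (\<lambda>j. inner_unit S (\<phi> j))"
    define e where "e = (\<lambda>j y. coef_hat P n \<phi> j y - \<theta> j)"
    define G where "G = C * (1 + \<phi>bar n ^ 4)"
    have b4: "0 \<le> \<phi>bar n ^ 4" by (rule zero_le_even_power) simp
    have G0: "0 \<le> G" unfolding G_def using C b4 by simp
    note cb = coefficient_bounds[where \<phi>=\<phi> and \<phi>b="\<phi>bar n", OF assms(1) n Q S basis per bound[of _ n], folded P \<sigma>]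
    have hat_m: "coef_hat P n \<phi> j \<in> borel_measurable P" if "j \<in> {1..n}" for j
      using cb(1) that by simp
    have em: "e j \<in> borel_measurable P" if "j \<in> {1..n}" for j
      unfolding e_def using hat_m[OF that] by measurable
    have trig_m: "coef_hat P n trig j \<in> borel_measurable P" for j by (rule cb(2))
    interpret prob_space P by (rule cb(3))
    have F1: "(\<integral>\<^sup>+y. ennreal ((\<Sum>j=1..n. x j * e j y)\<^sup>2) \<partial>P) \<le> ennreal (s * (\<Sum>j=1..n. (x j)\<^sup>2))" for x
      unfolding e_def \<theta>_def s_def by (rule cb(4))
    have F2: "(\<integral>\<^sup>+y. ennreal ((\<Sum>j=1..n. x j * ((e j y)\<^sup>2 - s))\<^sup>2) \<partial>P) \<le> ennreal (G * s\<^sup>2 * (\<Sum>j=1..n. (x j)\<^sup>2))" for x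
      unfolding e_def \<theta>_def s_def G_def C_def by (rule cb(5))
    have wf: "finite (\<Lambda> n)" "\<Lambda> n \<noteq> {}"
      and w01: "\<And>l j. l \<in> \<Lambda> n \<Longrightarrow> j \<in> {1..n} \<Longrightarrow> 0 \<le> l j \<and> l j \<le> 1"
      and wd: "\<And>l. l \<in> \<Lambda> n \<Longrightarrow> 1 \<le> d n l" "\<And>l. l \<in> \<Lambda> n \<Longrightarrow> d n l \<le> n"
      and w1: "\<And>l j. l \<in> \<Lambda> n \<Longrightarrow> j \<in> {1..d n l} \<Longrightarrow> l j = 1"
      using fam[OF n] unfolding weight_family_def by (auto simp: PiE_iff subset_iff)
    define W where "W = weight_size n (\<Lambda> n)"
    have wW: "(\<Sum>j=1..n. l j) \<le> W" if "l \<in> \<Lambda> n" for l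
      unfolding W_def weight_size_def using wf that by (intro Max_ge) auto
    have W0: "0 \<le> W"
    proof -
      obtain l where l: "l \<in> \<Lambda> n" using wf by auto
      have "0 \<le> (\<Sum>j=1..n. l j)" using w01[OF l] by (intro sum_nonneg) auto
      then show ?thesis using wW[OF l] by simp
    qed
    define cs where "cs = c_star n (\<Lambda> n) (c n)"
    have ccs: "(c n l)\<^sup>2 \<le> cs / real n" if "l \<in> \<Lambda> n" for l
    proof -
      have "(c n l)\<^sup>2 \<le> Max ((\<lambda>lam. (c n lam)\<^sup>2) ` \<Lambda> n)" using wf that by (intro Max_ge) auto
      then show ?thesis unfolding cs_def c_star_def using n by simp
    qed
    have cs0: "0 \<le> cs"
    proof -
      obtain l where l: "l \<in> \<Lambda> n" using wf by auto
      have "0 \<le> cs / real n" using ccs[OF l] zero_le_power2 order_trans by blast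
      then show ?thesis using n by (simp add: zero_le_divide_iff)
    qed
    \<comment> \<open>Energy of the signal outside the first n coefficients; none of the estimators
      can reduce it.\<close>
    define K where "K = norm2_unit S - (\<Sum>j=1..n. (\<theta> j)\<^sup>2)"
    have K0: "0 \<le> K" unfolding K_def \<theta>_def using norm2_expansion(2)[OF S(2) basis, of n] by simp
    define Err where "Err = (\<lambda>l y. (\<Sum>j=1..n. (l j * coef_star P n \<phi> (c n) (d n) l j y - \<theta> j)\<^sup>2) + K)"
    have Err: "norm2_unit (\<lambda>t. S_star P n \<phi> (c n) (d n) l y t - S t) = Err l y" for l y
      unfolding S_star_def Err_def K_def \<theta>_def by (rule norm2_expansion(1)[OF S(2) basis])
    have Err0: "0 \<le> Err l y" for l y unfolding Err_def using K0 by (simp add: sum_nonneg)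
    have star_eq: "coef_star P n \<phi> (c n) (d n) l j y = (1 - (if 1 \<le> j \<and> j \<le> d n l
        then c n l / sqrt (\<Sum>i=1..d n l. (\<theta> i + e i y)\<^sup>2) else 0)) * (\<theta> j + e j y)" for l j y
      unfolding coef_star_def shrinkage_factor_def e_def by simp
    have Err_m: "Err l \<in> borel_measurable P" if l: "l \<in> \<Lambda> n" for l
    proof -
      have "(\<lambda>y. coef_star P n \<phi> (c n) (d n) l j y) \<in> borel_measurable P" if j: "j \<in> {1..n}" for j
      proof -
        have r: "(\<lambda>y. sqrt (\<Sum>i=1..d n l. (\<theta> i + e i y)\<^sup>2)) \<in> borel_measurable P"
          by (intro measurable_compose[OF _ borel_measurable_sqrt] borel_measurable_sum borel_measurable_power
              borel_measurable_add borel_measurable_const em) (use wd(2)[OF l] in auto)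
        note intros = borel_measurable_times borel_measurable_diff borel_measurable_const borel_measurable_divide
          borel_measurable_add r em[OF j]
        show ?thesis
        proof (cases "1 \<le> j \<and> j \<le> d n l")
          case True
          show ?thesis unfolding star_eq if_P[OF True] by (intro intros)
        next
          case False
          show ?thesis unfolding star_eq if_not_P[OF False] by (intro intros)
        qed
      qed
      then show ?thesis unfolding Err_def by measurable
    qed
    define rem where "rem = (\<lambda>l y. remainder n \<theta> s l (c n l) (\<lambda>j. e j y))"
    have rem0: "0 \<le> rem l y" for l y unfolding rem_def using s0 by (intro remainder_nonneg) simp
    have rem_m: "rem l \<in> borel_measurable P"
      and rem_le: "(\<integral>\<^sup>+y. ennreal (rem l y) \<partial>P) \<le> ennreal (20 * (c n l)\<^sup>2 + 8 * s + 10 * (G * s))" if "l \<in> \<Lambda> n" for l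
      unfolding rem_def using remainder_expectation[OF prob_space_axioms em s0 G0 w01[OF that] F1 F2] by auto
    define h where "h = (\<lambda>y. sigma_hat P n y / real n)"
    have sig_m: "sigma_hat P n \<in> borel_measurable P"
      unfolding sigma_hat_def[abs_def] by (intro borel_measurable_sum borel_measurable_power trig_m)
    define \<alpha> where "\<alpha> = (1 + 5 * \<delta>) / (1 - \<delta>)"
    have \<alpha>0: "0 \<le> \<alpha>" unfolding \<alpha>_def using \<delta> by simp
    have d4: "0 \<le> 4 / \<delta>" and w5: "0 \<le> 5 * W / real n" using \<delta> W0 by auto
    \<comment> \<open>The comparison yields the coefficient 5, which is weakened to the 12 of the
      claim.\<close>
    have w12: "5 * W / real n \<le> 12 * W / real n" using W0 by (intro divide_right_mono) auto
    \<comment> \<open>The selected weight depends on the path, so its remainder has no directly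
      computable mean. The sum over the whole family dominates it and brings in the number of
      weights.\<close>
    define Rem where "Rem = (\<lambda>y. \<Sum>l\<in>\<Lambda> n. rem l y)"
    have Rem0: "0 \<le> Rem y" for y unfolding Rem_def using rem0 by (simp add: sum_nonneg)
    have pointwise: "AE y in P. Err (lam_star y) y \<le> \<alpha> * Err l y + 4 / \<delta> * Rem y + 5 * W / real n * \<bar>sigma_hat P n y - \<sigma>\<bar>"
      if l: "l \<in> \<Lambda> n" for l
    proof -
      have "AE y in P. is_arg_min (\<lambda>lam. selection_cost P n \<phi> (c n) (d n) \<delta> lam y) (\<lambda>lam. lam \<in> \<Lambda> n) (lam_star y)"
        using sel unfolding selects_model_def by simp
      then show ?thesis
      proof eventually_elim
        case (elim y)
        define l0 where "l0 = lam_star y"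
        have l0: "l0 \<in> \<Lambda> n" and J: "selection_cost P n \<phi> (c n) (d n) \<delta> l0 y \<le> selection_cost P n \<phi> (c n) (d n) \<delta> l y"
          using elim l unfolding is_arg_min_def l0_def by (auto simp: not_less)
        have cost: "selection_cost P n \<phi> (c n) (d n) \<delta> lam y = (\<Sum>j=1..n. (lam j)\<^sup>2 * (coef_star P n \<phi> (c n) (d n) lam j y)\<^sup>2)
            - 2 * (\<Sum>j=1..n. lam j * (coef_star P n \<phi> (c n) (d n) lam j y * (\<theta> j + e j y) - h y)) + \<delta> * h y * (\<Sum>j=1..n. (lam j)\<^sup>2)" for lam
          unfolding selection_cost_def e_def h_def by simp
        have "Err l0 y \<le> \<alpha> * Err l y + 2 / \<delta> * (rem l0 y + rem l y) + 5 * W * \<bar>h y - s\<bar>"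
          unfolding Err_def \<alpha>_def rem_def
        proof (rule weight_comparison[where d="d n l0" and d'="d n l" and K=K])
          show "(\<Sum>j=1..n. (l0 j)\<^sup>2 * (coef_star P n \<phi> (c n) (d n) l0 j y)\<^sup>2)
            - 2 * (\<Sum>j=1..n. l0 j * (coef_star P n \<phi> (c n) (d n) l0 j y * (\<theta> j + e j y) - h y)) + \<delta> * h y * (\<Sum>j=1..n. (l0 j)\<^sup>2)
            \<le> (\<Sum>j=1..n. (l j)\<^sup>2 * (coef_star P n \<phi> (c n) (d n) l j y)\<^sup>2)
            - 2 * (\<Sum>j=1..n. l j * (coef_star P n \<phi> (c n) (d n) l j y * (\<theta> j + e j y) - h y)) + \<delta> * h y * (\<Sum>j=1..n. (l j)\<^sup>2)"
            using J unfolding cost .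
        qed (rule star_eq | fact w01[OF l0] wd[OF l0] w1[OF l0] wW[OF l0] w01[OF l] wd[OF l] w1[OF l] wW[OF l] s0 \<delta> K0)+
        \<comment> \<open>The two weights may coincide, so each remainder is bounded by the full sum
          separately; this doubles the factor 2 / \<delta>.\<close>
        moreover have "2 / \<delta> * (rem l0 y + rem l y) \<le> 4 / \<delta> * Rem y"
        proof -
          have "rem l0 y \<le> Rem y" "rem l y \<le> Rem y"
            unfolding Rem_def using wf rem0 l l0 by (auto intro!: member_le_sum)
          then have "2 / \<delta> * (rem l0 y + rem l y) \<le> 2 / \<delta> * (2 * Rem y)" using \<delta> by (intro mult_left_mono) auto
          then show ?thesis by simp
        qed
        moreover have "5 * W * \<bar>h y - s\<bar> = 5 * W / real n * \<bar>sigma_hat P n y - \<sigma>\<bar>"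
          unfolding h_def s_def using n by (simp add: diff_divide_distrib[symmetric] abs_divide)
        ultimately show ?case unfolding l0_def by linarith
      qed
    qed
    have Rem_le: "(\<integral>\<^sup>+y. ennreal (4 / \<delta> * Rem y) \<partial>P)
        \<le> ennreal (4 * (28 + 10 * C) * (Psi n (\<phi>bar n) \<sigma> (\<Lambda> n) (c n) / (real n * \<delta>)))"
    proof -
      \<comment> \<open>A bound for the mean remainder common to all weights. The order 1 / n is
        that of \<open>s\<close> and, by the definition of \<open>c_star\<close>, of the squared
        shrinkage coefficients.\<close>
      define B where "B = (28 + 10 * C) * ((1 + \<phi>bar n ^ 4) * (1 + \<sigma>) * (1 + cs)) / real n"
      have B0: "0 \<le> B" unfolding B_def using C b4 \<sigma>0 cs0 by simp
      have each: "(\<integral>\<^sup>+y. ennreal (rem l y) \<partial>P) \<le> ennreal B" if l: "l \<in> \<Lambda> n" for l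
      proof -
        have "20 * (c n l)\<^sup>2 + 8 * s + 10 * (G * s) \<le> (20 * cs + 8 * \<sigma> + 10 * (G * \<sigma>)) / real n"
          using ccs[OF l] unfolding s_def by (simp add: add_divide_distrib)
        also have "\<dots> \<le> B"
        proof -
          define u where "u = (1 + \<phi>bar n ^ 4) * (1 + \<sigma>) * (1 + cs)"
          have a: "1 \<le> 1 + \<phi>bar n ^ 4" "1 \<le> 1 + \<sigma>" "1 \<le> 1 + cs" using b4 \<sigma>0 cs0 by auto
          have u1: "1 * 1 * (1 + cs) \<le> u" and u2: "1 * (1 + \<sigma>) * 1 \<le> u" and u3: "(1 + \<phi>bar n ^ 4) * (1 + \<sigma>) * 1 \<le> u"
            unfolding u_def using a by (intro mult_mono; auto)+
          have k1: "cs \<le> u" using u1 by simp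
          have k2: "\<sigma> \<le> u" using u2 by simp
          have "(1 + \<phi>bar n ^ 4) * \<sigma> \<le> (1 + \<phi>bar n ^ 4) * (1 + \<sigma>)"
            using b4 by (intro mult_left_mono) simp_all
          then have k3: "(1 + \<phi>bar n ^ 4) * \<sigma> \<le> u" using u3 unfolding mult_1_right by (rule order_trans)
          have k4: "C * ((1 + \<phi>bar n ^ 4) * \<sigma>) \<le> C * u" using k3 C by (intro mult_left_mono) auto
          have "20 * cs + 8 * \<sigma> + 10 * (G * \<sigma>) = 20 * cs + 8 * \<sigma> + 10 * (C * ((1 + \<phi>bar n ^ 4) * \<sigma>))"
            unfolding G_def by (simp add: mult.assoc)
          also have "\<dots> \<le> 20 * u + 8 * u + 10 * (C * u)" using k1 k2 k4 by linarith
          also have "\<dots> = (28 + 10 * C) * u" by (simp add: algebra_simps)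
          finally have "20 * cs + 8 * \<sigma> + 10 * (G * \<sigma>) \<le> (28 + 10 * C) * u" .
          then show ?thesis unfolding B_def u_def[symmetric] by (intro divide_right_mono) auto
        qed
        finally show ?thesis by (rule order_trans[OF rem_le[OF l] ennreal_leI])
      qed
      have "(\<integral>\<^sup>+y. ennreal (4 / \<delta> * Rem y) \<partial>P) = (\<integral>\<^sup>+y. ennreal (4 / \<delta>) * (\<Sum>l\<in>\<Lambda> n. ennreal (rem l y)) \<partial>P)"
        unfolding Rem_def by (intro nn_integral_cong) (subst sum_ennreal, rule rem0, rule ennreal_mult'[OF d4])
      also have "\<dots> = ennreal (4 / \<delta>) * (\<Sum>l\<in>\<Lambda> n. \<integral>\<^sup>+y. ennreal (rem l y) \<partial>P)"
        using rem_m by (subst nn_integral_cmult) (auto simp: nn_integral_sum)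
      also have "\<dots> \<le> ennreal (4 / \<delta>) * (\<Sum>l\<in>\<Lambda> n. ennreal B)"
        by (intro mult_left_mono sum_mono each) simp_all
      also have "(\<Sum>l\<in>\<Lambda> n. ennreal B) = ennreal (real (card (\<Lambda> n)) * B)"
        using B0 by (simp add: ennreal_mult' ennreal_of_nat_eq_real_of_nat)
      also have "ennreal (4 / \<delta>) * ennreal (real (card (\<Lambda> n)) * B) = ennreal (4 / \<delta> * (real (card (\<Lambda> n)) * B))"
        by (rule ennreal_mult'[OF d4, symmetric])
      also have "4 / \<delta> * (real (card (\<Lambda> n)) * B) = 4 * (28 + 10 * C) * (Psi n (\<phi>bar n) \<sigma> (\<Lambda> n) (c n) / (real n * \<delta>))"
        unfolding B_def Psi_def cs_def by (simp add: field_simps)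
      finally show ?thesis .
    qed
    have each: "risk P (\<lambda>y. S_star P n \<phi> (c n) (d n) (lam_star y) y) S
         \<le> ennreal \<alpha> * risk P (S_star P n \<phi> (c n) (d n) l) S
           + ennreal (4 * (28 + 10 * C) * (Psi n (\<phi>bar n) \<sigma> (\<Lambda> n) (c n) / (real n * \<delta>)))
           + ennreal (12 * W / real n) * (\<integral>\<^sup>+y. ennreal \<bar>sigma_hat P n y - \<sigma>\<bar> \<partial>P)" if l: "l \<in> \<Lambda> n" for l
    proof -
      have Rem_m: "Rem \<in> borel_measurable P" unfolding Rem_def using rem_m by measurable
      have "risk P (\<lambda>y. S_star P n \<phi> (c n) (d n) (lam_star y) y) S = (\<integral>\<^sup>+y. ennreal (Err (lam_star y) y) \<partial>P)"
        unfolding risk_def Err ..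
      also have "\<dots> \<le> (\<integral>\<^sup>+y. ennreal \<alpha> * ennreal (Err l y) + ennreal (4 / \<delta> * Rem y) + ennreal (5 * W / real n) * ennreal \<bar>sigma_hat P n y - \<sigma>\<bar> \<partial>P)"
      proof (rule nn_integral_mono_AE)
        show "AE y in P. ennreal (Err (lam_star y) y) \<le> ennreal \<alpha> * ennreal (Err l y) + ennreal (4 / \<delta> * Rem y) + ennreal (5 * W / real n) * ennreal \<bar>sigma_hat P n y - \<sigma>\<bar>"
          using pointwise[OF l]
        proof eventually_elim
          case (elim y)
          have "ennreal (Err (lam_star y) y) \<le> ennreal (\<alpha> * Err l y + 4 / \<delta> * Rem y + 5 * W / real n * \<bar>sigma_hat P n y - \<sigma>\<bar>)"
            by (rule ennreal_leI[OF elim])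
          also have "\<dots> = ennreal (\<alpha> * Err l y) + ennreal (4 / \<delta> * Rem y) + ennreal (5 * W / real n * \<bar>sigma_hat P n y - \<sigma>\<bar>)"
            using \<alpha>0 Err0[of l y] Rem0[of y] \<delta> W0 by (subst ennreal_plus; simp)+
          finally show ?case unfolding ennreal_mult'[OF \<alpha>0] ennreal_mult'[OF w5] .
        qed
      qed
      also have "\<dots> = ennreal \<alpha> * (\<integral>\<^sup>+y. ennreal (Err l y) \<partial>P) + (\<integral>\<^sup>+y. ennreal (4 / \<delta> * Rem y) \<partial>P)
          + ennreal (5 * W / real n) * (\<integral>\<^sup>+y. ennreal \<bar>sigma_hat P n y - \<sigma>\<bar> \<partial>P)"
        using Err_m[OF l] Rem_m sig_m by (simp add: nn_integral_add nn_integral_cmult)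
      also have "\<dots> \<le> ennreal \<alpha> * (\<integral>\<^sup>+y. ennreal (Err l y) \<partial>P)
          + ennreal (4 * (28 + 10 * C) * (Psi n (\<phi>bar n) \<sigma> (\<Lambda> n) (c n) / (real n * \<delta>)))
          + ennreal (12 * W / real n) * (\<integral>\<^sup>+y. ennreal \<bar>sigma_hat P n y - \<sigma>\<bar> \<partial>P)"
        by (rule add_mono[OF add_mono[OF order_refl Rem_le] mult_right_mono[OF ennreal_leI[OF w12]]]) simp
      also have "(\<integral>\<^sup>+y. ennreal (Err l y) \<partial>P) = risk P (S_star P n \<phi> (c n) (d n) l) S"
        unfolding risk_def Err ..
      finally show ?thesis .
    qed
    have "Min ((\<lambda>lam. risk P (S_star P n \<phi> (c n) (d n) lam) S) ` \<Lambda> n) \<in> (\<lambda>lam. risk P (S_star P n \<phi> (c n) (d n) lam) S) ` \<Lambda> n"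
      using wf by (intro Min_in) auto
    then obtain l where l: "l \<in> \<Lambda> n" "Min ((\<lambda>lam. risk P (S_star P n \<phi> (c n) (d n) lam) S) ` \<Lambda> n) = risk P (S_star P n \<phi> (c n) (d n) l) S"
      by auto
    show "risk P (\<lambda>y. S_star P n \<phi> (c n) (d n) (lam_star y) y) S
         \<le> ennreal ((1 + 5 * \<delta>) / (1 - \<delta>))
             * Min ((\<lambda>lam. risk P (S_star P n \<phi> (c n) (d n) lam) S) ` \<Lambda> n)
           + ennreal (4 * (28 + 10 * C) * (Psi n (\<phi>bar n) \<sigma> (\<Lambda> n) (c n) / (real n * \<delta>)))
           + ennreal (12 * weight_size n (\<Lambda> n) / real n)
             * (\<integral>\<^sup>+y. ennreal \<bar>sigma_hat P n y - \<sigma>\<bar> \<partial>P)"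
      using each[OF l(1)] unfolding l(2) \<alpha>_def W_def .
  qed
qed

end
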